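(* Algebras over the $2$-colored operad $\mathsf{Act}_\infty$ are precisely $A_\infty$-actions: for a pair of spaces $(X,P)$ (with $X$ of color $\mathfrak c$ and $P$ of color $\mathfrak o$), an $\mathsf{Act}_\infty$-algebra structure on $(X,P)$ is equivalent to the structure of an $A_\infty$-space on $X$ together with a left $A_\infty$-action of $X$ on $P$, i.e. a unital $A_\infty$-map $X\to\mathrm{End}(P)$.
   Context: Conventions: all spaces are compactly generated, Hausdorff, with non-degenerate base points; products and mapping spaces carry the compactly generated topology; operads are non-symmetric; $x_{i\ldots j}=(x_i,\dots,x_j)$. The operads $\mathsf{Act}$ and $\mathsf{Act}_\infty$. There are two colors $\mathfrak c,\mathfrak o$; $\mathcal P(p,q;\mathrm x)$ is the space of operations with $p$ inputs of color $\mathfrak c$ followed by $q$ inputs of color $\mathfrak o$ and output color $\mathrm x$. $\mathsf{Act}(p,0;\mathfrak c)$ and $\mathsf{Act}(p,1;\mathfrak o)$ are one-point spaces for all $p\ge0$, and all other $\mathsf{Act}(p,q;\mathrm x)$ are empty. $\overline{\mathsf{Act}}$ coincides with $\mathsf{Act}$ except that $\overline{\mathsf{Act}}(0,0;\mathfrak c)=\emptyset$. $W(\overline{\mathsf{Act}})$ is the Boardman–Vogt $W$-construction: classes of planar rooted trees with colored edges, vertices labelled by elements of $\overline{\mathsf{Act}}$ of the appropriate colors, internal edges labelled by lengths in $[0,1]$, modulo: an internal edge of length $0$ is contracted by composing labels; a vertex labelled by an identity is erased, the two adjacent edges being merged (the length being the maximum of the two lengths if both are internal). Composition is grafting, with new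 internal edge of length $1$. Then $\mathsf{Act}_\infty(p,q;\mathrm x)=W(\overline{\mathsf{Act}})(p,q;\mathrm x)$ for $p+q>0$, and $\mathsf{Act}_\infty(0,0;\mathfrak c)=K_0$ is a one-point space $\{\delta_0\}$; composing with $\delta_0$ at a closed leaf erases that leaf (a vertex left with a single input is erased, the two adjacent edges being merged with length the maximum of the lengths, external if one of the two is external). Metric trees. Trees are finite, planar and rooted, with one outgoing external edge (root) and incoming external edges (leaves, numbered left to right); every vertex has at least two incoming edges. $|T|$ is the number of leaves. For $n\ge2$, $K_n$ is the space of trees with $n$ leaves with a length in $[0,1]$ on each internal edge, modulo collapsing internal edges of length $0$ (quotient topology). $K_1=\{\delta_1\}$ (tree with one edge, no vertex), $K_0=\{\delta_0\}$, and $\delta_n$ is the $n$-corolla. $T\circ_iS$ grafts the root of $S$ on the $i$th leaf of $T$, the new edge having length $1$; $\delta_1$ is the identity. $s_i(T)=T\circ_i\delta_0$ erases the $i$th leaf, with the same convention (maximum of lengths) for vertices left with one input. $\mathcal K=\{K_n\}_{n\ge0}$ is the resulting operad. $A_\infty$-space: a $\mathcal K$-algebra, i.e. a space $X$ with maps $M_n:K_n\times X^n\to X$, $n\ge0$, compatible with $\circ_i$ and identity; $e_X=M_0(\delta_0)$. Unital $A_\infty$-map from $X$ to a topological monoid $Y$: maps $f_i:K_{i+1}\times X^i\to Y$, $i\ge1$, such that for $|\rho|,|\tau|\ge2$, $k=|\rho|+|\tau|-2$, $1\le j<|\rho|$: $f_k(\rho\circ_{j+1}\tau;x_{1\ldots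 k})=f_{|\rho|-1}(\rho;x_{1\ldots j-1},M_{|\tau|}(\tau;x_{j\ldots j+|\tau|-1}),x_{j+|\tau|\ldots k})$, $f_k(\rho\circ_1\tau;x_{1\ldots k})=f_{|\tau|-1}(\tau;x_{1\ldots|\tau|-1})\cdot f_{|\rho|-1}(\rho;x_{|\tau|\ldots k})$, and $f_{n-1}(s_{j+1}(\rho);x_{1\ldots n-1})=f_n(\rho;x_{1\ldots j-1},e_X,x_{j\ldots n-1})$ for $n\ge1$, $1\le j\le n$, where $f_0(\delta_1)=e_Y$. $\mathrm{End}(P)$ is the topological monoid of self-maps of $P$ under composition. *)

theory Defs
  imports "HOL-Analysis.Analysis"
begin

section \<open>Compactly generated spaces\<close>

definition quotient_topology :: "'a topology \<Rightarrow> ('a \<Rightarrow> 'b) \<Rightarrow> 'b topology" where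
  "quotient_topology X q =
     topology (\<lambda>U. U \<subseteq> q ` topspace X \<and> openin X {x \<in> topspace X. q x \<in> U})"

lemma openin_quotient_topology:
  "openin (quotient_topology X q) U \<longleftrightarrow>
     U \<subseteq> q ` topspace X \<and> openin X {x \<in> topspace X. q x \<in> U}"
proof -
  have "istopology (\<lambda>U. U \<subseteq> q ` topspace X \<and> openin X {x \<in> topspace X. q x \<in> U})"
    unfolding istopology_def
  proof (intro conjI allI impI)
    fix S T assume "S \<subseteq> q ` topspace X \<and> openin X {x \<in> topspace X. q x \<in> S}"
      and "T \<subseteq> q ` topspace X \<and> openin X {x \<in> topspace X. q x \<in> T}"
    moreover have "{x \<in> topspace X. q x \<in> S \<inter> T} =
        {x \<in> topspace X. q x \<in> S} \<inter> {x \<in> topspace X. q x \<in> T}" by auto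
    ultimately show "S \<inter> T \<subseteq> q ` topspace X" "openin X {x \<in> topspace X. q x \<in> S \<inter> T}"
      by auto
  next
    fix \<K> assume *: "\<forall>V\<in>\<K>. V \<subseteq> q ` topspace X \<and> openin X {x \<in> topspace X. q x \<in> V}"
    then show "\<Union> \<K> \<subseteq> q ` topspace X" by auto
    have "{x \<in> topspace X. q x \<in> \<Union> \<K>} = (\<Union>V\<in>\<K>. {x \<in> topspace X. q x \<in> V})" by auto
    with * show "openin X {x \<in> topspace X. q x \<in> \<Union> \<K>}" by (auto intro: openin_Union)
  qed
  then show ?thesis by (simp add: quotient_topology_def topology_inverse')
qed

text \<open>The compactly generated topology associated with a topology.\<close>

definition kify :: "'a topology \<Rightarrow> 'a topology" where
  "kify X = topology (\<lambda>U. U \<subseteq> topspace X \<and>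
     (\<forall>K. compactin X K \<longrightarrow> openin (subtopology X K) (K \<inter> U)))"

lemma openin_kify:
  "openin (kify X) U \<longleftrightarrow> U \<subseteq> topspace X \<and>
     (\<forall>K. compactin X K \<longrightarrow> openin (subtopology X K) (K \<inter> U))"
proof -
  have "istopology (\<lambda>U. U \<subseteq> topspace X \<and>
     (\<forall>K. compactin X K \<longrightarrow> openin (subtopology X K) (K \<inter> U)))"
    unfolding istopology_def
  proof (rule conjI; intro allI impI)
    fix S T assume S: "S \<subseteq> topspace X \<and> (\<forall>K. compactin X K \<longrightarrow> openin (subtopology X K) (K \<inter> S))"
      and T: "T \<subseteq> topspace X \<and> (\<forall>K. compactin X K \<longrightarrow> openin (subtopology X K) (K \<inter> T))"
    have "K \<inter> (S \<inter> T) = (K \<inter> S) \<inter> (K \<inter> T)" for K by auto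
    with S T show "S \<inter> T \<subseteq> topspace X \<and>
        (\<forall>K. compactin X K \<longrightarrow> openin (subtopology X K) (K \<inter> (S \<inter> T)))"
      by (metis openin_Int le_infI1)
  next
    fix \<K> assume *: "\<forall>V\<in>\<K>. V \<subseteq> topspace X \<and>
        (\<forall>K. compactin X K \<longrightarrow> openin (subtopology X K) (K \<inter> V))"
    have "openin (subtopology X K) (K \<inter> \<Union> \<K>)" if "compactin X K" for K
      unfolding Int_Union using * that by (intro openin_Union) auto
    with * show "\<Union> \<K> \<subseteq> topspace X \<and>
        (\<forall>K. compactin X K \<longrightarrow> openin (subtopology X K) (K \<inter> \<Union> \<K>))" by auto
  qed
  then show ?thesis by (simp add: kify_def topology_inverse')
qed

definition kprod :: "'a topology \<Rightarrow> 'b topology \<Rightarrow> ('a \<times> 'b) topology" where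
  "kprod X Y = kify (prod_topology X Y)"

text \<open>For a word \<open>w\<close> of colors, the product of the spaces \<open>X (w ! i)\<close>; its points are lists.\<close>

definition word_prod :: "('c \<Rightarrow> 'x topology) \<Rightarrow> 'c list \<Rightarrow> 'x list topology" where
  "word_prod X w = kify (pullback_topology {xs. length xs = length w}
     (\<lambda>xs. \<lambda>i\<in>{..<length w}. xs ! i)
     (product_topology (\<lambda>i. X (w ! i)) {..<length w}))"

abbreviation kpower :: "'x topology \<Rightarrow> nat \<Rightarrow> 'x list topology" where
  "kpower X n \<equiv> word_prod (\<lambda>_. X) (replicate n ())"

text \<open>The mapping space: its points are the continuous maps, made canonical outside the domain;
  its topology is the compactly generated one associated with the compact-open topology.\<close>

definition cmaps :: "'a topology \<Rightarrow> 'b topology \<Rightarrow> ('a \<Rightarrow> 'b) set" where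
  "cmaps X Y = {g. continuous_map X Y g \<and> g \<in> extensional (topspace X)}"

definition mapping_space :: "'a topology \<Rightarrow> 'b topology \<Rightarrow> ('a \<Rightarrow> 'b) topology" where
  "mapping_space X Y = kify (topology_generated_by
     {{g \<in> cmaps X Y. g ` K \<subseteq> U} |K U. compactin X K \<and> openin Y U})"

text \<open>A base point is non-degenerate if its inclusion is an NDR-pair.\<close>

definition nondegenerate :: "'a topology \<Rightarrow> 'a \<Rightarrow> bool" where
  "nondegenerate X a \<longleftrightarrow> a \<in> topspace X \<and>
     (\<exists>u h. continuous_map X (top_of_set {0..1::real}) u \<and>
        continuous_map (kprod X (top_of_set {0..1::real})) X h \<and>
        {x \<in> topspace X. u x = 0} = {a} \<and>
        (\<forall>x\<in>topspace X. h (x, 0) = x) \<and>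
        (\<forall>t\<in>{0..1}. h (a, t) = a) \<and>
        (\<forall>x\<in>topspace X. u x < 1 \<longrightarrow> h (x, 1) = a))"

definition cg_space :: "'a topology \<Rightarrow> 'a \<Rightarrow> bool" where
  "cg_space X a \<longleftrightarrow> k_space X \<and> Hausdorff_space X \<and> nondegenerate X a"


section \<open>Colored operads and their algebras\<close>

text \<open>Inputs are numbered from 0: \<open>pcomp T i S\<close> plugs \<open>S\<close> into the \<open>(i+1)\<close>st input of \<open>T\<close>.
  Non-symmetric operads are indexed by words of input colors.\<close>

record ('c, 'a) operad =
  ops :: "'c list \<Rightarrow> 'c \<Rightarrow> 'a topology"
  idop :: "'c \<Rightarrow> 'a"
  pcomp :: "'a \<Rightarrow> nat \<Rightarrow> 'a \<Rightarrow> 'a"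

text \<open>The extensionality clause makes structure maps equal as soon as they agree on their domain.\<close>

definition operad_algebra ::
  "('c, 'a) operad \<Rightarrow> ('c \<Rightarrow> 'x topology) \<Rightarrow> ('c list \<Rightarrow> 'c \<Rightarrow> 'a \<times> 'x list \<Rightarrow> 'x) \<Rightarrow> bool" where
  "operad_algebra Q X act \<longleftrightarrow>
     (\<forall>w x. continuous_map (kprod (ops Q w x) (word_prod X w)) (X x) (act w x) \<and>
            act w x \<in> extensional (topspace (kprod (ops Q w x) (word_prod X w)))) \<and>
     (\<forall>x. \<forall>a\<in>topspace (X x). act [x] x (idop Q x, [a]) = a) \<and>
     (\<forall>u v w x y T S.
        T \<in> topspace (ops Q (u @ [y] @ w) x) \<longrightarrow> S \<in> topspace (ops Q v y) \<longrightarrow>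
        (\<forall>xs\<in>topspace (word_prod X u). \<forall>ys\<in>topspace (word_prod X v). \<forall>zs\<in>topspace (word_prod X w).
           act (u @ v @ w) x (pcomp Q T (length u) S, xs @ ys @ zs) =
           act (u @ [y] @ w) x (T, xs @ [act v y (S, ys)] @ zs)))"


section \<open>Metric trees\<close>

text \<open>Edges carry a color in \<open>'c\<close>, vertices a label in \<open>'a\<close>. A node stores the color and the
  length of its outgoing edge. The root edge is external and has no length: the slot of the root
  vertex holds the dummy value 1 (\<open>root_ext\<close>). This value is chosen so that grafting, which creates
  an internal edge of length 1, is plain substitution, and so that merging edges with the maximum
  of the lengths is also correct if one of the two edges is the root edge.\<close>

datatype ('c, 'a) tree = Leaf 'c | Node 'c real 'a "('c, 'a) tree list"

fun color_of :: "('c, 'a) tree \<Rightarrow> 'c" where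
  "color_of (Leaf c) = c"
| "color_of (Node c l a ts) = c"

fun leaves :: "('c, 'a) tree \<Rightarrow> 'c list" where
  "leaves (Leaf c) = [c]"
| "leaves (Node c l a ts) = concat (map leaves ts)"

fun root_ext :: "('c, 'a) tree \<Rightarrow> bool" where
  "root_ext (Leaf c) \<longleftrightarrow> True"
| "root_ext (Node c l a ts) \<longleftrightarrow> l = 1"

text \<open>\<open>L w x\<close> is the set of labels allowed at a vertex with input colors \<open>w\<close> and output color \<open>x\<close>.\<close>

fun admissible :: "('c list \<Rightarrow> 'c \<Rightarrow> 'a set) \<Rightarrow> ('c, 'a) tree \<Rightarrow> bool" where
  "admissible L (Leaf c) \<longleftrightarrow> True"
| "admissible L (Node c l a ts) \<longleftrightarrow>
     0 \<le> l \<and> l \<le> 1 \<and> a \<in> L (map color_of ts) c \<and> (\<forall>t\<in>set ts. admissible L t)"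

definition mtrees :: "('c list \<Rightarrow> 'c \<Rightarrow> 'a set) \<Rightarrow> ('c, 'a) tree set" where
  "mtrees L = {t. admissible L t \<and> root_ext t}"

text \<open>The space of all trees is the disjoint union, over the combinatorial types (with discrete
  labels), of the cubes of edge lengths: it is embedded into the product of the discrete space of
  combinatorial types and the space of real sequences.\<close>

fun shape :: "('c, 'a) tree \<Rightarrow> ('c, 'a) tree" where
  "shape (Leaf c) = Leaf c"
| "shape (Node c l a ts) = Node c 0 a (map shape ts)"

fun lengths :: "('c, 'a) tree \<Rightarrow> real list" where
  "lengths (Leaf c) = []"
| "lengths (Node c l a ts) = l # concat (map lengths ts)"

definition tree_topology :: "('c, 'a) tree set \<Rightarrow> ('c, 'a) tree topology" where
  "tree_topology A = pullback_topology A
     (\<lambda>t. (shape t, \<lambda>i. if i < length (lengths t) then lengths t ! i else 0))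
     (prod_topology (discrete_topology UNIV) (product_topology (\<lambda>_. euclideanreal) UNIV))"

fun graft :: "('c, 'a) tree \<Rightarrow> nat \<Rightarrow> ('c, 'a) tree \<Rightarrow> ('c, 'a) tree"
  and graft_list :: "('c, 'a) tree list \<Rightarrow> nat \<Rightarrow> ('c, 'a) tree \<Rightarrow> ('c, 'a) tree list" where
  "graft (Leaf c) i s = (if i = 0 then s else Leaf c)"
| "graft (Node c l a ts) i s = Node c l a (graft_list ts i s)"
| "graft_list [] i s = []"
| "graft_list (t # ts) i s =
     (if i < length (leaves t) then graft t i s # ts
      else t # graft_list ts (i - length (leaves t)) s)"

text \<open>\<open>merge l t\<close> is what remains of a vertex with only input \<open>t\<close> and outgoing edge of length \<open>l\<close>.\<close>

fun merge :: "real \<Rightarrow> ('c, 'a) tree \<Rightarrow> ('c, 'a) tree" where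
  "merge l (Leaf c) = Leaf c"
| "merge l (Node c m a ts) = Node c (max l m) a ts"

text \<open>Erasing a leaf; the result \<open>None\<close> means that nothing is left. A vertex without inputs can
  only arise from a vertex with a single input, that is, one labelled by an identity.\<close>

fun erase :: "('c, unit) tree \<Rightarrow> nat \<Rightarrow> ('c, unit) tree option"
  and erase_list :: "('c, unit) tree list \<Rightarrow> nat \<Rightarrow> ('c, unit) tree list" where
  "erase (Leaf c) i = (if i = 0 then None else Some (Leaf c))"
| "erase (Node c l a ts) i =
     (case erase_list ts i of
        [] \<Rightarrow> None
      | [t] \<Rightarrow> Some (merge l t)
      | ts' \<Rightarrow> Some (Node c l () ts'))"
| "erase_list [] i = []"
| "erase_list (t # ts) i =
     (if i < length (leaves t)
      then (case erase t i of None \<Rightarrow> ts | Some t' \<Rightarrow> t' # ts)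
      else t # erase_list ts (i - length (leaves t)))"

text \<open>One elementary identification, performed anywhere in the tree: \<open>cmp\<close> composes labels, and
  \<open>E c\<close> is the set of labels of the vertices of color \<open>c\<close> which are to be erased.\<close>

inductive tree_step ::
  "('a \<Rightarrow> nat \<Rightarrow> 'a \<Rightarrow> 'a) \<Rightarrow> ('c \<Rightarrow> 'a set) \<Rightarrow> ('c, 'a) tree \<Rightarrow> ('c, 'a) tree \<Rightarrow> bool"
  for cmp E where
  contract: "tree_step cmp E (Node c l a (ts @ Node d 0 b us # vs))
                             (Node c l (cmp a (length ts) b) (ts @ us @ vs))"
| unary: "a \<in> E c \<Longrightarrow> color_of t = c \<Longrightarrow> tree_step cmp E (Node c l a [t]) (merge l t)"
| inside: "tree_step cmp E t t' \<Longrightarrow>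
     tree_step cmp E (Node c l a (ts @ t # vs)) (Node c l a (ts @ t' # vs))"

definition tree_equiv ::
  "('c list \<Rightarrow> 'c \<Rightarrow> 'a set) \<Rightarrow> ('a \<Rightarrow> nat \<Rightarrow> 'a \<Rightarrow> 'a) \<Rightarrow> ('c \<Rightarrow> 'a set) \<Rightarrow>
   (('c, 'a) tree \<times> ('c, 'a) tree) set" where
  "tree_equiv L cmp E =
     {(s, t). s \<in> mtrees L \<and> t \<in> mtrees L \<and>
        equivclp (\<lambda>s t. s \<in> mtrees L \<and> t \<in> mtrees L \<and> tree_step cmp E s t) s t}"

definition graft_classes :: "(('c, 'a) tree \<times> ('c, 'a) tree) set \<Rightarrow>
    ('c, 'a) tree set \<Rightarrow> nat \<Rightarrow> ('c, 'a) tree set \<Rightarrow> ('c, 'a) tree set" where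
  "graft_classes R A i B = R `` {graft s i t |s t. s \<in> A \<and> t \<in> B}"

text \<open>Operads in which \<open>None\<close> is the operation \<open>\<delta>\<^sub>0\<close> without inputs.\<close>

fun pcomp_with_delta0 :: "(('c, unit) tree \<times> ('c, unit) tree) set \<Rightarrow>
    ('c, unit) tree set option \<Rightarrow> nat \<Rightarrow> ('c, unit) tree set option \<Rightarrow>
    ('c, unit) tree set option" where
  "pcomp_with_delta0 R (Some A) i (Some B) = Some (graft_classes R A i B)"
| "pcomp_with_delta0 R (Some A) i None =
     (let B = {t. \<exists>s\<in>A. erase s i = Some t} in if B = {} then None else Some (R `` B))"
| "pcomp_with_delta0 R None i B = None"


section \<open>The operads \<open>Act\<close>, \<open>Act\<^sub>\<infinity>\<close> and the operad of metric trees\<close>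

text \<open>The Boardman--Vogt construction, for operads \<open>Q\<close> with discrete spaces of operations.\<close>

definition W_labels :: "('c, 'a) operad \<Rightarrow> 'c list \<Rightarrow> 'c \<Rightarrow> 'a set" where
  "W_labels Q w x = topspace (ops Q w x)"

definition W_equiv :: "('c, 'a) operad \<Rightarrow> (('c, 'a) tree \<times> ('c, 'a) tree) set" where
  "W_equiv Q = tree_equiv (W_labels Q) (pcomp Q) (\<lambda>c. {idop Q c})"

definition W :: "('c, 'a) operad \<Rightarrow> ('c, ('c, 'a) tree set) operad" where
  "W Q = \<lparr>
     ops = (\<lambda>w x. quotient_topology
       (tree_topology {t \<in> mtrees (W_labels Q). leaves t = w \<and> color_of t = x})
       (\<lambda>t. W_equiv Q `` {t})),
     idop = (\<lambda>x. W_equiv Q `` {Leaf x}),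
     pcomp = graft_classes (W_equiv Q)\<rparr>"

datatype color = Closed | Open

definition Act :: "(color, unit) operad" where
  "Act = \<lparr>
     ops = (\<lambda>w x. discrete_topology
       (if (\<exists>p. w = replicate p Closed \<and> x = Closed) \<or>
           (\<exists>p. w = replicate p Closed @ [Open] \<and> x = Open) then {()} else {})),
     idop = (\<lambda>_. ()),
     pcomp = (\<lambda>_ _ _. ())\<rparr>"

definition Act_bar :: "(color, unit) operad" where
  "Act_bar = Act\<lparr>ops :=
     (\<lambda>w x. if w = [] \<and> x = Closed then discrete_topology {} else ops Act w x)\<rparr>"

definition Act_inf :: "(color, (color, unit) tree set option) operad" where
  "Act_inf = \<lparr>
     ops = (\<lambda>w x. if w = [] \<and> x = Closed then discrete_topology {None}
                  else quotient_topology (ops (W Act_bar) w x) Some),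
     idop = (\<lambda>x. Some (idop (W Act_bar) x)),
     pcomp = pcomp_with_delta0 (W_equiv Act_bar)\<rparr>"

text \<open>Metric trees without colors and labels; all vertices have at least two inputs, and no
  vertices are erased in the equivalence relation.\<close>

definition K_labels :: "unit list \<Rightarrow> unit \<Rightarrow> unit set" where
  "K_labels w x = (if length w \<ge> 2 then {()} else {})"

definition K_equiv :: "((unit, unit) tree \<times> (unit, unit) tree) set" where
  "K_equiv = tree_equiv K_labels (\<lambda>_ _ _. ()) (\<lambda>_. {})"

type_synonym kpoint = "(unit, unit) tree set option"

definition K :: "nat \<Rightarrow> kpoint topology" where
  "K n = (if n = 0 then discrete_topology {None}
          else quotient_topology (tree_topology {t \<in> mtrees K_labels. length (leaves t) = n})
                 (\<lambda>t. Some (K_equiv `` {t})))"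

definition delta0 :: kpoint where "delta0 = None"

definition delta1 :: kpoint where "delta1 = Some (K_equiv `` {Leaf ()})"

definition K_comp :: "kpoint \<Rightarrow> nat \<Rightarrow> kpoint \<Rightarrow> kpoint" where
  "K_comp = pcomp_with_delta0 K_equiv"

definition K_operad :: "(unit, kpoint) operad" where
  "K_operad = \<lparr>ops = (\<lambda>w _. K (length w)), idop = (\<lambda>_. delta1), pcomp = K_comp\<rparr>"


section \<open>\<open>A\<^sub>\<infinity>\<close>-spaces and \<open>A\<^sub>\<infinity>\<close>-actions\<close>

definition Ainf_space :: "'x topology \<Rightarrow> (nat \<Rightarrow> kpoint \<times> 'x list \<Rightarrow> 'x) \<Rightarrow> bool" where
  "Ainf_space X M \<longleftrightarrow> operad_algebra K_operad (\<lambda>_. X) (\<lambda>w _. M (length w))"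

text \<open>The numbering of leaves starts at 0, so the leaf \<open>j + 1\<close> of the usual formulas is
  leaf \<open>j = Suc (length xs)\<close> here, where \<open>xs\<close> are the first \<open>j - 1\<close> arguments. The component
  \<open>f 0\<close> is no additional datum, but the map sending the point of \<open>K 1\<close> to the unit.\<close>

definition unital_Ainf_map :: "'x topology \<Rightarrow> (nat \<Rightarrow> kpoint \<times> 'x list \<Rightarrow> 'x) \<Rightarrow>
    'y topology \<Rightarrow> ('y \<Rightarrow> 'y \<Rightarrow> 'y) \<Rightarrow> 'y \<Rightarrow> (nat \<Rightarrow> kpoint \<times> 'x list \<Rightarrow> 'y) \<Rightarrow> bool" where
  "unital_Ainf_map X M Y mul e f \<longleftrightarrow>
     (\<forall>i. continuous_map (kprod (K (Suc i)) (kpower X i)) Y (f i) \<and>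
          f i \<in> extensional (topspace (kprod (K (Suc i)) (kpower X i)))) \<and>
     f 0 (delta1, []) = e \<and>
     (\<forall>r t. 2 \<le> r \<longrightarrow> 2 \<le> t \<longrightarrow>
        (\<forall>\<rho>\<in>topspace (K r). \<forall>\<tau>\<in>topspace (K t).
          (\<forall>j xs ys zs. 1 \<le> j \<longrightarrow> j < r \<longrightarrow> xs \<in> topspace (kpower X (j - 1)) \<longrightarrow>
             ys \<in> topspace (kpower X t) \<longrightarrow> zs \<in> topspace (kpower X (r - 1 - j)) \<longrightarrow>
             f (r + t - 2) (K_comp \<rho> j \<tau>, xs @ ys @ zs) =
             f (r - 1) (\<rho>, xs @ [M t (\<tau>, ys)] @ zs)) \<and>
          (\<forall>ys\<in>topspace (kpower X (t - 1)). \<forall>zs\<in>topspace (kpower X (r - 1)).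
             f (r + t - 2) (K_comp \<rho> 0 \<tau>, ys @ zs) = mul (f (t - 1) (\<tau>, ys)) (f (r - 1) (\<rho>, zs))))) \<and>
     (\<forall>n j xs zs. 1 \<le> j \<longrightarrow> j \<le> n \<longrightarrow>
        xs \<in> topspace (kpower X (j - 1)) \<longrightarrow> zs \<in> topspace (kpower X (n - j)) \<longrightarrow>
        (\<forall>\<rho>\<in>topspace (K (Suc n)).
           f (n - 1) (K_comp \<rho> j delta0, xs @ zs) = f n (\<rho>, xs @ [M 0 (delta0, [])] @ zs)))"

text \<open>A left action of \<open>X\<close> on \<open>P\<close> is a unital map to the monoid of self-maps of \<open>P\<close>.\<close>

definition left_Ainf_action :: "'x topology \<Rightarrow> (nat \<Rightarrow> kpoint \<times> 'x list \<Rightarrow> 'x) \<Rightarrow>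
    'p topology \<Rightarrow> (nat \<Rightarrow> kpoint \<times> 'x list \<Rightarrow> 'p \<Rightarrow> 'p) \<Rightarrow> bool" where
  "left_Ainf_action X M P f \<longleftrightarrow>
     unital_Ainf_map X M (mapping_space P P) (compose (topspace P)) (\<lambda>p\<in>topspace P. p) f"


section \<open>From algebras over \<open>Act\<^sub>\<infinity>\<close> to actions\<close>

text \<open>The pair \<open>(X, P)\<close> as a family indexed by colors, in a common type.\<close>

definition pair_family :: "'x topology \<Rightarrow> 'p topology \<Rightarrow> color \<Rightarrow> ('x + 'p) topology" where
  "pair_family X P = case_color (quotient_topology X Inl) (quotient_topology P Inr)"

fun paint :: "(unit, unit) tree \<Rightarrow> (color, unit) tree" where
  "paint (Leaf c) = Leaf Closed"
| "paint (Node c l a ts) = Node Closed l a (map paint ts)"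

text \<open>In \<open>f\<^sub>n(\<rho>; x\<^sub>1, \<dots>, x\<^sub>n)\<close> the leaf 0 of \<open>\<rho>\<close> is not attached to an argument, and in
  \<open>\<rho> \<circ>\<^sub>1 \<tau>\<close> the tree \<open>\<tau>\<close> acts after \<open>\<rho>\<close>. In terms of operations of \<open>Act\<^sub>\<infinity>\<close> with input colors
  \<open>Closed\<^sup>n Open\<close> this means that leaf 0 becomes the root, and the root becomes the last leaf.
  The edges between the root and leaf 0 become the open ones and are reversed, so the outgoing
  length of a vertex on this path is now that of its first input; \<open>acc\<close> is the part of the
  new tree built so far.\<close>

fun edge_length :: "('c, 'a) tree \<Rightarrow> real" where
  "edge_length (Leaf c) = 1"
| "edge_length (Node c l a ts) = l"

fun reroot_onto :: "(unit, unit) tree \<Rightarrow> (color, unit) tree \<Rightarrow> (color, unit) tree" where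
  "reroot_onto (Node c l a (t # ts)) acc =
     reroot_onto t (Node Open (edge_length t) () (map paint ts @ [acc]))"
| "reroot_onto _ acc = acc"

definition reroot :: "(unit, unit) tree \<Rightarrow> (color, unit) tree" where
  "reroot t = reroot_onto t (Leaf Open)"

definition closed_op :: "kpoint \<Rightarrow> (color, unit) tree set option" where
  "closed_op = map_option (\<lambda>A. W_equiv Act_bar `` (paint ` A))"

definition open_op :: "kpoint \<Rightarrow> (color, unit) tree set option" where
  "open_op = map_option (\<lambda>A. W_equiv Act_bar `` (reroot ` A))"

definition action_of_algebra :: "'x topology \<Rightarrow> 'p topology \<Rightarrow>
    (color list \<Rightarrow> color \<Rightarrow> (color, unit) tree set option \<times> ('x + 'p) list \<Rightarrow> 'x + 'p) \<Rightarrow>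
    (nat \<Rightarrow> kpoint \<times> 'x list \<Rightarrow> 'x) \<times> (nat \<Rightarrow> kpoint \<times> 'x list \<Rightarrow> 'p \<Rightarrow> 'p)" where
  "action_of_algebra X P act =
     (\<lambda>n. \<lambda>(T, xs)\<in>topspace (kprod (K n) (kpower X n)).
        projl (act (replicate n Closed) Closed (closed_op T, map Inl xs)),
      \<lambda>n. \<lambda>(T, xs)\<in>topspace (kprod (K (Suc n)) (kpower X n)). \<lambda>p\<in>topspace P.
        projr (act (replicate n Closed @ [Open]) Open (open_op T, map Inl xs @ [Inr p])))"

end

(* Both operads are quotients of spaces of trees, and everything is checked on representatives.
   An Act_inf-tree has a normal form without unary vertices, since the labels of unary vertices are
   identities. A normal form with closed root is a metric tree with all edges painted closed. In a
   normal form with open root the open edges form a path from the root to the last leaf; reversing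
   this path turns it into a metric tree whose leaf 0 is the former root. Both correspondences
   respect contractions of edges, grafting and erasing of leaves, and change lengths by
   non-expansive maps, hence are homeomorphisms K_n = Act_inf(c^n; c) and
   K_(n+1) = Act_inf(c^n o; o) compatible with compositions. Structure maps of the second kind are
   maps K_(n+1) x X^n x P -> P, which by the exponential law of compactly generated Hausdorff spaces
   are maps K_(n+1) x X^n -> End(P). *)

theory Submission
  imports Defs
begin

section \<open>Words and trees\<close>

text \<open>Identifications can be applied in many orders, yet no confluence argument is needed:
  each map between quotients is defined on all representatives and sends one identification to at
  most one. \<open>normalize\<close> is such a map; it removes only unary vertices and leaves edges
  of length 0 alone, since the spaces \<open>K n\<close> still have to identify those. Erasing is
  the delicate operation, because the vertex at a contracted edge may vanish or become unary
  together with the leaf; the maximum rule then absorbs its length 0. Reversal moves a cut along the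
  path: the traversed part is kept as a tree, and the length of the cut edge is recorded on both
  sides. Both external ends of the path carry the dummy length 1, so root and leaf 0 are exchanged
  without special cases. If erasing makes a path vertex unary, its two path edges merge, and the
  maximum does not depend on the direction in which the path is read. In the exponential law,
  currying uses that \<open>P\<close> is compactly generated, and uncurrying that compact subsets of
  \<open>P\<close> are Hausdorff, hence regular.\<close>

abbreviation full_step :: "('c, unit) tree \<Rightarrow> ('c, unit) tree \<Rightarrow> bool" where
  "full_step \<equiv> tree_step (\<lambda>_ _ _. ()) (\<lambda>_. {()})"

text \<open>The relation behind \<open>K_equiv\<close>. All labels are \<open>()\<close>, so the
  identity vertices that \<open>full_step\<close> erases in addition are recognized by their single
  input of the same color.\<close>

abbreviation contract_step :: "('c, unit) tree \<Rightarrow> ('c, unit) tree \<Rightarrow> bool" where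
  "contract_step \<equiv> tree_step (\<lambda>_ _ _. ()) (\<lambda>_. {})"

abbreviation act_labels :: "color list \<Rightarrow> color \<Rightarrow> unit set" where
  "act_labels \<equiv> W_labels Act_bar"

text \<open>The type of normal forms: it lies between \<open>act_labels\<close> and, after
  forgetting colors, \<open>K_labels\<close>.\<close>

definition reduced_labels :: "color list \<Rightarrow> color \<Rightarrow> unit set" where
  "reduced_labels w x = (if 2 \<le> length w then act_labels w x else {})"

section \<open>Words of colors allowed at a vertex\<close>

lemma ex_replicate_iff: "(\<exists>p. w = replicate p c) \<longleftrightarrow> set w \<subseteq> {c}"
proof
  assume "set w \<subseteq> {c}"
  then have "w = replicate (length w) c" by (intro replicate_eqI) auto
  then show "\<exists>p. w = replicate p c" ..
qed auto

text \<open>Uniform in the output color, which saves most later case distinctions: the words are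
  c...c (at least one letter) for \<open>Closed\<close> and c...co for \<open>Open\<close>.\<close>

lemma in_act_labels:
  "a \<in> act_labels w x \<longleftrightarrow> w \<noteq> [] \<and> last w = x \<and> set (butlast w) \<subseteq> {Closed}"
proof (cases w rule: rev_cases)
  case Nil
  then show ?thesis by (cases x) (simp_all add: W_labels_def Act_bar_def Act_def)
next
  case (snoc v y)
  have 1: "(\<exists>p. w = replicate p Closed @ [Open]) \<longleftrightarrow> y = Open \<and> set v \<subseteq> {Closed}"
    unfolding snoc ex_replicate_iff[symmetric] by blast
  have 2: "(\<exists>p. w = replicate p Closed) \<longleftrightarrow> y = Closed \<and> set v \<subseteq> {Closed}"
    unfolding ex_replicate_iff snoc by auto
  have "a \<in> act_labels w x \<longleftrightarrow> (\<exists>p. w = replicate p Closed) \<and> x = Closed \<or>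
      (\<exists>p. w = replicate p Closed @ [Open]) \<and> x = Open"
    using snoc by (simp add: W_labels_def Act_bar_def Act_def)
  then show ?thesis unfolding 1 2 using snoc by (cases x) auto
qed

text \<open>If \<open>y\<close> is the last letter, then the last color survives because
  \<open>v\<close> ends in \<open>y\<close>; otherwise \<open>y = Closed\<close>, and then all
  letters of \<open>v\<close> are \<open>Closed\<close>.\<close>

lemma act_labels_compose:
  assumes "a \<in> act_labels (u @ y # w) x" "b \<in> act_labels v y"
  shows "c \<in> act_labels (u @ v @ w) x"
proof (cases w rule: rev_cases)
  case Nil
  then show ?thesis using assms by (auto simp: in_act_labels butlast_append)
next
  case (snoc w' z)
  obtain v' where "v = v' @ [y]" "set v' \<subseteq> {Closed}"
    using assms(2) append_butlast_last_id[of v] unfolding in_act_labels by metis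
  then show ?thesis using assms(1) snoc by (simp add: in_act_labels butlast_append)
qed

section \<open>Merging edges\<close>

lemma color_of_merge [simp]: "color_of (merge l t) = color_of t"
  by (cases t) auto

lemma leaves_merge [simp]: "leaves (merge l t) = leaves t"
  by (cases t) auto

lemma merge_merge: "merge l (merge m t) = merge (max l m) t"
  by (cases t) (auto simp: max.assoc)

lemma merge_0: "admissible L t \<Longrightarrow> merge 0 t = t"
  by (cases t) auto

lemma merge_root_ext: "root_ext t \<Longrightarrow> l \<le> 1 \<Longrightarrow> merge l t = t"
  by (cases t) auto

lemma admissible_merge: "admissible L t \<Longrightarrow> 0 \<le> l \<Longrightarrow> l \<le> 1 \<Longrightarrow> admissible L (merge l t)"
  by (cases t) auto

lemma root_ext_merge: "admissible L t \<Longrightarrow> l = 1 \<Longrightarrow> root_ext (merge l t)"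
  by (cases t) auto

section \<open>What elementary identifications preserve\<close>

lemma step_color: "tree_step f E s t \<Longrightarrow> color_of t = color_of s"
  by (induction rule: tree_step.induct) auto

lemma step_leaves: "tree_step f E s t \<Longrightarrow> leaves t = leaves s"
  by (induction rule: tree_step.induct) auto

lemma step_admissible: "tree_step f E s t \<Longrightarrow> admissible act_labels s \<Longrightarrow> admissible act_labels t"
proof (induction rule: tree_step.induct)
  case (contract c l a ts d b us vs)
  then show ?case using act_labels_compose by (fastforce simp del: in_act_labels)
next
  case (unary a c t l)
  then show ?case by (auto intro: admissible_merge)
next
  case (inside t t' c l a ts vs)
  then show ?case by (auto simp: step_color)
qed

lemma step_root_ext: "tree_step f E s t \<Longrightarrow> admissible L s \<Longrightarrow> root_ext s \<Longrightarrow> root_ext t"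
  by (cases rule: tree_step.cases) (auto intro: root_ext_merge)

text \<open>Because of this the side condition on the target tree in \<open>W_equiv\<close> is
  automatic, and a step from an admissible tree is at once an equivalence.\<close>

lemma step_mtrees: "tree_step f E s t \<Longrightarrow> s \<in> mtrees act_labels \<Longrightarrow> t \<in> mtrees act_labels"
  by (auto simp: mtrees_def intro: step_admissible step_root_ext)

lemma step_mono: "tree_step f E s t \<Longrightarrow> (\<And>c. E c \<subseteq> E' c) \<Longrightarrow> tree_step f E' s t"
  by (induction rule: tree_step.induct) (auto intro: tree_step.intros)

text \<open>A step touches the root edge only by another merge, and taking maxima is
  associative.\<close>

lemma step_merge: "tree_step f E s t \<Longrightarrow> tree_step f E (merge l s) (merge l t)"
proof (induction rule: tree_step.induct)
  case (unary a c t m)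
  then show ?case using tree_step.unary[of a E c t f "max l m"] by (simp add: merge_merge)
qed (auto intro: tree_step.intros)

subsection \<open>Grafting and erasing\<close>

lemma graft_list_append:
  "graft_list (ts @ vs) i s =
     (if i < length (concat (map leaves ts)) then graft_list ts i s @ vs
      else ts @ graft_list vs (i - length (concat (map leaves ts))) s)"
  by (induction ts arbitrary: i) auto

lemma erase_list_append:
  "erase_list (ts @ vs) i =
     (if i < length (concat (map leaves ts)) then erase_list ts i @ vs
      else ts @ erase_list vs (i - length (concat (map leaves ts))))"
  by (induction ts arbitrary: i) (auto split: option.split)

text \<open>The grafted tree is taken from \<open>mtrees\<close> because its dummy root length 1
  becomes the length of the new internal edge, or the root length of the result if \<open>s\<close>
  is a bare leaf.\<close>

lemma graft_typed:
  shows "u \<in> mtrees L \<Longrightarrow> i < length (leaves s) \<Longrightarrow> color_of u = leaves s ! i \<Longrightarrow> admissible L s \<Longrightarrow>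
      admissible L (graft s i u) \<and> color_of (graft s i u) = color_of s \<and>
      leaves (graft s i u) = take i (leaves s) @ leaves u @ drop (Suc i) (leaves s) \<and>
      (root_ext s \<longrightarrow> root_ext (graft s i u))"
    and "u \<in> mtrees L \<Longrightarrow> i < length (concat (map leaves ts)) \<Longrightarrow> color_of u = concat (map leaves ts) ! i \<Longrightarrow>
      \<forall>t\<in>set ts. admissible L t \<Longrightarrow>
      (\<forall>t\<in>set (graft_list ts i u). admissible L t) \<and> map color_of (graft_list ts i u) = map color_of ts \<and>
      concat (map leaves (graft_list ts i u)) =
        take i (concat (map leaves ts)) @ leaves u @ drop (Suc i) (concat (map leaves ts))"
proof (induction s i u and ts i u rule: graft_graft_list.induct)
  case (1 c i s)
  then show ?case by (simp add: mtrees_def)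
next
  case (2 c l a ts i s)
  then show ?case by simp
next
  case (3 i s)
  then show ?case by simp
next
  case (4 t ts i s)
  show ?case
  proof (cases "i < length (leaves t)")
    case True
    with 4 show ?thesis by (simp add: nth_append)
  next
    case False
    have "color_of s = concat (map leaves ts) ! (i - length (leaves t))"
      "i - length (leaves t) < length (concat (map leaves ts))"
      using False 4(4,5) by (simp_all add: nth_append less_diff_conv2)
    with 4(2)[OF False 4(3)] 4(6) False show ?thesis by (simp add: Suc_diff_le)
  qed
qed

text \<open>The grafted tree is a subtree of the result. The list version exhibits the child in
  which the step happens, so that \<open>inside\<close> applies.\<close>

lemma graft_step_right:
  shows "tree_step f E u u' \<Longrightarrow> i < length (leaves s) \<Longrightarrow> tree_step f E (graft s i u) (graft s i u')"
    and "tree_step f E u u' \<Longrightarrow> i < length (concat (map leaves ts)) \<Longrightarrow>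
      \<exists>as x y bs. graft_list ts i u = as @ x # bs \<and> graft_list ts i u' = as @ y # bs \<and> tree_step f E x y"
proof (induction s i u and ts i u rule: graft_graft_list.induct)
  case (2 c l a ts i s)
  then obtain as x y bs where "graft_list ts i s = as @ x # bs" "graft_list ts i u' = as @ y # bs" "tree_step f E x y"
    by auto
  then show ?case by (simp add: tree_step.inside)
next
  case (4 t ts i s)
  show ?case
  proof (cases "i < length (leaves t)")
    case True
    then show ?thesis using 4 by (intro exI[of _ "[]"]) auto
  next
    case False
    then have "i - length (leaves t) < length (concat (map leaves ts))" using 4(4) by auto
    from 4(2)[OF False 4(3) this] obtain as x y bs where "graft_list ts (i - length (leaves t)) s = as @ x # bs"
      "graft_list ts (i - length (leaves t)) u' = as @ y # bs" "tree_step f E x y"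
      by auto
    then show ?thesis using False by (intro exI[of _ "t # as"]) auto
  qed
qed auto

text \<open>The critical case is a unary vertex whose input is the very leaf that is replaced:
  erasing it before or after grafting agrees because \<open>u\<close> has root length 1, so merging
  with \<open>l\<close> changes nothing.\<close>

lemma graft_step_left:
  "tree_step (\<lambda>_ _ _. ()) E s t \<Longrightarrow> admissible L s \<Longrightarrow> u \<in> mtrees L \<Longrightarrow>
   i < length (leaves s) \<Longrightarrow> color_of u = leaves s ! i \<Longrightarrow>
   graft s i u = graft t i u \<or> tree_step (\<lambda>_ _ _. ()) E (graft s i u) (graft t i u)"
proof (induction arbitrary: i rule: tree_step.induct)
  \<comment> \<open>The leaf lies to the left of the contracted vertex, above it, or to its right;
    in each case the contraction survives with one of the three lists modified.\<close>
  case (contract c l a ts d b us vs)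
  then show ?case
    using tree_step.contract[of "\<lambda>_ _ _. ()" E c l a "graft_list ts i u" d b us vs]
      tree_step.contract[of "\<lambda>_ _ _. ()" E c l a ts d b "graft_list us (i - length (concat (map leaves ts))) u" vs]
      tree_step.contract[of "\<lambda>_ _ _. ()" E c l a ts d b us
         "graft_list vs (i - length (concat (map leaves ts)) - length (concat (map leaves us))) u"]
    by (auto simp: graft_list_append)
next
  case (unary a c t l)
  show ?case
  proof (cases t)
    case (Leaf d)
    then have "merge l u = u" using unary by (intro merge_root_ext) (auto simp: mtrees_def)
    then show ?thesis using Leaf unary tree_step.unary[of a E c u _ l] by auto
  next
    case (Node d m b us)
    then show ?thesis using unary tree_step.unary[of a E c "graft t i u" _ l] by auto
  qed
next
  case (inside t t' c l a ts vs)
  have len: "leaves t' = leaves t" using inside.hyps by (rule step_leaves)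
  consider "i < length (concat (map leaves ts))"
    | "\<not> i < length (concat (map leaves ts))" "i - length (concat (map leaves ts)) < length (leaves t)"
    | "\<not> i < length (concat (map leaves ts))" "\<not> i - length (concat (map leaves ts)) < length (leaves t)"
    by blast
  then show ?case
  proof cases
    case 2
    then have "graft t (i - length (concat (map leaves ts))) u = graft t' (i - length (concat (map leaves ts))) u \<or>
        tree_step (\<lambda>_ _ _. ()) E (graft t (i - length (concat (map leaves ts))) u) (graft t' (i - length (concat (map leaves ts))) u)"
      using inside by (intro inside.IH) (auto simp: nth_append split: if_splits)
    then show ?thesis using 2 len by (auto simp: graft_list_append intro: tree_step.inside)
  qed (use inside.hyps len in \<open>auto simp: graft_list_append intro: tree_step.inside\<close>)
qed

section \<open>Rebuilding a vertex after erasing a leaf\<close>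

lemma step_Node_cong:
  "s = t \<or> tree_step f E s t \<Longrightarrow>
   Node c l a (ts @ s # vs) = Node c l a (ts @ t # vs) \<or>
   tree_step f E (Node c l a (ts @ s # vs)) (Node c l a (ts @ t # vs))"
  by (auto intro: tree_step.inside)

text \<open>The case distinction of \<open>erase\<close> at a vertex, isolated from the leaf index.
  From here on \<open>erase_Node\<close> replaces the defining equation.\<close>

definition rebuild :: "'c \<Rightarrow> real \<Rightarrow> ('c, unit) tree list \<Rightarrow> ('c, unit) tree option" where
  "rebuild c l ts = (case ts of [] \<Rightarrow> None | [t] \<Rightarrow> Some (merge l t) | _ \<Rightarrow> Some (Node c l () ts))"

lemma erase_Node: "erase (Node c l a ts) i = rebuild c l (erase_list ts i)"
  by (auto simp: rebuild_def split: list.split)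

lemma rebuild_simps [simp]:
  "rebuild c l [] = None" "rebuild c l [t] = Some (merge l t)"
  "rebuild c l (t # u # ts) = Some (Node c l () (t # u # ts))"
  by (simp_all add: rebuild_def)

declare erase.simps(2) [simp del] erase_Node [simp]

lemma rebuild_eq_Node: "2 \<le> length ts \<Longrightarrow> rebuild c l ts = Some (Node c l () ts)"
  by (auto simp: rebuild_def split: list.split)

text \<open>Erasing can turn a step into an equality, for instance when the contracted edge
  disappears together with the leaf; hence at most one step is claimed.\<close>

definition step_option where
  "step_option s t \<longleftrightarrow> s = t \<or> (\<exists>x y. s = Some x \<and> t = Some y \<and> full_step x y)"

lemma step_option_refl [simp]: "step_option s s"
  by (simp add: step_option_def)

lemma step_option_Some [simp]: "step_option (Some x) (Some y) \<longleftrightarrow> x = y \<or> full_step x y"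
  by (auto simp: step_option_def)

lemma step_option_rebuild:
  assumes "x = y \<or> full_step x y"
  shows "step_option (rebuild c l (ts @ x # vs)) (rebuild c l (ts @ y # vs))"
proof (cases "ts @ vs = []")
  case True
  then show ?thesis using assms by (auto simp: step_merge)
next
  case False
  then have "2 \<le> length (ts @ x # vs)" by (cases ts; cases vs) auto
  then show ?thesis using step_Node_cong[OF assms] by (simp add: rebuild_eq_Node)
qed

text \<open>With siblings present this is an ordinary contraction. Without them the parent is
  dissolved into its only child: the length becomes \<open>max l 0 = l\<close>, the colors agree,
  and a single remaining input is reached by a unary step.\<close>

lemma step_option_rebuild_contract:
  assumes d: "us = [] \<Longrightarrow> False" "l \<ge> 0" "ts = [] \<Longrightarrow> vs = [] \<Longrightarrow> c = d" "\<And>u. us = [u] \<Longrightarrow> color_of u = d"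
  shows "step_option (rebuild c l (ts @ Node d 0 () us # vs)) (rebuild c l (ts @ us @ vs))"
proof (cases "ts @ vs = []")
  case True
  show ?thesis
  proof (cases us rule: remdups_adj.cases)
    case (2 u)
    then show ?thesis using True d tree_step.unary[of "()" "\<lambda>_. {()}" d u "\<lambda>_ _ _. ()" l] by auto
  qed (use True d in auto)
next
  case False
  then have 1: "2 \<le> length (ts @ Node d 0 () us # vs)" by (cases ts; cases vs) auto
  moreover have "2 \<le> length (ts @ us @ vs)" using False d(1) by (cases ts; cases vs; cases us) auto
  ultimately show ?thesis
    using tree_step.contract[of "\<lambda>_ _ _. ()" "\<lambda>_. {()}" c l "()" ts d "()" us vs]
    by (simp add: rebuild_eq_Node)
qed

lemma act_labels_unary: "a \<in> act_labels [y] x \<Longrightarrow> y = x"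
  by (simp add: in_act_labels)

text \<open>Collects what typing of \<open>erase\<close> requires, so that one induction serves both
  colored and metric trees. Here \<open>e\<close> is the color of erased leaves: a vertex that loses
  such an input must become a legitimate vertex or leave behind an edge of the right color.\<close>

locale leaf_erasure =
  fixes L :: "'c list \<Rightarrow> 'c \<Rightarrow> unit set" and e :: 'c
  assumes nonempty: "() \<in> L w x \<Longrightarrow> w \<noteq> []"
    and unary: "() \<in> L [y] x \<Longrightarrow> y = x"
    and delete1: "() \<in> L (u @ e # w) x \<Longrightarrow> u @ w = [z] \<Longrightarrow> z = x"
    and delete: "() \<in> L (u @ e # w) x \<Longrightarrow> 2 \<le> length (u @ w) \<Longrightarrow> () \<in> L (u @ w) x"
begin

text \<open>The two alternatives for \<open>ts'\<close> reflect that the child containing the leaf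
  either survives with its color or disappears, in which case its color was
  \<open>e\<close>.\<close>

lemma rebuild_typed:
  assumes "() \<in> L (map color_of ts) c" "0 \<le> l" "l \<le> 1" "\<forall>t\<in>set ts'. admissible L t"
    and ts': "map color_of ts' = map color_of ts \<or>
      (\<exists>u w. map color_of ts = u @ e # w \<and> map color_of ts' = u @ w)"
  shows "case rebuild c l ts' of
      None \<Rightarrow> ts' = [] \<and> c = e
    | Some t \<Rightarrow> admissible L t \<and> color_of t = c \<and> leaves t = concat (map leaves ts') \<and>
        (l = 1 \<longrightarrow> root_ext t)"
proof (cases ts' rule: remdups_adj.cases)
  case 1
  then have "map color_of ts = [e]" using ts' assms(1) nonempty by fastforce
  then show ?thesis using 1 assms(1) unary[of e c] by auto
next
  case (2 t)
  have "color_of t = c"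
    using ts' assms(1) 2 unary delete1[of _ _ c "color_of t"] by fastforce
  then show ?thesis using 2 assms by (auto intro: admissible_merge root_ext_merge)
next
  case (3 t u us)
  have "() \<in> L (map color_of ts') c"
    using ts'
  proof (elim disjE exE conjE)
    fix u w assume u: "map color_of ts = u @ e # w" "map color_of ts' = u @ w"
    then have "2 \<le> length (u @ w)" using 3 by (metis length_Cons length_map le_add1 add_2_eq_Suc add.commute)
    then show ?thesis using u assms(1) delete by simp
  qed (use assms(1) in simp)
  then show ?thesis using 3 assms by auto
qed

lemma delete_nth_eq_Nil: "take i xs @ drop (Suc i) xs = [] \<Longrightarrow> i < length xs \<Longrightarrow> xs = [xs ! i]"
  by (cases xs; cases i) auto

text \<open>The last clause for lists records whether a child has disappeared, which is the
  information that \<open>rebuild_typed\<close> consumes at the vertex below.\<close>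

lemma erase_typed:
  "admissible L t \<Longrightarrow> i < length (leaves t) \<Longrightarrow> leaves t ! i = e \<Longrightarrow>
    (case erase t i of
      None \<Rightarrow> leaves t = [e] \<and> color_of t = e
    | Some t' \<Rightarrow> admissible L t' \<and> color_of t' = color_of t \<and>
        leaves t' = take i (leaves t) @ drop (Suc i) (leaves t) \<and> (root_ext t \<longrightarrow> root_ext t'))"
  "\<forall>t\<in>set ts. admissible L t \<Longrightarrow> i < length (concat (map leaves ts)) \<Longrightarrow> concat (map leaves ts) ! i = e \<Longrightarrow>
    (\<forall>t\<in>set (erase_list ts i). admissible L t) \<and>
    concat (map leaves (erase_list ts i)) =
      take i (concat (map leaves ts)) @ drop (Suc i) (concat (map leaves ts)) \<and>
    (map color_of (erase_list ts i) = map color_of ts \<or>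
      (\<exists>u w. map color_of ts = u @ e # w \<and> map color_of (erase_list ts i) = u @ w))"
proof (induction t i and ts i rule: erase_erase_list.induct)
  case (1 c i)
  then show ?case by simp
next
  case (2 c l a ts i)
  define ts' where "ts' = erase_list ts i"
  note IH = 2(1)[folded ts'_def]
  have "case rebuild c l ts' of
      None \<Rightarrow> ts' = [] \<and> c = e
    | Some t \<Rightarrow> admissible L t \<and> color_of t = c \<and> leaves t = concat (map leaves ts') \<and>
        (l = 1 \<longrightarrow> root_ext t)"
    using IH 2(2-) by (intro rebuild_typed[of ts]) auto
  moreover have "leaves (Node c l a ts) = [e]" if "ts' = []"
  proof -
    have "take i (leaves (Node c l a ts)) @ drop (Suc i) (leaves (Node c l a ts)) = []"
      using IH 2(2-) that by simp
    then show ?thesis using delete_nth_eq_Nil 2(3,4) by metis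
  qed
  ultimately show ?case
    using IH 2(2-) by (auto simp flip: ts'_def split: option.splits)
next
  case (3 i)
  then show ?case by simp
next
  case (4 t ts i)
  show ?case
  proof (cases "i < length (leaves t)")
    case True
    show ?thesis
    proof (cases "erase t i")
      case None
      then have "leaves t = [e]" "color_of t = e"
        using 4 True by (auto simp: nth_append)
      then have ex: "\<exists>u w. map color_of (t # ts) = u @ e # w \<and> map color_of ts = u @ w"
        by (intro exI[of _ "[]"] exI[of _ "map color_of ts"]) simp
      have eq: "erase_list (t # ts) i = ts" using None True by simp
      show ?thesis unfolding eq using 4(3,4) True \<open>leaves t = [e]\<close>
        by (intro conjI disjI2 ex) auto
    next
      case (Some t')
      then show ?thesis using True 4 by (auto simp: nth_append)
    qed
  next
    case False
    have 5: "concat (map leaves ts) ! (i - length (leaves t)) = e"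
      "i - length (leaves t) < length (concat (map leaves ts))"
      using False 4(4,5) by (auto simp: nth_append less_diff_conv2)
    have 6: "\<exists>u w. map color_of (t # ts) = u @ e # w \<and> color_of t # v = u @ w"
      if "\<exists>u w. map color_of ts = u @ e # w \<and> v = u @ w" for v
      using that by (metis append_Cons list.simps(9))
    show ?thesis using 4(2)[OF False _ 5(2,1)] 4(3) False 6 by (auto simp: Suc_diff_le)
  qed
qed

lemma erase_list_eq_Nil:
  assumes "\<forall>t\<in>set ts. admissible L t" "i < length (concat (map leaves ts))"
    "concat (map leaves ts) ! i = e" "erase_list ts i = []"
  shows "map color_of ts = [e]"
  using erase_typed(2)[OF assms(1-3)] assms(4) assms(2) by auto

end

text \<open>Only closed letters are deleted. For output \<open>Open\<close> the deleted letter is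
  not the last one, so the final open letter stays; for output \<open>Closed\<close> every remaining
  letter is closed.\<close>

interpretation act: leaf_erasure act_labels Closed
proof
  fix u w :: "color list" and x z
  assume "() \<in> act_labels (u @ Closed # w) x"
  then show "z = x" if "u @ w = [z]"
    using that by (cases u) (auto simp: in_act_labels append_eq_Cons_conv)
  from \<open>() \<in> act_labels (u @ Closed # w) x\<close> show "() \<in> act_labels (u @ w) x" if "2 \<le> length (u @ w)"
    using that by (cases w rule: rev_cases; cases u rule: rev_cases) (auto simp: in_act_labels butlast_append)
qed (auto simp: in_act_labels)

interpretation K: leaf_erasure K_labels "()"
  by unfold_locales (auto simp: K_labels_def split: if_splits)

text \<open>This makes erasing well defined on classes. The delicate configuration is a leaf above
  the contracted vertex: that vertex may vanish or become unary, and then merging with its length 0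
  has the same effect as the contraction.\<close>

lemma erase_step:
  "full_step s t \<Longrightarrow> admissible act_labels s \<Longrightarrow> i < length (leaves s) \<Longrightarrow> leaves s ! i = Closed \<Longrightarrow>
    step_option (erase s i) (erase t i)"
proof (induction arbitrary: i rule: tree_step.induct)
  case (contract c l a ts d b us vs)
  have us: "us \<noteq> []" and l: "0 \<le> l" and cd: "vs = [] \<Longrightarrow> c = d" and ud: "\<And>u. us = [u] \<Longrightarrow> color_of u = d"
    and adm: "\<forall>u\<in>set us. admissible act_labels u" "\<forall>u\<in>set vs. admissible act_labels u"
    and w: "() \<in> act_labels (map color_of ts @ d # map color_of vs) c"
    using contract by (auto simp: in_act_labels)
  define n where "n = length (concat (map leaves ts))"
  define m where "m = length (concat (map leaves us))"
  \<comment> \<open>Position of the leaf: to the left of the contracted vertex, above it, or to its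
    right.\<close>
  consider "i < n" | "\<not> i < n" "i - n < m" | "\<not> i < n" "\<not> i - n < m" by blast
  then show ?case
  proof cases
    case 1
    then show ?thesis
      using step_option_rebuild_contract[of us l "erase_list ts i" vs c d] us l ud cd
      by (auto simp: erase_list_append n_def)
  next
    case 2
    define us' where "us' = erase_list us (i - n)"
    have "concat (map leaves us) ! (i - n) = Closed"
      using contract.prems(3) 2 by (simp add: nth_append n_def m_def)
    then have us': "\<forall>u\<in>set us'. admissible act_labels u"
      using act.erase_typed(2)[OF adm(1), of "i - n"] 2 unfolding us'_def m_def by blast
    have eq: "erase (Node c l a (ts @ Node d 0 b us # vs)) i =
        rebuild c l (ts @ (case rebuild d 0 us' of None \<Rightarrow> vs | Some t \<Rightarrow> t # vs))"
      "erase (Node c l () (ts @ us @ vs)) i = rebuild c l (ts @ us' @ vs)"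
      using 2 by (auto simp: erase_list_append us'_def n_def m_def)
    show ?thesis
    proof (cases us' rule: remdups_adj.cases)
      case (3 x y xs)
      then show ?thesis unfolding eq using step_option_rebuild_contract[of us' l ts vs c d] l cd by simp
    next
      case 1
      then show ?thesis unfolding eq by simp
    next
      case (2 x)
      then show ?thesis unfolding eq using us' by (simp add: merge_0)
    qed
  next
    case 3
    \<comment> \<open>If everything to the right disappears, the contracted vertex is left as only
      child and must have the color of its parent. The vanished child was the closed last letter, so
      the parent is closed, and hence so are all its inputs.\<close>
    have "c = d" if "erase_list vs (i - n - m) = []" "ts = []"
    proof -
      have "concat (map leaves vs) ! (i - n - m) = Closed" "i - n - m < length (concat (map leaves vs))"
        using contract.prems 3 by (auto simp: nth_append n_def m_def split: if_splits)
      then have "map color_of vs = [Closed]" using act.erase_list_eq_Nil adm(2) that by blast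
      then show ?thesis using w that by (simp add: in_act_labels)
    qed
    then show ?thesis
      using 3 step_option_rebuild_contract[of us l ts "erase_list vs (i - n - m)" c d] us l ud
      by (auto simp: erase_list_append n_def m_def)
  qed
next
  case (unary a c t l)
  show ?case
  proof (cases t)
    case (Leaf d)
    then show ?thesis using unary by simp
  next
    case (Node d m b us)
    \<comment> \<open>Collapsing in two stages takes the maximum of both lengths, just as erasing
      the unary vertex beforehand does.\<close>
    have "rebuild c l (case rebuild d m ts of None \<Rightarrow> [] | Some t' \<Rightarrow> [t']) = rebuild d (max l m) ts" for ts
      by (cases ts rule: remdups_adj.cases) (auto simp: merge_merge)
    then show ?thesis using Node unary by (auto split: option.split)
  qed
next
  case (inside t t' c l a ts vs)
  have len: "leaves t' = leaves t" using inside.hyps by (rule step_leaves)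
  define n where "n = length (concat (map leaves ts))"
  consider "i < n" | "\<not> i < n" "i - n < length (leaves t)" | "\<not> i < n" "\<not> i - n < length (leaves t)" by blast
  then show ?case
  proof cases
    case 2
    have IH: "step_option (erase t (i - n)) (erase t' (i - n))"
      using inside 2 by (intro inside.IH) (auto simp: nth_append n_def)
    have eq: "erase (Node c l a (ts @ x # vs)) i =
        rebuild c l (ts @ (case erase x (i - n) of None \<Rightarrow> vs | Some y \<Rightarrow> y # vs))"
      if "leaves x = leaves t" for x
      using 2 that by (simp add: erase_list_append n_def)
    show ?thesis unfolding eq[OF refl] eq[OF len]
      using IH by (auto simp: step_option_def[of "erase _ _"] intro: step_option_rebuild)
  qed (use inside.hyps len step_option_rebuild[of t t'] in \<open>auto simp: erase_list_append n_def\<close>)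
qed

section \<open>Removing unary vertices\<close>

lemma admissible_mono: "admissible L t \<Longrightarrow> (\<And>w x. L w x \<subseteq> L' w x) \<Longrightarrow> admissible L' t"
  by (induction t) auto

lemma in_reduced_labels: "a \<in> reduced_labels w x \<longleftrightarrow> 2 \<le> length w \<and> a \<in> act_labels w x"
  by (simp add: reduced_labels_def)

lemma admissible_reduced: "admissible reduced_labels t \<Longrightarrow> admissible act_labels t"
  by (erule admissible_mono) (auto simp: reduced_labels_def)

lemma admissible_edge_length: "admissible L t \<Longrightarrow> 0 \<le> edge_length t \<and> edge_length t \<le> 1"
  by (cases t) auto

definition join :: "'c \<Rightarrow> real \<Rightarrow> ('c, unit) tree list \<Rightarrow> ('c, unit) tree" where
  "join c l ts = (case ts of [t] \<Rightarrow> merge l t | _ \<Rightarrow> Node c l () ts)"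

lemma join_simps [simp]: "join c l [t] = merge l t" "2 \<le> length ts \<Longrightarrow> join c l ts = Node c l () ts"
  by (auto simp: join_def split: list.split)

fun normalize :: "('c, unit) tree \<Rightarrow> ('c, unit) tree" where
  "normalize (Leaf c) = Leaf c"
| "normalize (Node c l a ts) = join c l (map normalize ts)"

lemma list_1_or_2:
  assumes "xs \<noteq> []"
  obtains x where "xs = [x]" | "2 \<le> length xs"
  using assms by (cases xs rule: remdups_adj.cases) auto

lemma normalize_typed:
  "admissible act_labels t \<Longrightarrow> admissible reduced_labels (normalize t) \<and>
     color_of (normalize t) = color_of t \<and> leaves (normalize t) = leaves t \<and>
     (root_ext t \<longrightarrow> root_ext (normalize t))"
proof (induction t)
  case (Node c l a ts)
  then have "ts \<noteq> []" by (auto simp: in_act_labels)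
  have IH: "\<forall>t\<in>set ts. admissible reduced_labels (normalize t)"
    "map (\<lambda>t. color_of (normalize t)) ts = map color_of ts"
    "map (\<lambda>t. leaves (normalize t)) ts = map leaves ts"
    using Node by auto
  show ?case
    using \<open>ts \<noteq> []\<close>
  proof (cases ts rule: list_1_or_2)
    case (1 t)
    then show ?thesis
      using Node act_labels_unary by (auto intro: admissible_merge root_ext_merge)
  next
    case 2
    then show ?thesis using Node.prems IH by (simp add: in_reduced_labels o_def cong: map_cong)
  qed
qed auto

lemma normalize_reduced: "admissible reduced_labels t \<Longrightarrow> normalize t = t"
proof (induction t)
  case (Node c l a ts)
  then have "map normalize ts = ts" "2 \<le> length ts"
    by (auto simp: map_idI reduced_labels_def split: if_splits)
  then show ?case by simp
qed auto

lemma join_step: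
  assumes "x = y \<or> tree_step f E x y"
  shows "join c l (ts @ x # vs) = join c l (ts @ y # vs) \<or>
    tree_step f E (join c l (ts @ x # vs)) (join c l (ts @ y # vs))"
proof (cases "ts @ vs = []")
  case True
  then show ?thesis using assms by (auto simp: step_merge)
next
  case False
  then have "2 \<le> length (ts @ x # vs)" by (cases ts; cases vs) auto
  then show ?thesis using step_Node_cong[OF assms] by simp
qed

text \<open>If the vertex with length 0 is unary, \<open>merge 0\<close> has already dissolved it;
  if it is the only input, it has already been merged with its parent. In the remaining case the
  contraction is still visible.\<close>

lemma join_contract:
  assumes "us \<noteq> []" "\<forall>u\<in>set us. admissible L u" "l \<ge> 0" "ts = [] \<Longrightarrow> vs = [] \<Longrightarrow> c = d"
  shows "join c l (ts @ join d 0 us # vs) = join c l (ts @ us @ vs) \<or>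
    contract_step (join c l (ts @ join d 0 us # vs)) (join c l (ts @ us @ vs))"
  using assms(1)
proof (cases us rule: list_1_or_2)
  case (1 u)
  then show ?thesis using assms by (simp add: merge_0)
next
  case 2
  show ?thesis
  proof (cases "ts @ vs = []")
    case True
    then show ?thesis using 2 assms by simp
  next
    case False
    then have 1: "2 \<le> length (ts @ Node d 0 () us # vs)" by (cases ts; cases vs) auto
    then show ?thesis
      using 2 tree_step.contract[of "\<lambda>_ _ _. ()" "\<lambda>_. {}" c l "()" ts d "()" us vs] by simp
  qed
qed

lemma normalize_merge: "normalize (merge l t) = merge l (normalize t)"
proof (cases t)
  case (Node c m a ts)
  then show ?thesis
    by (cases "map normalize ts" rule: remdups_adj.cases) (auto simp: join_def merge_merge)
qed auto

text \<open>Erasing a unary vertex becomes an equality and a contraction remains at most one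
  contraction. So normal forms of equivalent trees are related by contractions alone.\<close>

lemma normalize_step:
  "full_step s t \<Longrightarrow> admissible act_labels s \<Longrightarrow>
   normalize s = normalize t \<or> contract_step (normalize s) (normalize t)"
proof (induction rule: tree_step.induct)
  case (contract c l a ts d b us vs)
  have "us \<noteq> []" "\<forall>u\<in>set us. admissible act_labels u" "l \<ge> 0" "vs = [] \<Longrightarrow> c = d"
    using contract by (auto simp: in_act_labels)
  then show ?case
    using join_contract[of "map normalize us" reduced_labels l "map normalize ts" "map normalize vs" c d]
    by (simp add: normalize_typed)
next
  case (unary a c t l)
  then show ?case by (simp add: normalize_merge)
next
  case (inside t t' c l a ts vs)
  then show ?case using join_step[of "normalize t" "normalize t'"] by simp
qed

text \<open>\<open>us\<close> holds the children that have already been rewritten, which lets the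
  induction run over the remaining ones.\<close>

lemma steps_Node:
  assumes "\<And>t. t \<in> set ts \<Longrightarrow> (tree_step f E)\<^sup>*\<^sup>* t (F t)"
  shows "(tree_step f E)\<^sup>*\<^sup>* (Node c l a (us @ ts)) (Node c l a (us @ map F ts))"
  using assms
proof (induction ts arbitrary: us)
  case (Cons t ts)
  have "(tree_step f E)\<^sup>*\<^sup>* t (F t)" using Cons.prems by simp
  then have "(tree_step f E)\<^sup>*\<^sup>* (Node c l a (us @ t # ts)) (Node c l a (us @ F t # ts))"
    by (induction rule: rtranclp_induct) (auto intro: tree_step.inside rtranclp.rtrancl_into_rtrancl)
  then show ?case using Cons.IH[of "us @ [F t]"] Cons.prems by simp
qed simp

lemma steps_normalize: "admissible act_labels t \<Longrightarrow> full_step\<^sup>*\<^sup>* t (normalize t)"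
proof (induction t)
  case (Node c l a ts)
  have *: "full_step\<^sup>*\<^sup>* (Node c l a ts) (Node c l a (map normalize ts))"
    using steps_Node[of ts _ _ normalize c l a "[]"] Node by simp
  have "ts \<noteq> []" using Node by (auto simp: in_act_labels)
  then show ?case
  proof (cases ts rule: list_1_or_2)
    case (1 t)
    then have "full_step (Node c l a [normalize t]) (merge l (normalize t))"
      using Node.prems normalize_typed by (intro tree_step.unary) (auto dest: act_labels_unary)
    then show ?thesis using * 1 by simp
  qed (use * in simp)
qed auto

lemma leaves_in_act_labels: "admissible act_labels t \<Longrightarrow> () \<in> act_labels (leaves t) (color_of t)"
proof (induction t)
  case (Leaf c)
  then show ?case by (simp add: in_act_labels)
next
  case (Node c l a ts)
  \<comment> \<open>\<open>us\<close> collects the leaf words of the children already substituted;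
    each further child is one partial composition in \<open>Act_bar\<close>.\<close>
  have "() \<in> act_labels (us @ map color_of ts) c \<Longrightarrow>
      \<forall>t\<in>set ts. () \<in> act_labels (leaves t) (color_of t) \<Longrightarrow>
      () \<in> act_labels (us @ concat (map leaves ts)) c" for us
  proof (induction ts arbitrary: us)
    case (Cons t ts)
    then show ?case
      using Cons.IH[of "us @ leaves t"] act_labels_compose[of "()" us "color_of t" "map color_of ts" c "()" "leaves t" "()"]
      by simp
  qed simp
  from this[of "[]"] show ?case using Node by simp
qed

section \<open>Trees without colors as closed and open operations\<close>

fun unpaint :: "(color, unit) tree \<Rightarrow> (unit, unit) tree" where
  "unpaint (Leaf c) = Leaf ()"
| "unpaint (Node c l a ts) = Node () l a (map unpaint ts)"

lemma unpaint_paint [simp]: "unpaint (paint t) = t"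
  by (induction t) (auto simp: map_idI)

lemma in_act_labels_Closed: "() \<in> act_labels w Closed \<longleftrightarrow> w \<noteq> [] \<and> set w \<subseteq> {Closed}"
  by (cases w rule: rev_cases) (auto simp: in_act_labels)

text \<open>Above a closed root all edges are closed, so forgetting the colors loses
  nothing.\<close>

lemma paint_unpaint: "admissible act_labels s \<Longrightarrow> color_of s = Closed \<Longrightarrow> paint (unpaint s) = s"
proof (induction s)
  case (Node c l a ts)
  then have "\<forall>t\<in>set ts. color_of t = Closed" by (auto simp: in_act_labels_Closed)
  then show ?case using Node by (auto simp: map_idI)
qed auto

lemma color_of_paint [simp]: "color_of (paint t) = Closed"
  by (cases t) auto

lemma root_ext_paint [simp]: "root_ext (paint t) = root_ext t"
  by (cases t) auto

lemma leaves_paint [simp]: "leaves (paint t) = map (\<lambda>_. Closed) (leaves t)"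
  by (induction t) (auto simp: map_concat o_def cong: map_cong)

lemma admissible_paint: "admissible K_labels t \<Longrightarrow> admissible reduced_labels (paint t)"
  by (induction t) (auto simp: reduced_labels_def K_labels_def in_act_labels_Closed split: if_splits)

lemma admissible_unpaint: "admissible reduced_labels t \<Longrightarrow> admissible K_labels (unpaint t)"
  by (induction t) (auto simp: reduced_labels_def K_labels_def split: if_splits)

lemma length_leaves_unpaint [simp]: "length (leaves (unpaint t)) = length (leaves t)"
  by (induction t) (auto simp: length_concat o_def cong: map_cong)

lemma root_ext_unpaint [simp]: "root_ext (unpaint t) = root_ext t"
  by (cases t) auto

lemma step_paint: "contract_step s t \<Longrightarrow> contract_step (paint s) (paint t)"
proof (induction rule: tree_step.induct)
  case (contract c l a ts d b us vs)
  then show ?case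
    using tree_step.contract[of "\<lambda>_ _ _. ()" "\<lambda>_. {}" Closed l a "map paint ts" Closed b "map paint us" "map paint vs"]
    by simp
qed (auto intro: tree_step.inside)

lemma step_unpaint: "contract_step s t \<Longrightarrow> contract_step (unpaint s) (unpaint t)"
proof (induction rule: tree_step.induct)
  case (contract c l a ts d b us vs)
  then show ?case
    using tree_step.contract[of "\<lambda>_ _ _. ()" "\<lambda>_. {}" "()" l a "map unpaint ts" "()" b "map unpaint us" "map unpaint vs"]
    by simp
qed (auto intro: tree_step.inside)

lemma leaves_paint_list [simp]:
  "concat (map (leaves \<circ> paint) ts) = map (\<lambda>_. Closed) (concat (map leaves ts))"
  by (induction ts) auto

lemma paint_graft:
  "paint (graft t i s) = graft (paint t) i (paint s)"
  "map paint (graft_list ts i s) = graft_list (map paint ts) i (paint s)"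
  by (induction t i s and ts i s rule: graft_graft_list.induct) auto

lemma paint_merge: "paint (merge l t) = merge l (paint t)"
  by (cases t) auto

lemma paint_rebuild: "map_option paint (rebuild () l ts) = rebuild Closed l (map paint ts)"
  by (cases ts rule: remdups_adj.cases) (auto simp: paint_merge)

lemma paint_erase:
  shows "erase (paint t) i = map_option paint (erase t i)"
    and "erase_list (map paint ts) i = map paint (erase_list ts i)"
  by (induction t i and ts i rule: erase_erase_list.induct)
    (auto simp: paint_rebuild split: option.splits)

subsection \<open>Rerooting\<close>

lemma size_last [termination_simp]: "ts \<noteq> [] \<Longrightarrow> size (last ts) < Suc (Suc (n + size_list size ts))"
proof -
  assume "ts \<noteq> []"
  then have "size (last ts) \<le> size_list size ts" by (induction ts) auto
  then show ?thesis by simp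
qed

text \<open>Follows the open path through last inputs; each vertex on it receives the part built so
  far as first input. The edge towards the next path vertex becomes the outgoing one, hence its
  length is used.\<close>

fun unroot_onto :: "(color, unit) tree \<Rightarrow> (unit, unit) tree \<Rightarrow> (unit, unit) tree" where
  "unroot_onto (Node c l a (t # ts)) acc = unroot_onto (last (t # ts))
     (Node () (edge_length (last (t # ts))) () (acc # map unpaint (butlast (t # ts))))"
| "unroot_onto _ acc = acc"

lemma unroot_onto_snoc [simp]:
  "unroot_onto (Node c l a (ts @ [t])) acc =
     unroot_onto t (Node () (edge_length t) () (acc # map unpaint ts))"
  by (cases ts) (auto simp: butlast_append)

text \<open>A vertex with open output has exactly one open input, the last; inductions along the
  open path rest on this.\<close>

lemma admissible_OpenE:
  assumes "admissible act_labels t" "color_of t = Open"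
  obtains "t = Leaf Open"
    | l ts u where "t = Node Open l () (ts @ [u])" "\<forall>s\<in>set ts. admissible act_labels s \<and> color_of s = Closed"
      "admissible act_labels u" "color_of u = Open" "0 \<le> l" "l \<le> 1"
proof (cases t)
  case (Node c l a us)
  then obtain ts u where "us = ts @ [u]" using assms by (cases us rule: rev_cases) (auto simp: in_act_labels)
  then show ?thesis using assms Node that(2)[of l ts u] by (auto simp: in_act_labels)
qed (use assms that in auto)

text \<open>\<open>t\<close> and \<open>acc\<close> are the two sides of a tree cut at an edge of
  the path, whose length is stored on both sides; this is the hypothesis on
  \<open>edge_length\<close>. Rerooting moves the cut back over the vertices that unrooting has
  passed.\<close>

lemma reroot_unroot_onto:
  "admissible act_labels t \<Longrightarrow> color_of t = Open \<Longrightarrow> edge_length acc = edge_length t \<Longrightarrow>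
   reroot_onto (unroot_onto t acc) (Leaf Open) = reroot_onto acc t"
proof (induction "size t" arbitrary: t acc rule: less_induct)
  case less
  from less.prems(1,2) show ?case
  proof (cases rule: admissible_OpenE)
    case (2 l ts u)
    have "map paint (map unpaint ts) = ts"
      using 2 by (simp add: map_idI paint_unpaint o_def)
    moreover have "reroot_onto (unroot_onto u (Node () (edge_length u) () (acc # map unpaint ts))) (Leaf Open) =
        reroot_onto (Node () (edge_length u) () (acc # map unpaint ts)) u"
      using 2 by (intro less.hyps) auto
    ultimately show ?thesis using 2 less.prems(3) by simp
  qed simp
qed

lemma unroot_reroot_onto:
  "edge_length acc = edge_length t \<Longrightarrow> admissible K_labels t \<Longrightarrow>
   unroot_onto (reroot_onto t acc) (Leaf ()) = unroot_onto acc t"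
proof (induction t acc rule: reroot_onto.induct)
  case (1 c l a t ts acc)
  then show ?case by (simp add: o_def)
qed (auto simp: K_labels_def)

lemma step_edge_length: "contract_step s t \<Longrightarrow> edge_length t = edge_length s"
  by (cases rule: tree_step.cases) auto

lemma step_reroot_onto_acc: "tree_step f E s s' \<Longrightarrow> tree_step f E (reroot_onto t s) (reroot_onto t s')"
proof (induction t s arbitrary: s' rule: reroot_onto.induct)
  case (1 c l a t ts acc)
  then show ?case by (simp add: tree_step.inside)
qed auto

lemma step_unroot_onto_acc: "tree_step f E s s' \<Longrightarrow> tree_step f E (unroot_onto t s) (unroot_onto t s')"
proof (induction t s arbitrary: s' rule: unroot_onto.induct)
  case (1 c l a t ts acc)
  then show ?case using tree_step.inside[of "\<lambda>_ _ _. ()" E acc s' _ _ _ "[]"] by simp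
qed auto

text \<open>Reversal exchanges the ends of a path edge but keeps its length, so contraction joins
  the same two vertices before and after. Edges off the path are merely painted.\<close>

lemma step_reroot_onto:
  "contract_step s t \<Longrightarrow> admissible K_labels s \<Longrightarrow> contract_step (reroot_onto s acc) (reroot_onto t acc)"
proof (induction arbitrary: acc rule: tree_step.induct)
  case (contract c l a ts d b us vs)
  show ?case
  proof (cases ts)
    case (Cons t ts')
    then show ?thesis
      using tree_step.contract[of "\<lambda>_ _ _. ()" "\<lambda>_. {}" Open "edge_length t" "()" "map paint ts'" Closed b "map paint us" "map paint vs @ [acc]"]
      by (simp add: step_reroot_onto_acc)
  next
    \<comment> \<open>The contracted edge lies on the path: the former parent is now the last input,
      with length 0, of its former child.\<close>
    case Nil
    obtain u us' where "us = u # us'" using contract by (cases us) (auto simp: K_labels_def)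
    then show ?thesis
      using tree_step.contract[of "\<lambda>_ _ _. ()" "\<lambda>_. {}" Open "edge_length u" "()" "map paint us'" Open "()" "map paint vs @ [acc]" "[]"] Nil
      by (simp add: step_reroot_onto_acc)
  qed
next
  case (inside t t' c l a ts vs)
  show ?case
  proof (cases ts)
    case Nil
    then show ?thesis using inside by (simp add: step_edge_length)
  next
    case (Cons u us)
    then show ?thesis
      using inside.hyps tree_step.inside[OF step_paint, of t t' Open "edge_length u" "()" "map paint us" "map paint vs @ [acc]"]
      by (simp add: step_reroot_onto_acc)
  qed
qed auto

lemma step_unroot_onto:
  "contract_step s t \<Longrightarrow> admissible act_labels s \<Longrightarrow> contract_step (unroot_onto s acc) (unroot_onto t acc)"
proof (induction arbitrary: acc rule: tree_step.induct)
  case (contract c l a ts d b us vs)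
  show ?case
  proof (cases vs rule: rev_cases)
    case (snoc vs' v)
    then have "contract_step (Node () (edge_length v) () ((acc # map unpaint ts) @ Node () 0 b (map unpaint us) # map unpaint vs'))
       (Node () (edge_length v) () ((acc # map unpaint ts) @ map unpaint us @ map unpaint vs'))"
      using tree_step.contract[of "\<lambda>_ _ _. ()" "\<lambda>_. {}" "()" "edge_length v" "()" "acc # map unpaint ts" "()" b "map unpaint us" "map unpaint vs'"]
      by simp
    then show ?thesis
      using unroot_onto_snoc[of c l a "ts @ Node d 0 b us # vs'" v acc] unroot_onto_snoc[of c l "()" "ts @ us @ vs'" v acc] snoc
      by (simp add: step_unroot_onto_acc)
  next
    \<comment> \<open>Again parent and child are exchanged; the former parent is now the first input
      of its former child.\<close>
    case Nil
    obtain us' u where us: "us = us' @ [u]" using contract by (cases us rule: rev_cases) (auto simp: in_act_labels)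
    have "contract_step (Node () (edge_length u) () ([] @ Node () 0 () (acc # map unpaint ts) # map unpaint us'))
       (Node () (edge_length u) () ([] @ (acc # map unpaint ts) @ map unpaint us'))"
      using tree_step.contract[of "\<lambda>_ _ _. ()" "\<lambda>_. {}" "()" "edge_length u" "()" "[]" "()" "()" "acc # map unpaint ts" "map unpaint us'"]
      by simp
    then show ?thesis
      using Nil us unroot_onto_snoc[of c l "()" "ts @ us'" u acc]
      by (simp add: step_unroot_onto_acc)
  qed
next
  case (inside t t' c l a ts vs)
  show ?case
  proof (cases vs rule: rev_cases)
    case Nil
    then show ?thesis using inside by (simp add: step_edge_length)
  next
    case (snoc vs' v)
    then show ?thesis
      using unroot_onto_snoc[of c l a "ts @ t # vs'" v acc] unroot_onto_snoc[of c l a "ts @ t' # vs'" v acc]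
        tree_step.inside[OF step_unpaint[OF inside.hyps], of "()" "edge_length v" "()" "acc # map unpaint ts" "map unpaint vs'"]
      by (simp add: step_unroot_onto_acc)
  qed
qed auto

lemma leaves_K_nonempty: "admissible K_labels t \<Longrightarrow> leaves t \<noteq> []"
proof (induction t)
  case (Node c l a ts)
  then show ?case by (cases ts) (auto simp: K_labels_def)
qed auto

lemma leaves_reroot_onto:
  "admissible K_labels t \<Longrightarrow>
   leaves (reroot_onto t acc) = replicate (length (leaves t) - 1) Closed @ leaves acc"
proof (induction t acc rule: reroot_onto.induct)
  case (1 c l a t ts acc)
  obtain n where n: "length (leaves t) = Suc n"
    using 1(2) leaves_K_nonempty[of t] by (cases "leaves t") auto
  then show ?case using 1 by (simp add: map_replicate_const replicate_add)
qed (auto simp: K_labels_def)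

lemma root_ext_iff: "root_ext t \<longleftrightarrow> edge_length t = 1"
  by (cases t) auto

text \<open>The root length 1 of the result is the \<open>edge_length\<close> of leaf 0: the
  external edges at both ends of the path carry the same dummy value.\<close>

lemma reroot_onto_typed:
  "admissible K_labels t \<Longrightarrow> admissible reduced_labels acc \<Longrightarrow> color_of acc = Open \<Longrightarrow>
   edge_length acc = edge_length t \<Longrightarrow>
   admissible reduced_labels (reroot_onto t acc) \<and> color_of (reroot_onto t acc) = Open \<and>
   root_ext (reroot_onto t acc)"
proof (induction t acc rule: reroot_onto.induct)
  case (1 c l a t ts acc)
  have "ts \<noteq> []" using 1(2) by (auto simp: K_labels_def)
  then have "2 \<le> length (ts @ [t])" by (cases ts) auto
  then show ?case using 1 admissible_edge_length[of K_labels t]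
    by (auto simp: in_reduced_labels in_act_labels butlast_append admissible_paint set_replicate_conv_if)
qed (auto simp: K_labels_def root_ext_iff)

text \<open>The last leaf of \<open>t\<close> becomes the root, hence the \<open>- 1\<close> in the
  count.\<close>

lemma unroot_onto_typed:
  "admissible reduced_labels t \<Longrightarrow> color_of t = Open \<Longrightarrow> admissible K_labels acc \<Longrightarrow>
   edge_length acc = edge_length t \<Longrightarrow>
   admissible K_labels (unroot_onto t acc) \<and> root_ext (unroot_onto t acc) \<and>
   length (leaves (unroot_onto t acc)) = length (leaves acc) + length (leaves t) - 1"
proof (induction "size t" arbitrary: t acc rule: less_induct)
  case less
  from admissible_reduced[OF less.prems(1)] less.prems(2) show ?case
  proof (cases rule: admissible_OpenE)
    case 1
    then show ?thesis using less.prems by (simp add: root_ext_iff)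
  next
    case (2 l ts u)
    let ?acc = "Node () (edge_length u) () (acc # map unpaint ts)"
    have "ts \<noteq> []" using less.prems(1) 2 by (auto simp: in_reduced_labels)
    moreover have "length (leaves u) \<noteq> 0" using leaves_in_act_labels[OF 2(3)] by (auto simp: in_act_labels)
    moreover have "length (concat (map (leaves \<circ> unpaint) ts)) = length (concat (map leaves ts))"
      by (simp add: length_concat o_def)
    moreover have red: "\<forall>s\<in>set ts. admissible reduced_labels s" "admissible reduced_labels u"
      using less.prems(1) 2(1) by simp_all
    moreover have acc: "admissible K_labels ?acc"
    proof -
      have "\<forall>s\<in>set (acc # map unpaint ts). admissible K_labels s"
        using red(1) less.prems(3) by (simp add: admissible_unpaint)
      moreover have "2 \<le> length (acc # map unpaint ts)" using \<open>ts \<noteq> []\<close> by (cases ts) auto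
      ultimately show ?thesis using admissible_edge_length[OF red(2)] by (simp add: K_labels_def)
    qed
    moreover have "admissible K_labels (unroot_onto u ?acc) \<and> root_ext (unroot_onto u ?acc) \<and>
        length (leaves (unroot_onto u ?acc)) = length (leaves ?acc) + length (leaves u) - 1"
      using 2(1,4) red(2) acc by (intro less.hyps) simp_all
    ultimately show ?thesis using 2 by simp
  qed
qed

subsection \<open>Rerooting, grafting and erasing\<close>

lemma edge_length_graft: "t \<noteq> Leaf c \<Longrightarrow> edge_length (graft t i s) = edge_length t" for t :: "(unit, unit) tree"
  by (cases t) auto

text \<open>The leaves of \<open>acc\<close> come after all leaves of \<open>t\<close> except leaf
  0, which explains the offset.\<close>

lemma graft_reroot_onto_acc:
  "admissible K_labels t \<Longrightarrow> i < length (leaves acc) \<Longrightarrow>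
   graft (reroot_onto t acc) (length (leaves t) - 1 + i) s = reroot_onto t (graft acc i s)"
proof (induction t acc arbitrary: i rule: reroot_onto.induct)
  case (1 c l a t ts acc)
  obtain n where n: "length (leaves t) = Suc n"
    using 1(2) leaves_K_nonempty[of t] by (cases "leaves t") auto
  have "graft (Node Open (edge_length t) () (map paint ts @ [acc])) (length (concat (map leaves ts)) + i) s =
      Node Open (edge_length t) () (map paint ts @ [graft acc i s])"
    using 1(3) by (simp add: graft_list_append)
  then show ?case using 1(1)[of "length (concat (map leaves ts)) + i"] 1(2,3) n by (simp add: add.assoc)
qed (auto simp: K_labels_def)

text \<open>Leaf 0 is no longer an input, so leaf \<open>Suc j\<close> gets number \<open>j\<close>.
  It lies either further along the path or above another input of the current vertex, which then
  belongs to the accumulated part.\<close>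

lemma graft_reroot_onto:
  "admissible K_labels t \<Longrightarrow> Suc j < length (leaves t) \<Longrightarrow>
   graft (reroot_onto t acc) j (paint s) = reroot_onto (graft t (Suc j) s) acc"
proof (induction t acc arbitrary: j rule: reroot_onto.induct)
  case (1 c l a t ts acc)
  obtain n where n: "length (leaves t) = Suc n"
    using 1(2) leaves_K_nonempty[of t] by (cases "leaves t") auto
  show ?case
  proof (cases "j < n")
    case True
    then have "t \<noteq> Leaf ()" using n by auto
    then show ?thesis using True 1 n by (simp add: edge_length_graft)
  next
    case False
    then obtain k where k: "j = n + k" using le_Suc_ex not_less by blast
    then have "k < length (concat (map leaves ts))" using 1(3) n by simp
    then show ?thesis
      using graft_reroot_onto_acc[of t k "Node Open (edge_length t) () (map paint ts @ [acc])" "paint s"] 1(2) n k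
      by (simp add: graft_list_append paint_graft)
  qed
qed (auto simp: K_labels_def)

text \<open>Grafting at leaf 0 concatenates the two paths, and reversal exchanges their order; this
  is the origin of the order of factors in the multiplicativity of an action.\<close>

lemma reroot_onto_graft_0:
  "admissible K_labels t \<Longrightarrow> root_ext s \<Longrightarrow>
   reroot_onto (graft t 0 s) acc = reroot_onto s (reroot_onto t acc)"
proof (induction t acc rule: reroot_onto.induct)
  case (1 c l a t ts acc)
  have "0 < length (leaves t)" using 1(2) leaves_K_nonempty by auto
  moreover have "edge_length (graft t 0 s) = edge_length t"
    using 1(3) by (cases t) (auto simp: root_ext_iff)
  ultimately show ?case using 1 by simp
qed (auto simp: K_labels_def)

text \<open>As something is left of \<open>acc\<close>, each path vertex of \<open>t\<close> keeps
  it besides at least one other input, so none of them becomes unary.\<close>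

lemma erase_reroot_onto_acc:
  "admissible K_labels t \<Longrightarrow> i < length (leaves acc) \<Longrightarrow> erase acc i = Some acc' \<Longrightarrow>
   erase (reroot_onto t acc) (length (leaves t) - 1 + i) = Some (reroot_onto t acc')"
proof (induction t acc arbitrary: i acc' rule: reroot_onto.induct)
  case (1 c l a t ts acc)
  obtain n where n: "length (leaves t) = Suc n"
    using 1(2) leaves_K_nonempty[of t] by (cases "leaves t") auto
  have "ts \<noteq> []" using 1(2) by (auto simp: K_labels_def)
  then have "2 \<le> length (map paint ts @ [acc'])" by (cases ts) auto
  then have "erase (Node Open (edge_length t) () (map paint ts @ [acc])) (length (concat (map leaves ts)) + i) =
      Some (Node Open (edge_length t) () (map paint ts @ [acc']))"
    using 1(3,4) by (simp add: erase_list_append rebuild_eq_Node)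
  then show ?case using 1(1)[of "length (concat (map leaves ts)) + i"] 1(2,3) n by (simp add: add.assoc)
qed (auto simp: K_labels_def)

lemma edge_length_merge [simp]: "admissible L t \<Longrightarrow> l \<le> 1 \<Longrightarrow> edge_length (merge l t) = max l (edge_length t)"
  by (cases t) auto

text \<open>The root edge is either kept or merged with another edge, and merging takes a
  maximum.\<close>

lemma edge_length_erase:
  assumes "admissible K_labels t" "i < length (leaves t)" "erase t i = Some t'"
  shows "edge_length t \<le> edge_length t'"
proof (cases t)
  case (Node c l a ts)
  then have *: "\<forall>t\<in>set (erase_list ts i). admissible K_labels t"
    using K.erase_typed(2)[of ts i] assms by simp
  show ?thesis using Node * assms
    by (cases "erase_list ts i" rule: remdups_adj.cases) auto
qed (use assms in auto)

lemma merge_edge_length: "merge (edge_length t) t = t"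
  by (cases t) auto

text \<open>The length of the edge below \<open>t\<close> is read off \<open>acc\<close>, not off
  \<open>t\<close>.\<close>

lemma reroot_onto_merge: "reroot_onto (merge l t) acc = reroot_onto t acc"
proof (cases t)
  case (Node c m a ts)
  then show ?thesis by (cases ts) auto
qed auto

text \<open>If erasing the leaf makes the root vertex of \<open>t\<close> unary, then its outgoing edge, which is also
  the root edge of \<open>acc\<close>, is merged with the edge to its first input; hence the new length of \<open>acc\<close>.\<close>

lemma erase_reroot_onto:
  "admissible K_labels t \<Longrightarrow> Suc j < length (leaves t) \<Longrightarrow> edge_length acc = edge_length t \<Longrightarrow>
   erase t (Suc j) = Some t' \<Longrightarrow>
   erase (reroot_onto t acc) j = Some (reroot_onto t' (merge (edge_length t') acc))"
proof (induction t acc arbitrary: j t' rule: reroot_onto.induct)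
  case (1 c l a t ts acc)
  obtain n where n: "length (leaves t) = Suc n"
    using 1(2) leaves_K_nonempty[of t] by (cases "leaves t") auto
  have ts: "ts \<noteq> []" using 1(2) by (auto simp: K_labels_def)
  have t: "admissible K_labels t" and l: "l = edge_length acc" "l \<le> 1" using 1(2,4) by simp_all
  let ?acc = "Node Open (edge_length t) () (map paint ts @ [acc])"
  show ?case
  proof (cases "j < n")
    case True
    then obtain s where s: "erase t (Suc j) = Some s"
      using K.erase_typed(1)[OF t, of "Suc j"] n by (cases "erase t (Suc j)") auto
    \<comment> \<open>The accumulated vertex carries \<open>edge_length t\<close>, and the merge
      required by the induction hypothesis raises it to \<open>edge_length s\<close>.\<close>
    have "edge_length t \<le> edge_length s" using edge_length_erase[OF t _ s] True n by simp
    moreover have "t' = Node () l () (s # ts)"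
      using 1(5) True n s ts by (cases ts) auto
    ultimately show ?thesis using 1(1)[OF t _ _ s] True n l by (simp add: merge_edge_length)
  next
    case False
    then obtain k where k: "j = n + k" using le_Suc_ex not_less by blast
    then have k': "k < length (concat (map leaves ts))" using 1(3) n by simp
    have t': "Some t' = rebuild () l (t # erase_list ts k)"
      using 1(5) n k by simp
    have acc: "erase ?acc k = rebuild Open (edge_length t) (map paint (erase_list ts k) @ [acc])"
      using k' by (simp add: erase_list_append paint_erase)
    show ?thesis
    proof (cases "erase_list ts k")
      case Nil
      have "merge (max l (edge_length t)) acc = merge (edge_length t) acc"
        using l(1) by (cases acc) auto
      then show ?thesis
        using erase_reroot_onto_acc[of t k ?acc "merge (edge_length t) acc"] t t' l Nil acc k k' n
        by (simp add: reroot_onto_merge)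
    next
      case (Cons u us)
      then show ?thesis
        using erase_reroot_onto_acc[of t k ?acc "Node Open (edge_length t) () (map paint (erase_list ts k) @ [acc])"]
          t t' l acc k k' n
        by (simp add: rebuild_eq_Node merge_edge_length)
    qed
  qed
qed (auto simp: K_labels_def)

section \<open>Equivalence classes of trees\<close>

abbreviation W_eq :: "((color, unit) tree \<times> (color, unit) tree) set" where
  "W_eq \<equiv> W_equiv Act_bar"

lemma W_eq_def: "W_eq = tree_equiv act_labels (\<lambda>_ _ _. ()) (\<lambda>_. {()})"
  by (simp add: W_equiv_def Act_bar_def Act_def W_labels_def)

lemma equiv_tree_equiv: "equiv (mtrees L) (tree_equiv L f E)"
proof (rule equivI)
  show "refl_on (mtrees L) (tree_equiv L f E)"
    by (auto simp: refl_on_def tree_equiv_def)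
  show "sym (tree_equiv L f E)"
    by (auto simp: sym_def tree_equiv_def intro: equivclp_sym)
  show "trans (tree_equiv L f E)"
    by (auto simp: trans_def tree_equiv_def intro: equivclp_trans)
qed (auto simp: tree_equiv_def)

lemma equiv_W_eq: "equiv (mtrees act_labels) W_eq"
  unfolding W_eq_def by (rule equiv_tree_equiv)

lemma equiv_K_equiv: "equiv (mtrees K_labels) K_equiv"
  unfolding K_equiv_def by (rule equiv_tree_equiv)

text \<open>Reduces compatibility with the equivalence relation to single steps. The target may be
  any equivalence: equality for invariants, or \<open>option_rel\<close> for erasing.\<close>

lemma tree_equiv_map:
  assumes "(s, t) \<in> tree_equiv L f E" "equiv B R"
    and step: "\<And>s t. s \<in> mtrees L \<Longrightarrow> t \<in> mtrees L \<Longrightarrow> tree_step f E s t \<Longrightarrow> (F s, F t) \<in> R"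
    and B: "\<And>s. s \<in> mtrees L \<Longrightarrow> F s \<in> B"
  shows "(F s, F t) \<in> R"
proof -
  note R = equivE[OF assms(2)]
  have s: "s \<in> mtrees L" and "equivclp (\<lambda>s t. s \<in> mtrees L \<and> t \<in> mtrees L \<and> tree_step f E s t) s t"
    using assms(1) by (auto simp: tree_equiv_def)
  from this(2) show ?thesis
  proof (induction rule: equivclp_induct)
    case base
    then show ?case using B[OF s] R by (meson refl_onD)
  next
    case (step y z)
    then have "(F y, F z) \<in> R" using assms(3) R by (meson symD)
    then show ?case using step.IH R by (meson transD)
  qed
qed

lemma step_W_eq: "s \<in> mtrees act_labels \<Longrightarrow> full_step s t \<Longrightarrow> (s, t) \<in> W_eq"
  unfolding W_eq_def tree_equiv_def by (auto intro: step_mtrees r_into_equivclp)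

lemma contract_step_full: "contract_step s t \<Longrightarrow> full_step s t"
  by (erule step_mono) auto

lemma W_eq_refl: "s \<in> mtrees act_labels \<Longrightarrow> (s, s) \<in> W_eq"
  using equiv_W_eq by (meson equivE refl_onD)

lemma step_K_equiv:
  "s \<in> mtrees K_labels \<Longrightarrow> t \<in> mtrees K_labels \<Longrightarrow> contract_step s t \<Longrightarrow> (s, t) \<in> K_equiv"
  unfolding K_equiv_def tree_equiv_def by (auto intro: r_into_equivclp)

lemma K_equiv_refl: "s \<in> mtrees K_labels \<Longrightarrow> (s, s) \<in> K_equiv"
  using equiv_K_equiv by (meson equivE refl_onD)

lemma W_eq_typed:
  assumes "(s, t) \<in> W_eq"
  shows "color_of s = color_of t" "leaves s = leaves t"
proof -
  \<comment> \<open>Taking equality as target relation turns \<open>tree_equiv_map\<close> into a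
    proof of invariance.\<close>
  have Id: "equiv UNIV (Id :: 'b rel)" by (auto simp: equiv_def refl_on_def sym_def trans_def)
  have "(color_of s, color_of t) \<in> Id"
    using assms unfolding W_eq_def by (rule tree_equiv_map[OF _ Id]) (auto dest: step_color)
  moreover have "(leaves s, leaves t) \<in> Id"
    using assms unfolding W_eq_def by (rule tree_equiv_map[OF _ Id]) (auto dest: step_leaves)
  ultimately show "color_of s = color_of t" "leaves s = leaves t" by auto
qed

text \<open>A single inverse for both \<open>paint\<close> and \<open>reroot\<close>, chosen by the
  root color. Normalizing beforehand extends it to all representatives, so it descends to
  classes.\<close>

definition to_K :: "(color, unit) tree \<Rightarrow> (unit, unit) tree" where
  "to_K s = (if color_of s = Closed then unpaint (normalize s) else unroot_onto (normalize s) (Leaf ()))"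

lemma paint_mtrees: "t \<in> mtrees K_labels \<Longrightarrow> paint t \<in> mtrees act_labels"
  by (auto simp: mtrees_def admissible_paint admissible_reduced)

lemma reroot_typed:
  assumes "t \<in> mtrees K_labels"
  shows "admissible reduced_labels (reroot t)" "reroot t \<in> mtrees act_labels" "color_of (reroot t) = Open"
    "leaves (reroot t) = replicate (length (leaves t) - 1) Closed @ [Open]"
  using assms reroot_onto_typed[of t "Leaf Open"]
  by (auto simp: mtrees_def reroot_def leaves_reroot_onto root_ext_iff intro: admissible_reduced)

lemma to_K_typed:
  assumes "s \<in> mtrees act_labels"
  shows "to_K s \<in> mtrees K_labels" "length (leaves (to_K s)) = length (leaves s)"
proof -
  have s: "admissible act_labels s" "root_ext s" using assms by (auto simp: mtrees_def)
  note n = normalize_typed[OF s(1)]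
  have "to_K s \<in> mtrees K_labels \<and> length (leaves (to_K s)) = length (leaves s)"
  proof (cases "color_of s")
    case Closed
    then show ?thesis using n s by (simp add: mtrees_def to_K_def admissible_unpaint)
  next
    case Open
    moreover from this have "edge_length (normalize s) = 1" using n s(2) by (simp add: root_ext_iff)
    ultimately show ?thesis using n unroot_onto_typed[of "normalize s" "Leaf ()"]
      by (simp add: mtrees_def to_K_def)
  qed
  then show "to_K s \<in> mtrees K_labels" "length (leaves (to_K s)) = length (leaves s)" by auto
qed

lemma to_K_paint: "t \<in> mtrees K_labels \<Longrightarrow> to_K (paint t) = t"
  by (simp add: to_K_def normalize_reduced admissible_paint mtrees_def)

lemma to_K_reroot: "t \<in> mtrees K_labels \<Longrightarrow> to_K (reroot t) = t"
  using unroot_reroot_onto[of "Leaf Open" t]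
  by (simp add: to_K_def normalize_reduced reroot_typed) (simp add: reroot_def mtrees_def root_ext_iff)

lemma normalize_W_eq:
  assumes "s \<in> mtrees act_labels"
  shows "(s, normalize s) \<in> W_eq"
proof -
  have "full_step\<^sup>*\<^sup>* s (normalize s)" using assms by (simp add: steps_normalize mtrees_def)
  then have "normalize s \<in> mtrees act_labels \<and> (s, normalize s) \<in> W_eq"
  proof (induction rule: rtranclp_induct)
    case (step y z)
    then show ?case using step_mtrees step_W_eq equiv_W_eq by (meson equivE transD)
  qed (use assms W_eq_refl in auto)
  then show ?thesis ..
qed

lemma paint_to_K: "s \<in> mtrees act_labels \<Longrightarrow> color_of s = Closed \<Longrightarrow> (paint (to_K s), s) \<in> W_eq"
  using normalize_typed[of s] paint_unpaint[of "normalize s"] normalize_W_eq[of s] equiv_W_eq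
  by (simp add: to_K_def admissible_reduced mtrees_def) (meson equivE symD)

lemma reroot_to_K: "s \<in> mtrees act_labels \<Longrightarrow> color_of s = Open \<Longrightarrow> (reroot (to_K s), s) \<in> W_eq"
  using normalize_typed[of s] reroot_unroot_onto[of "normalize s" "Leaf ()"] normalize_W_eq[of s] equiv_W_eq
  by (simp add: to_K_def admissible_reduced mtrees_def reroot_def root_ext_iff) (meson equivE symD)

lemma paint_W_eq: "(s, t) \<in> K_equiv \<Longrightarrow> (paint s, paint t) \<in> W_eq"
  unfolding K_equiv_def
  by (erule tree_equiv_map[OF _ equiv_W_eq]) (auto intro: step_W_eq paint_mtrees step_paint contract_step_full)

lemma reroot_W_eq: "(s, t) \<in> K_equiv \<Longrightarrow> (reroot s, reroot t) \<in> W_eq"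
  unfolding K_equiv_def
proof (erule tree_equiv_map[OF _ equiv_W_eq])
  fix s t assume "s \<in> mtrees K_labels" "contract_step s t"
  then have "contract_step (reroot s) (reroot t)"
    unfolding reroot_def by (intro step_reroot_onto) (auto simp: mtrees_def)
  then show "(reroot s, reroot t) \<in> W_eq"
    using \<open>s \<in> mtrees K_labels\<close> by (intro step_W_eq reroot_typed contract_step_full)
qed (rule reroot_typed)

lemma to_K_equiv:
  assumes "(s, t) \<in> W_eq"
  shows "(to_K s, to_K t) \<in> K_equiv"
  using assms equiv_K_equiv unfolding W_eq_def
proof (rule tree_equiv_map)
  fix s t assume s: "s \<in> mtrees act_labels" and t: "t \<in> mtrees act_labels" and step: "full_step s t"
  have "to_K s = to_K t \<or> contract_step (to_K s) (to_K t)"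
    using normalize_step[OF step] s step_color[OF step] normalize_typed[of s]
    by (auto simp: to_K_def mtrees_def admissible_reduced intro: step_unpaint step_unroot_onto)
  then show "(to_K s, to_K t) \<in> K_equiv"
    using s t to_K_typed step_K_equiv K_equiv_refl by metis
qed (rule to_K_typed)

text \<open>\<open>to_K\<close> is a left inverse that respects the relations. Therefore statements
  about \<open>K_equiv\<close> can be derived from their colored versions.\<close>

lemma paint_W_eq_iff:
  assumes "s \<in> mtrees K_labels" "t \<in> mtrees K_labels"
  shows "(paint s, paint t) \<in> W_eq \<longleftrightarrow> (s, t) \<in> K_equiv"
  using assms paint_W_eq to_K_equiv to_K_paint by metis

section \<open>Compatibility of grafting and erasing with the equivalence relations\<close>

lemma graft_mtrees:
  "s \<in> mtrees L \<Longrightarrow> t \<in> mtrees L \<Longrightarrow> i < length (leaves s) \<Longrightarrow> color_of t = leaves s ! i \<Longrightarrow>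
   graft s i t \<in> mtrees L"
  using graft_typed(1)[of t L i s] by (auto simp: mtrees_def)

lemma W_eq_mtrees: "(s, t) \<in> W_eq \<Longrightarrow> s \<in> mtrees act_labels \<and> t \<in> mtrees act_labels"
  by (auto simp: W_eq_def tree_equiv_def)

lemma graft_W_eq:
  assumes "(s, s') \<in> W_eq" "(t, t') \<in> W_eq" "i < length (leaves s)" "color_of t = leaves s ! i"
  shows "(graft s i t, graft s' i t') \<in> W_eq"
proof -
  have m: "s \<in> mtrees act_labels" "s' \<in> mtrees act_labels" "t \<in> mtrees act_labels" "t' \<in> mtrees act_labels"
    using assms W_eq_mtrees by blast+
  \<comment> \<open>\<open>tree_equiv_map\<close> requires a map on all admissible trees, so
    grafting is extended by the identity to trees with other leaf words; steps do not change the
    leaf word.\<close>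
  define F where "F u = (if leaves u = leaves s then graft u i t else u)" for u
  have "(F s, F s') \<in> W_eq"
    using assms(1) equiv_W_eq unfolding W_eq_def
  proof (rule tree_equiv_map)
    fix u v assume uv: "u \<in> mtrees act_labels" "full_step u v"
    then show "(F u, F v) \<in> tree_equiv act_labels (\<lambda>_ _ _. ()) (\<lambda>_. {()})"
      using graft_step_left[OF uv(2) _ m(3), of i] m assms(3,4) step_W_eq[OF uv] step_leaves[OF uv(2)]
        step_W_eq[OF graft_mtrees[OF uv(1) m(3), of i]] W_eq_refl[OF graft_mtrees[OF uv(1) m(3), of i]]
      unfolding W_eq_def[symmetric] F_def by (auto simp: mtrees_def)
  qed (use m assms in \<open>auto simp: F_def intro: graft_mtrees\<close>)
  then have 1: "(graft s i t, graft s' i t) \<in> W_eq"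
    using W_eq_typed[OF assms(1)] by (simp add: F_def)
  define G where "G u = (if color_of u = color_of t then graft s' i u else u)" for u
  have s': "i < length (leaves s')" "color_of t = leaves s' ! i" using W_eq_typed[OF assms(1)] assms by auto
  have "(G t, G t') \<in> W_eq"
    using assms(2) equiv_W_eq unfolding W_eq_def
  proof (rule tree_equiv_map)
    fix u v assume uv: "u \<in> mtrees act_labels" "full_step u v"
    then show "(G u, G v) \<in> tree_equiv act_labels (\<lambda>_ _ _. ()) (\<lambda>_. {()})"
      using graft_step_right(1)[OF uv(2) s'(1)] s' step_W_eq[OF uv] step_color[OF uv(2)]
        step_W_eq[OF graft_mtrees[OF m(2) uv(1) s'(1)]]
      unfolding W_eq_def[symmetric] G_def by auto
  qed (use m s' in \<open>auto simp: G_def intro: graft_mtrees\<close>)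
  then have "(graft s' i t, graft s' i t') \<in> W_eq"
    using W_eq_typed[OF assms(2)] by (simp add: G_def)
  with 1 show ?thesis using equiv_W_eq by (meson equivE transD)
qed

text \<open>Lets \<open>tree_equiv_map\<close> take the results of erasing as values, with
  \<open>None\<close> as a class of its own.\<close>

definition option_rel :: "('a \<times> 'a) set \<Rightarrow> ('a option \<times> 'a option) set" where
  "option_rel R = insert (None, None) (map_prod Some Some ` R)"

lemma option_rel_simps [simp]:
  "(None, None) \<in> option_rel R" "(Some x, None) \<notin> option_rel R" "(None, Some y) \<notin> option_rel R"
  "(Some x, Some y) \<in> option_rel R \<longleftrightarrow> (x, y) \<in> R"
  by (auto simp: option_rel_def)

lemma equiv_option_rel:
  assumes "equiv A R"
  shows "equiv (insert None (Some ` A)) (option_rel R)"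
proof (rule equivI)
  note R = equivE[OF assms]
  show "option_rel R \<subseteq> insert None (Some ` A) \<times> insert None (Some ` A)"
    using assms by (auto simp: option_rel_def equiv_def)
  show "refl_on (insert None (Some ` A)) (option_rel R)"
  proof (rule refl_onI)
    fix x assume "x \<in> insert None (Some ` A)"
    then show "(x, x) \<in> option_rel R" using R by (cases x) (auto intro: refl_onD)
  qed
  show "sym (option_rel R)"
  proof (rule symI)
    fix x y assume "(x, y) \<in> option_rel R"
    then show "(y, x) \<in> option_rel R" using R by (cases x; cases y) (auto dest: symD)
  qed
  show "trans (option_rel R)"
  proof (rule transI)
    fix x y z assume "(x, y) \<in> option_rel R" "(y, z) \<in> option_rel R"
    then show "(x, z) \<in> option_rel R" using R by (cases x; cases y; cases z) (auto dest: transD)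
  qed
qed

lemma erase_mtrees:
  "s \<in> mtrees act_labels \<Longrightarrow> i < length (leaves s) \<Longrightarrow> leaves s ! i = Closed \<Longrightarrow> erase s i = Some t \<Longrightarrow>
   t \<in> mtrees act_labels \<and> color_of t = color_of s \<and> leaves t = take i (leaves s) @ drop (Suc i) (leaves s)"
  using act.erase_typed(1)[of s i] by (auto simp: mtrees_def)

lemma erase_W_eq:
  assumes "(s, s') \<in> W_eq" "i < length (leaves s)" "leaves s ! i = Closed"
  shows "(erase s i, erase s' i) \<in> option_rel W_eq"
proof -
  define F where "F u = (if leaves u = leaves s then erase u i else None)" for u
  have "(F s, F s') \<in> option_rel W_eq"
  proof (rule tree_equiv_map[OF assms(1)[unfolded W_eq_def]])
    show "equiv (insert None (Some ` mtrees act_labels)) (option_rel W_eq)"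
      using equiv_W_eq by (rule equiv_option_rel)
    fix u v assume uv: "u \<in> mtrees act_labels" "full_step u v"
    show "(F u, F v) \<in> option_rel W_eq"
    proof (cases "leaves u = leaves s")
      case True
      then have "step_option (erase u i) (erase v i)"
        using erase_step[OF uv(2)] uv(1) assms by (simp add: mtrees_def)
      moreover have "x \<in> mtrees act_labels" if "erase u i = Some x" for x
        using erase_mtrees[OF uv(1) _ _ that] True assms by simp
      ultimately have "(erase u i, erase v i) \<in> option_rel W_eq"
        by (cases "erase u i"; cases "erase v i") (auto simp: step_option_def intro: step_W_eq W_eq_refl)
      then show ?thesis using True step_leaves[OF uv(2)] by (simp add: F_def)
    qed (use step_leaves[OF uv(2)] in \<open>simp add: F_def\<close>)
  next
    fix u assume "u \<in> mtrees act_labels"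
    then have "x \<in> mtrees act_labels" if "leaves u = leaves s" "erase u i = Some x" for x
      using erase_mtrees[of u i x] assms that by simp
    then show "F u \<in> insert None (Some ` mtrees act_labels)"
      by (cases "erase u i") (auto simp: F_def)
  qed
  then show ?thesis using W_eq_typed[OF assms(1)] by (simp add: F_def)
qed

text \<open>Inherited from colored trees: painting commutes with grafting and reflects
  equivalence.\<close>

lemma graft_K_equiv:
  assumes "(s, s') \<in> K_equiv" "(t, t') \<in> K_equiv" "i < length (leaves s)"
  shows "(graft s i t, graft s' i t') \<in> K_equiv"
proof -
  have m: "s \<in> mtrees K_labels" "s' \<in> mtrees K_labels" "t \<in> mtrees K_labels" "t' \<in> mtrees K_labels"
    using assms by (auto simp: K_equiv_def tree_equiv_def)
  have "length (leaves s') = length (leaves s)"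
    using W_eq_typed(2)[OF paint_W_eq[OF assms(1)]] by (metis leaves_paint length_map)
  then have "graft s i t \<in> mtrees K_labels" "graft s' i t' \<in> mtrees K_labels"
    using m assms(3) by (auto intro: graft_mtrees)
  moreover have "(paint (graft s i t), paint (graft s' i t')) \<in> W_eq"
    unfolding paint_graft using assms by (intro graft_W_eq paint_W_eq) auto
  ultimately show ?thesis using paint_W_eq_iff by blast
qed

lemma K_erase_mtrees:
  "s \<in> mtrees K_labels \<Longrightarrow> i < length (leaves s) \<Longrightarrow> erase s i = Some t \<Longrightarrow>
   t \<in> mtrees K_labels \<and> length (leaves t) = length (leaves s) - 1"
  using K.erase_typed(1)[of s i] by (auto simp: mtrees_def)

lemma erase_K_equiv:
  assumes "(s, s') \<in> K_equiv" "i < length (leaves s)"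
  shows "(erase s i, erase s' i) \<in> option_rel K_equiv"
proof -
  have m: "s \<in> mtrees K_labels" "s' \<in> mtrees K_labels"
    using assms by (auto simp: K_equiv_def tree_equiv_def)
  have "length (leaves s') = length (leaves s)"
    using W_eq_typed(2)[OF paint_W_eq[OF assms(1)]] by (metis leaves_paint length_map)
  then have "x \<in> mtrees K_labels" if "erase s i = Some x \<or> erase s' i = Some x" for x
    using K_erase_mtrees[of _ i x] m assms that by metis
  moreover have "(erase (paint s) i, erase (paint s') i) \<in> option_rel W_eq"
    using assms by (intro erase_W_eq paint_W_eq) auto
  ultimately show ?thesis
    by (cases "erase s i"; cases "erase s' i") (auto simp: paint_erase paint_W_eq_iff)
qed

text \<open>Compositions of classes are saturations of sets of composites; this reduces them to the
  class of one composite.\<close>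

lemma Image_eq_class:
  assumes "equiv A R" "x \<in> S" "\<And>y. y \<in> S \<Longrightarrow> (x, y) \<in> R"
  shows "R `` S = R `` {x}"
  using assms by (auto 4 4 simp: equiv_def dest: transD)

lemma pcomp_with_delta0_Some:
  assumes R: "equiv A R" and "s \<in> A" "t \<in> A"
    and "\<And>s' t'. (s, s') \<in> R \<Longrightarrow> (t, t') \<in> R \<Longrightarrow> (graft s i t, graft s' i t') \<in> R"
  shows "pcomp_with_delta0 R (Some (R `` {s})) i (Some (R `` {t})) = Some (R `` {graft s i t})"
proof -
  have "s \<in> R `` {s}" "t \<in> R `` {t}" using equiv_class_self[OF R] assms(2,3) by blast+
  then show ?thesis
    unfolding pcomp_with_delta0.simps graft_classes_def
    using assms(4) by (auto intro!: Image_eq_class[OF R] simp del: Image_singleton_iff)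
qed

lemma pcomp_with_delta0_None:
  assumes R: "equiv A R" and "s \<in> A"
    and step: "\<And>s'. (s, s') \<in> R \<Longrightarrow> (erase s i, erase s' i) \<in> option_rel R"
  shows "pcomp_with_delta0 R (Some (R `` {s})) i None = map_option (\<lambda>u. R `` {u}) (erase s i)"
proof -
  have s: "s \<in> R `` {s}" using equiv_class_self[OF R] assms(2) by blast
  define B where "B = {t. \<exists>s'\<in>R `` {s}. erase s' i = Some t}"
  have eq: "pcomp_with_delta0 R (Some (R `` {s})) i None = (if B = {} then None else Some (R `` B))"
    by (simp add: B_def Let_def)
  show ?thesis
  proof (cases "erase s i")
    case None
    then have "B = {}" using step unfolding B_def by fastforce
    then show ?thesis using eq None by simp
  next
    case (Some u)
    then have "u \<in> B" using s by (auto simp: B_def)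
    moreover have "(u, y) \<in> R" if "y \<in> B" for y
      using that step Some unfolding B_def by fastforce
    ultimately have "R `` B = R `` {u}" by (intro Image_eq_class[OF R])
    then show ?thesis using eq Some \<open>u \<in> B\<close> by auto
  qed
qed

section \<open>The operations of \<open>Act\<^sub>\<infinity>\<close> and metric trees\<close>

definition W_class :: "(color, unit) tree \<Rightarrow> (color, unit) tree set option" where
  "W_class s = Some (W_eq `` {s})"

definition K_class :: "(unit, unit) tree \<Rightarrow> kpoint" where
  "K_class t = Some (K_equiv `` {t})"

definition to_kpoint :: "(color, unit) tree set option \<Rightarrow> kpoint" where
  "to_kpoint = map_option (\<lambda>A. K_equiv `` (to_K ` A))"

lemma map_class:
  assumes "equiv A R" "equiv B S" "x \<in> A" "\<And>y. (x, y) \<in> R \<Longrightarrow> (F x, F y) \<in> S"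
  shows "S `` (F ` (R `` {x})) = S `` {F x}"
  using assms(3,4) equiv_class_self[OF assms(1,3)] by (intro Image_eq_class[OF assms(2)]) auto

lemma closed_op_class: "t \<in> mtrees K_labels \<Longrightarrow> closed_op (K_class t) = W_class (paint t)"
  using map_class[OF equiv_K_equiv equiv_W_eq, of t paint] paint_W_eq
  by (simp add: closed_op_def K_class_def W_class_def)

lemma open_op_class: "t \<in> mtrees K_labels \<Longrightarrow> open_op (K_class t) = W_class (reroot t)"
  using map_class[OF equiv_K_equiv equiv_W_eq, of t reroot] reroot_W_eq
  by (simp add: open_op_def K_class_def W_class_def)

lemma to_kpoint_class: "s \<in> mtrees act_labels \<Longrightarrow> to_kpoint (W_class s) = K_class (to_K s)"
  using map_class[OF equiv_W_eq equiv_K_equiv, of s to_K] to_K_equiv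
  by (simp add: to_kpoint_def K_class_def W_class_def)

lemma op_None [simp]: "closed_op None = None" "open_op None = None" "to_kpoint None = None"
  by (simp_all add: closed_op_def open_op_def to_kpoint_def)

lemma topspace_quotient_topology [simp]: "topspace (quotient_topology X q) = q ` topspace X"
proof
  have "{x \<in> topspace X. q x \<in> q ` topspace X} = topspace X" by auto
  then have "openin (quotient_topology X q) (q ` topspace X)" by (simp add: openin_quotient_topology)
  then show "q ` topspace X \<subseteq> topspace (quotient_topology X q)" by (rule openin_subset)
  show "topspace (quotient_topology X q) \<subseteq> q ` topspace X"
    using openin_topspace[of "quotient_topology X q"] by (simp only: openin_quotient_topology)
qed

lemma topspace_tree_topology [simp]: "topspace (tree_topology A) = A"
  by (auto simp: tree_topology_def topspace_pullback_topology)

lemma topspace_K: "topspace (K n) =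
    (if n = 0 then {None} else K_class ` {t \<in> mtrees K_labels. length (leaves t) = n})"
  by (simp add: K_def K_class_def[abs_def])

lemma topspace_Act_inf: "topspace (ops Act_inf w x) =
    (if w = [] \<and> x = Closed then {None}
     else W_class ` {s \<in> mtrees act_labels. leaves s = w \<and> color_of s = x})"
  by (auto simp: Act_inf_def W_class_def[abs_def] W_def image_image)

lemma K_comp_class:
  assumes "s \<in> mtrees K_labels" "i < length (leaves s)"
  shows "t \<in> mtrees K_labels \<Longrightarrow> K_comp (K_class s) i (K_class t) = K_class (graft s i t)"
    and "K_comp (K_class s) i None = map_option (\<lambda>u. K_equiv `` {u}) (erase s i)"
proof -
  show "K_comp (K_class s) i (K_class t) = K_class (graft s i t)" if "t \<in> mtrees K_labels"
    unfolding K_comp_def K_class_def using assms that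
    by (intro pcomp_with_delta0_Some[OF equiv_K_equiv] graft_K_equiv)
  show "K_comp (K_class s) i None = map_option (\<lambda>u. K_equiv `` {u}) (erase s i)"
    unfolding K_comp_def K_class_def using assms
    by (intro pcomp_with_delta0_None[OF equiv_K_equiv] erase_K_equiv)
qed

lemma Act_inf_comp_class:
  assumes "s \<in> mtrees act_labels" "i < length (leaves s)"
  shows "t \<in> mtrees act_labels \<Longrightarrow> color_of t = leaves s ! i \<Longrightarrow>
      pcomp Act_inf (W_class s) i (W_class t) = W_class (graft s i t)"
    and "leaves s ! i = Closed \<Longrightarrow>
      pcomp Act_inf (W_class s) i None = map_option (\<lambda>u. W_eq `` {u}) (erase s i)"
proof -
  have comp: "pcomp Act_inf = pcomp_with_delta0 W_eq" by (simp add: Act_inf_def)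
  show "pcomp Act_inf (W_class s) i (W_class t) = W_class (graft s i t)"
    if "t \<in> mtrees act_labels" "color_of t = leaves s ! i"
    unfolding comp W_class_def using assms that
    by (intro pcomp_with_delta0_Some[OF equiv_W_eq] graft_W_eq)
  show "pcomp Act_inf (W_class s) i None = map_option (\<lambda>u. W_eq `` {u}) (erase s i)"
    if "leaves s ! i = Closed"
    unfolding comp W_class_def using assms that
    by (intro pcomp_with_delta0_None[OF equiv_W_eq] erase_W_eq)
qed

lemma K_comp_in_K:
  assumes "S \<in> topspace (K n)" "T \<in> topspace (K m)" "i < n"
  shows "K_comp S i T \<in> topspace (K (n - 1 + m))"
proof -
  obtain s where s: "s \<in> mtrees K_labels" "length (leaves s) = n" "S = K_class s"
    using assms by (auto simp: topspace_K split: if_splits)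
  show ?thesis
  proof (cases "m = 0")
    case True
    then have T: "T = None" using assms by (simp add: topspace_K)
    show ?thesis
    proof (cases "erase s i")
      \<comment> \<open>Nothing is left only if \<open>n = 1\<close>, and then the result is the
        point of \<open>K 0\<close>.\<close>
      case None
      then show ?thesis using K_comp_class(2)[OF s(1)] K.erase_typed(1)[of s i] s assms(3) True T
        by (auto simp: mtrees_def topspace_K)
    next
      case (Some u)
      then have u: "u \<in> mtrees K_labels" "length (leaves u) = n - 1"
        using K_erase_mtrees[OF s(1) _ Some] s assms by auto
      moreover have "leaves u \<noteq> []" using u(1) leaves_K_nonempty by (auto simp: mtrees_def)
      ultimately show ?thesis using K_comp_class(2)[OF s(1)] s assms(3) True T Some
        by (auto simp: topspace_K K_class_def)
    qed
  next
    case False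
    then obtain t where t: "t \<in> mtrees K_labels" "length (leaves t) = m" "T = K_class t"
      using assms by (auto simp: topspace_K split: if_splits)
    have "length (leaves (graft s i t)) = n - 1 + m"
      using graft_typed(1)[of t K_labels i s] s t assms(3) by (auto simp: mtrees_def)
    then show ?thesis using s t assms K_comp_class(1)[OF s(1) _ t(1)] False
      by (auto simp: topspace_K graft_mtrees)
  qed
qed

lemma closed_op_comp:
  assumes "S \<in> topspace (K n)" "T \<in> topspace (K m)" "i < n"
  shows "closed_op (K_comp S i T) = pcomp Act_inf (closed_op S) i (closed_op T)"
proof -
  obtain s where s: "s \<in> mtrees K_labels" "length (leaves s) = n" "S = K_class s"
    using assms by (auto simp: topspace_K split: if_splits)
  note ps = paint_mtrees[OF s(1)]
  show ?thesis
  proof (cases "m = 0")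
    case True
    then have T: "T = None" using assms by (simp add: topspace_K)
    have "closed_op (map_option (\<lambda>u. K_equiv `` {u}) (erase s i)) =
        map_option (\<lambda>u. W_eq `` {u}) (map_option paint (erase s i))"
    proof (cases "erase s i")
      case (Some u)
      then show ?thesis
        using K_erase_mtrees[OF s(1) _ Some] s assms closed_op_class[of u]
        by (simp add: K_class_def W_class_def)
    qed simp
    then show ?thesis
      using s assms T K_comp_class(2)[OF s(1)] Act_inf_comp_class(2)[OF ps]
      by (simp add: closed_op_class paint_erase)
  next
    case False
    then obtain t where t: "t \<in> mtrees K_labels" "length (leaves t) = m" "T = K_class t"
      using assms by (auto simp: topspace_K split: if_splits)
    then show ?thesis
      using s assms K_comp_class(1)[OF s(1) _ t(1)] Act_inf_comp_class(1)[OF ps _ paint_mtrees[OF t(1)]]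
      by (simp add: closed_op_class paint_graft graft_mtrees)
  qed
qed

text \<open>Leaf 0 of a metric tree corresponds to the output, so input \<open>i\<close> of the open
  operation is leaf \<open>Suc i\<close>.\<close>

lemma open_op_comp_closed:
  assumes "S \<in> topspace (K (Suc n))" "T \<in> topspace (K m)" "i < n"
  shows "open_op (K_comp S (Suc i) T) = pcomp Act_inf (open_op S) i (closed_op T)"
proof -
  obtain s where s: "s \<in> mtrees K_labels" "length (leaves s) = Suc n" "S = K_class s"
    using assms by (auto simp: topspace_K split: if_splits)
  note rs = reroot_typed[OF s(1)]
  have i: "i < length (leaves (reroot s))" "leaves (reroot s) ! i = Closed"
    using rs(4) s(2) assms(3) by (auto simp: nth_append)
  show ?thesis
  proof (cases "m = 0")
    case True
    then have T: "T = None" using assms by (simp add: topspace_K)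
    \<comment> \<open>Leaf 0 remains, so erasing cannot leave nothing.\<close>
    obtain u where u: "erase s (Suc i) = Some u"
      using K.erase_typed(1)[of s "Suc i"] s assms(3) by (cases "erase s (Suc i)") (auto simp: mtrees_def)
    have "erase (reroot s) i = Some (reroot u)"
      using erase_reroot_onto[OF _ _ _ u, of "Leaf Open"] s assms(3)
      by (auto simp: reroot_def mtrees_def root_ext_iff)
    then show ?thesis
      using s assms T K_comp_class(2)[OF s(1)] Act_inf_comp_class(2)[OF rs(2) i] u
        K_erase_mtrees[OF s(1) _ u] open_op_class[of u]
      by (simp add: open_op_class K_class_def[of u] W_class_def[of "reroot u"])
  next
    case False
    then obtain t where t: "t \<in> mtrees K_labels" "length (leaves t) = m" "T = K_class t"
      using assms by (auto simp: topspace_K split: if_splits)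
    have "reroot (graft s (Suc i) t) = graft (reroot s) i (paint t)"
      unfolding reroot_def using s assms(3) by (subst graft_reroot_onto) (auto simp: mtrees_def)
    then show ?thesis
      using s t assms K_comp_class(1)[OF s(1) _ t(1)] Act_inf_comp_class(1)[OF rs(2) i(1) paint_mtrees[OF t(1)]] i(2)
      by (simp add: closed_op_class open_op_class graft_mtrees)
  qed
qed

text \<open>Reversal exchanges outer and inner operation. The open input of the operation of
  \<open>T\<close> has number \<open>m\<close>, as it follows \<open>m\<close> closed ones.\<close>

lemma open_op_comp_open:
  assumes "S \<in> topspace (K (Suc n))" "T \<in> topspace (K (Suc m))"
  shows "open_op (K_comp S 0 T) = pcomp Act_inf (open_op T) m (open_op S)"
proof -
  obtain s where s: "s \<in> mtrees K_labels" "length (leaves s) = Suc n" "S = K_class s"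
    using assms by (auto simp: topspace_K split: if_splits)
  obtain t where t: "t \<in> mtrees K_labels" "length (leaves t) = Suc m" "T = K_class t"
    using assms by (auto simp: topspace_K split: if_splits)
  note rs = reroot_typed[OF s(1)] and rt = reroot_typed[OF t(1)]
  have "reroot (graft s 0 t) = graft (reroot t) m (reroot s)"
    using reroot_onto_graft_0[of s t "Leaf Open"] graft_reroot_onto_acc[of t 0 "Leaf Open" "reroot s"] s t
    by (simp add: reroot_def mtrees_def)
  then show ?thesis
    using s t assms K_comp_class(1)[OF s(1) _ t(1)] Act_inf_comp_class(1)[OF rt(2) _ rs(2), of m] rs rt
    by (simp add: closed_op_class open_op_class graft_mtrees nth_append)
qed

text \<open>A vertex has at least two inputs, and there is a leaf above each of them; so a tree with
  one leaf has no vertex.\<close>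

lemma topspace_K_1: "topspace (K 1) = {delta1}"
proof -
  have "t = Leaf ()" if t: "t \<in> mtrees K_labels" "length (leaves t) = 1" for t
  proof (cases t)
    case (Node c l a ts)
    have "2 \<le> length ts" using Node t(1) by (auto simp: mtrees_def K_labels_def split: if_splits)
    then obtain u v us where ts: "ts = u # v # us"
      by (cases ts rule: remdups_adj.cases) auto
    then have "leaves u \<noteq> []" "leaves v \<noteq> []"
      using Node t(1) leaves_K_nonempty by (auto simp: mtrees_def)
    then show ?thesis using Node ts t(2) by (cases "leaves u"; cases "leaves v") simp_all
  qed simp
  moreover have "Leaf () \<in> mtrees K_labels" "length (leaves (Leaf ())) = 1" by (simp_all add: mtrees_def)
  ultimately have "{t \<in> mtrees K_labels. length (leaves t) = 1} = {Leaf ()}" by blast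
  then show ?thesis by (simp add: topspace_K delta1_def K_class_def)
qed

lemma graft_unit_Leaf:
  fixes t :: "(unit, unit) tree" and ts :: "(unit, unit) tree list"
  shows "graft t i (Leaf ()) = t" "graft_list ts i (Leaf ()) = ts"
proof -
  \<comment> \<open>The grafted tree is kept as a variable with an equation, since the induction
    rule runs over arbitrary arguments.\<close>
  have "s = Leaf () \<longrightarrow> graft t i s = t" "s = Leaf () \<longrightarrow> graft_list ts i s = ts" for s :: "(unit, unit) tree"
    by (induction t i s and ts i s rule: graft_graft_list.induct) auto
  then show "graft t i (Leaf ()) = t" "graft_list ts i (Leaf ()) = ts" by auto
qed

lemma K_comp_delta1:
  "T \<in> topspace (K n) \<Longrightarrow> K_comp delta1 0 T = T"
  "T \<in> topspace (K n) \<Longrightarrow> i < n \<Longrightarrow> K_comp T i delta1 = T"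
proof -
  have Leaf: "Leaf () \<in> mtrees K_labels" by (simp add: mtrees_def)
  have delta1: "delta1 = K_class (Leaf ())" by (simp add: delta1_def K_class_def)
  show "K_comp delta1 0 T = T" if "T \<in> topspace (K n)"
    using that K_comp_class[OF Leaf, of 0] unfolding delta1 by (auto simp: topspace_K split: if_splits)
  show "K_comp T i delta1 = T" if "T \<in> topspace (K n)" "i < n"
    using that K_comp_class(1)[OF _ _ Leaf] unfolding delta1
    by (auto simp: topspace_K graft_unit_Leaf split: if_splits)
qed

section \<open>Operations with closed and open output as points of the spaces
  \<open>K n\<close>\<close>

lemma op_delta1: "closed_op delta1 = idop Act_inf Closed" "open_op delta1 = idop Act_inf Open"
  using closed_op_class[of "Leaf ()"] open_op_class[of "Leaf ()"]
  by (simp_all add: mtrees_def delta1_def K_class_def W_class_def Act_inf_def W_def reroot_def)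

lemma closed_op_in: "T \<in> topspace (K n) \<Longrightarrow> closed_op T \<in> topspace (ops Act_inf (replicate n Closed) Closed)"
  by (auto simp: topspace_K topspace_Act_inf closed_op_class paint_mtrees map_replicate_const split: if_splits)

lemma open_op_in: "T \<in> topspace (K (Suc n)) \<Longrightarrow> open_op T \<in> topspace (ops Act_inf (replicate n Closed @ [Open]) Open)"
  by (auto simp: topspace_K topspace_Act_inf open_op_class reroot_typed split: if_splits)

lemma to_kpoint_in:
  assumes "A \<in> topspace (ops Act_inf w x)"
  shows "to_kpoint A \<in> topspace (K (length w))"
    and "x = Closed \<Longrightarrow> closed_op (to_kpoint A) = A"
    and "x = Open \<Longrightarrow> open_op (to_kpoint A) = A"
proof -
  have "to_kpoint A \<in> topspace (K (length w)) \<and> (x = Closed \<longrightarrow> closed_op (to_kpoint A) = A) \<and>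
      (x = Open \<longrightarrow> open_op (to_kpoint A) = A)"
  proof (cases "w = [] \<and> x = Closed")
    case True
    then show ?thesis using assms by (simp add: topspace_Act_inf topspace_K)
  next
    case False
    then obtain s where s: "s \<in> mtrees act_labels" "leaves s = w" "color_of s = x" "A = W_class s"
      using assms by (auto simp: topspace_Act_inf)
    have "w \<noteq> []" using s leaves_in_act_labels[of s] by (auto simp: mtrees_def in_act_labels)
    moreover have "W_class (paint (to_K s)) = A" if "x = Closed"
      using equiv_class_eq[OF equiv_W_eq paint_to_K[OF s(1)]] s that by (simp add: W_class_def)
    moreover have "W_class (reroot (to_K s)) = A" if "x = Open"
      using equiv_class_eq[OF equiv_W_eq reroot_to_K[OF s(1)]] s that by (simp add: W_class_def)
    ultimately show ?thesis
      using s to_K_typed[OF s(1)] by (auto simp: to_kpoint_class topspace_K closed_op_class open_op_class)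
  qed
  then show "to_kpoint A \<in> topspace (K (length w))" "x = Closed \<Longrightarrow> closed_op (to_kpoint A) = A"
    "x = Open \<Longrightarrow> open_op (to_kpoint A) = A" by auto
qed

lemma to_kpoint_op:
  "T \<in> topspace (K n) \<Longrightarrow> to_kpoint (closed_op T) = T"
  "T \<in> topspace (K n) \<Longrightarrow> to_kpoint (open_op T) = T"
  by (auto simp: topspace_K closed_op_class open_op_class to_kpoint_class paint_mtrees reroot_typed to_K_paint
      to_K_reroot split: if_splits)

text \<open>Reduces an arbitrary word to the two families in which operations exist and are
  described by metric trees.\<close>

lemma Act_inf_arity:
  assumes "A \<in> topspace (ops Act_inf w x)"
  shows "x = Closed \<and> w = replicate (length w) Closed \<or>
    x = Open \<and> w = replicate (length w - 1) Closed @ [Open]"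
proof (cases "w = [] \<and> x = Closed")
  case False
  then have "() \<in> act_labels w x"
    using assms leaves_in_act_labels by (auto simp: topspace_Act_inf mtrees_def)
  then have w: "w = butlast w @ [x]" "set (butlast w) \<subseteq> {Closed}" by (auto simp: in_act_labels)
  then have "butlast w = replicate (length w - 1) Closed"
    using replicate_eqI[of "butlast w" "length w - 1" Closed] by auto
  then have "w = replicate (length w - 1) Closed @ [x]" using w(1) by simp
  then show ?thesis
    by (cases x) (metis Suc_diff_1 append_Nil2 length_append_singleton length_replicate replicate_append_same replicate_Suc, simp)
qed simp

section \<open>Continuity of maps between spaces of trees\<close>

text \<open>Balls of the supremum metric on each cube of edge lengths, different combinatorial types
  being infinitely far apart. The recursive form fits maps defined by recursion on trees.\<close>

fun near :: "real \<Rightarrow> ('c, 'a) tree \<Rightarrow> ('c, 'a) tree \<Rightarrow> bool" where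
  "near e (Leaf c) (Leaf d) \<longleftrightarrow> c = d"
| "near e (Node c l a ts) (Node d m b us) \<longleftrightarrow> c = d \<and> a = b \<and> \<bar>l - m\<bar> < e \<and> list_all2 (near e) ts us"
| "near e _ _ \<longleftrightarrow> False"

lemma length_lengths_cong: "shape s = shape t \<Longrightarrow> length (lengths s) = length (lengths t)"
proof (induction s arbitrary: t)
  case (Leaf c)
  then show ?case by (cases t) auto
next
  case (Node c l a ts)
  then obtain m us where t: "t = Node c m a us" and eq: "map shape ts = map shape us" by (cases t) auto
  have "length (concat (map lengths ts)) = length (concat (map lengths us))"
    using eq Node.IH
  proof (induction ts arbitrary: us)
    case (Cons s ts)
    then obtain u us' where us: "us = u # us'" "shape s = shape u" "map shape ts = map shape us'"
      by (cases us) auto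
    have "length (lengths s) = length (lengths u)" using Cons.prems(2) us by simp
    moreover have "length (concat (map lengths ts)) = length (concat (map lengths us'))"
      by (rule Cons.IH) (use Cons.prems us in auto)
    ultimately show ?case using us by simp
  qed simp
  then show ?case using t by simp
qed

lemma near_iff:
  "near e s t \<longleftrightarrow> shape s = shape t \<and> list_all2 (\<lambda>x y. \<bar>x - y\<bar> < e) (lengths s) (lengths t)"
proof (induction s arbitrary: t)
  case (Leaf c)
  then show ?case by (cases t) auto
next
  case (Node c l a ts)
  have "list_all2 (near e) ts us \<longleftrightarrow> map shape ts = map shape us \<and>
      list_all2 (\<lambda>x y. \<bar>x - y\<bar> < e) (concat (map lengths ts)) (concat (map lengths us))" for us
    using Node.IH
  proof (induction ts arbitrary: us)
    case (Cons s ts)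
    show ?case
    proof (cases us)
      case (Cons u us')
      then show ?thesis
        using Cons.prems(1)[of s] Cons.IH[of us'] Cons.prems length_lengths_cong[of s u]
        by (auto simp: list_all2_append)
    qed auto
  qed auto
  then show ?case by (cases t) auto
qed

text \<open>The product over all indices causes no difference from these balls: a tree has finitely
  many lengths, and beyond them the sequences of all trees of its type vanish.\<close>

lemma openin_tree_topology:
  "openin (tree_topology A) U \<longleftrightarrow> U \<subseteq> A \<and> (\<forall>t\<in>U. \<exists>e>0. \<forall>u\<in>A. near e t u \<longrightarrow> u \<in> U)"
proof -
  define g :: "('a, 'b) tree \<Rightarrow> nat \<Rightarrow> real"
    where "g t = (\<lambda>i. if i < length (lengths t) then lengths t ! i else 0)" for t
  let ?T = "prod_topology (discrete_topology UNIV) (product_topology (\<lambda>_. euclideanreal) UNIV)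
      :: (('a, 'b) tree \<times> (nat \<Rightarrow> real)) topology"
  have near: "near e s t \<longleftrightarrow> shape s = shape t \<and> (\<forall>i<length (lengths s). \<bar>g s i - g t i\<bar> < e)" for e s t
    using length_lengths_cong[of s t] by (auto simp: near_iff list_all2_conv_all_nth g_def)
  have eq: "openin (tree_topology A) U \<longleftrightarrow> (\<exists>V. openin ?T V \<and> U = (\<lambda>t. (shape t, g t)) -` V \<inter> A)"
    unfolding tree_topology_def openin_pullback_topology g_def ..
  show ?thesis
    unfolding eq
  proof (intro iffI conjI ballI)
    assume "\<exists>V. openin ?T V \<and> U = (\<lambda>t. (shape t, g t)) -` V \<inter> A"
    then obtain V where V: "openin ?T V" "U = (\<lambda>t. (shape t, g t)) -` V \<inter> A" by blast
    then show "U \<subseteq> A" by auto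
    fix t assume "t \<in> U"
    then have tV: "(shape t, g t) \<in> V" using V(2) by auto
    obtain S B where B: "shape t \<in> S" "openin (product_topology (\<lambda>_. euclideanreal) UNIV) B" "g t \<in> B" "S \<times> B \<subseteq> V"
      using V(1)[unfolded openin_prod_topology_alt, rule_format, OF tV] by blast
    obtain X where X: "g t \<in> (\<Pi>\<^sub>E i\<in>UNIV. X i)" "\<And>i. open (X i)" "finite {i. X i \<noteq> UNIV}" "(\<Pi>\<^sub>E i\<in>UNIV. X i) \<subseteq> B"
      using product_topology_open_contains_basis[OF B(2,3)] by auto
    have "\<forall>i. \<exists>e>0. \<forall>y. \<bar>g t i - y\<bar> < e \<longrightarrow> y \<in> X i"
    proof
      fix i
      have "g t i \<in> X i" using X(1) by (auto simp: PiE_iff)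
      then obtain e where "e > 0" "\<forall>y. dist y (g t i) < e \<longrightarrow> y \<in> X i"
        using X(2)[of i] open_dist by blast
      then show "\<exists>e>0. \<forall>y. \<bar>g t i - y\<bar> < e \<longrightarrow> y \<in> X i"
        by (intro exI[of _ e]) (auto simp: dist_real_def abs_minus_commute)
    qed
    then obtain d where d: "\<And>i. d i > 0" "\<And>i y. \<bar>g t i - y\<bar> < d i \<Longrightarrow> y \<in> X i" by metis
    \<comment> \<open>Only finitely many factors are restricted; the 1 covers the case that none
      is.\<close>
    define e where "e = Min (insert 1 (d ` {i. X i \<noteq> UNIV}))"
    have "e > 0" using X(3) d(1) by (auto simp: e_def)
    moreover have "u \<in> U" if "u \<in> A" "near e t u" for u
    proof -
      have "g u i \<in> X i" for i
      proof (cases "X i = UNIV")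
        case False
        then have "e \<le> d i" using X(3) by (auto simp: e_def)
        moreover have "\<bar>g t i - g u i\<bar> < e"
        proof (cases "i < length (lengths t)")
          case False
          then have "g t i = 0" "g u i = 0" using that length_lengths_cong[of t u] by (auto simp: near g_def)
          then show ?thesis using \<open>e > 0\<close> by simp
        qed (use that near in auto)
        ultimately show ?thesis using d(2)[of i "g u i"] by simp
      qed simp
      then have "(shape u, g u) \<in> S \<times> B" using X(4) B(1) that near by (auto simp: PiE_iff)
      then show ?thesis using V B(4) that by auto
    qed
    ultimately show "\<exists>e>0. \<forall>u\<in>A. near e t u \<longrightarrow> u \<in> U" by blast
  next
    assume "U \<subseteq> A \<and> (\<forall>t\<in>U. \<exists>e>0. \<forall>u\<in>A. near e t u \<longrightarrow> u \<in> U)"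
    then obtain e where e: "U \<subseteq> A" "\<And>t. t \<in> U \<Longrightarrow> e t > 0" "\<And>t u. t \<in> U \<Longrightarrow> u \<in> A \<Longrightarrow> near (e t) t u \<Longrightarrow> u \<in> U"
      by metis
    \<comment> \<open>Coordinates beyond the edges are left free, so that each box is open in the
      infinite product.\<close>
    define X where "X t i = (if i < length (lengths t) then {y. \<bar>g t i - y\<bar> < e t} else UNIV)" for t i
    define V where "V = (\<Union>t\<in>U. {shape t} \<times> (\<Pi>\<^sub>E i\<in>UNIV. X t i))"
    have open': "open {y. \<bar>g t i - y\<bar> < e t}" for t i
      by (intro open_Collect_less continuous_intros)
    have fin: "finite {i. X t i \<noteq> UNIV}" for t
      by (rule finite_subset[of _ "{..<length (lengths t)}"]) (auto simp: X_def)
    have "openin (product_topology (\<lambda>_. euclideanreal) UNIV) (\<Pi>\<^sub>E i\<in>UNIV. X t i)" for t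
      by (rule product_topology_basis) (use open' fin in \<open>auto simp: X_def\<close>)
    then have "openin ?T V"
      unfolding V_def by (intro openin_Union) (auto simp: openin_prod_Times_iff)
    moreover have "U = (\<lambda>t. (shape t, g t)) -` V \<inter> A"
    proof
      show "U \<subseteq> (\<lambda>t. (shape t, g t)) -` V \<inter> A"
        using e(1,2) by (force simp: V_def X_def PiE_iff)
      show "(\<lambda>t. (shape t, g t)) -` V \<inter> A \<subseteq> U"
      proof
        fix u assume u: "u \<in> (\<lambda>t. (shape t, g t)) -` V \<inter> A"
        then obtain t where "t \<in> U" "shape u = shape t" "\<forall>i. g u i \<in> X t i" by (auto simp: V_def PiE_iff)
        then have "near (e t) t u" unfolding near by (auto simp: X_def split: if_splits)
        then show "u \<in> U" using e(3) \<open>t \<in> U\<close> u by auto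
      qed
    qed
    ultimately show "\<exists>V. openin ?T V \<and> U = (\<lambda>t. (shape t, g t)) -` V \<inter> A" by blast
  qed
qed

text \<open>Non-expansiveness suffices, as the maps in question only rearrange lengths or replace
  two of them by their maximum.\<close>

lemma continuous_map_trees:
  assumes "\<And>t. t \<in> A \<Longrightarrow> F t \<in> B" "\<And>e s t. e > 0 \<Longrightarrow> near e s t \<Longrightarrow> near e (F s) (F t)"
  shows "continuous_map (tree_topology A) (tree_topology B) F"
  unfolding continuous_map_def
proof (intro conjI allI impI)
  fix U assume "openin (tree_topology B) U"
  then show "openin (tree_topology A) {x \<in> topspace (tree_topology A). F x \<in> U}"
    using assms unfolding openin_tree_topology by simp (meson assms(1))
qed (use assms in auto)

lemma near_edge_length: "near e s t \<Longrightarrow> e > 0 \<Longrightarrow> \<bar>edge_length s - edge_length t\<bar> < e"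
  by (cases s; cases t) auto

lemma near_color: "near e s t \<Longrightarrow> color_of s = color_of t"
  by (cases s; cases t) auto

lemma near_merge: "near e s t \<Longrightarrow> \<bar>l - m\<bar> < e \<Longrightarrow> near e (merge l s) (merge m t)"
  by (cases s; cases t) auto

lemma near_map:
  assumes "list_all2 (near e) ts us" "\<And>t u. t \<in> set ts \<Longrightarrow> u \<in> set us \<Longrightarrow> near e t u \<Longrightarrow> near e (F t) (F u)"
  shows "list_all2 (near e) (map F ts) (map F us)"
  using assms by (auto simp: list_all2_map1 list_all2_map2 intro: list.rel_mono_strong)

lemma near_join: "list_all2 (near e) ts us \<Longrightarrow> \<bar>l - m\<bar> < e \<Longrightarrow> near e (join c l ts) (join c m us)"
  by (cases ts rule: remdups_adj.cases; cases us rule: remdups_adj.cases)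
    (auto simp: join_def near_merge)

lemma near_normalize: "near e s t \<Longrightarrow> near e (normalize s) (normalize t)"
  by (induction e s t rule: near.induct) (auto intro!: near_join near_map)

lemma near_unpaint: "near e s t \<Longrightarrow> near e (unpaint s) (unpaint t)"
  by (induction e s t rule: near.induct) (auto intro!: near_map)

lemma near_paint: "near e s t \<Longrightarrow> near e (paint s) (paint t)"
  by (induction e s t rule: near.induct) (auto intro!: near_map)

lemma near_reroot_onto:
  "near e s t \<Longrightarrow> near e x y \<Longrightarrow> e > 0 \<Longrightarrow> near e (reroot_onto s x) (reroot_onto t y)"
proof (induction s x arbitrary: t y rule: reroot_onto.induct)
  case (1 c l a u us acc)
  then obtain m v vs where t: "t = Node c m a (v # vs)" "near e u v" "list_all2 (near e) us vs"
    by (cases t) (auto simp: list_all2_Cons1)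
  show ?case using t 1
    by (auto intro!: 1(1) near_edge_length near_map near_paint list_all2_appendI)
next
  case ("2_1" c acc)
  then show ?case by (cases t) auto
next
  case ("2_2" c l a acc)
  then show ?case by (cases t) auto
qed

lemma list_all2_snoc1:
  "list_all2 P (xs @ [x]) ys \<Longrightarrow> (\<exists>zs z. ys = zs @ [z] \<and> list_all2 P xs zs \<and> P x z)"
  by (auto simp: list_all2_append1 list_all2_Cons1)

lemma near_unroot_onto:
  "near e s t \<Longrightarrow> near e x y \<Longrightarrow> e > 0 \<Longrightarrow> near e (unroot_onto s x) (unroot_onto t y)"
proof (induction "size s" arbitrary: s t x y rule: less_induct)
  case less
  show ?case
  proof (cases s)
    case (Leaf c)
    then show ?thesis using less by (cases t) auto
  next
    case (Node c l a ts)
    show ?thesis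
    proof (cases ts rule: rev_cases)
      case Nil
      then show ?thesis using less Node by (cases t) auto
    next
      case (snoc us u)
      then obtain m vs v where t: "t = Node c m a (vs @ [v])" "near e u v" "list_all2 (near e) us vs"
        using less.prems(1) Node by (cases t) (auto simp: dest!: list_all2_snoc1)
      have "near e (unroot_onto u (Node () (edge_length u) () (x # map unpaint us)))
          (unroot_onto v (Node () (edge_length v) () (y # map unpaint vs)))"
        using t less.prems Node snoc by (intro less.hyps) (auto intro!: near_edge_length near_map near_unpaint)
      then show ?thesis using Node snoc t(1) by simp
    qed
  qed
qed

lemma near_reroot: "near e s t \<Longrightarrow> e > 0 \<Longrightarrow> near e (reroot s) (reroot t)"
  unfolding reroot_def by (rule near_reroot_onto) auto

lemma near_to_K: "near e s t \<Longrightarrow> e > 0 \<Longrightarrow> near e (to_K s) (to_K t)"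
  by (auto simp: to_K_def near_color intro: near_unpaint near_unroot_onto near_normalize)

section \<open>Continuity of the comparison maps on quotients\<close>

lemma continuous_map_quotient_topology:
  "continuous_map X (quotient_topology X q) q"
  "continuous_map (quotient_topology X q) Y f \<longleftrightarrow> continuous_map X Y (f \<circ> q)"
proof -
  show q: "continuous_map X (quotient_topology X q) q"
    by (auto simp: continuous_map_def openin_quotient_topology)
  show "continuous_map (quotient_topology X q) Y f \<longleftrightarrow> continuous_map X Y (f \<circ> q)"
  proof
    assume *: "continuous_map X Y (f \<circ> q)"
    show "continuous_map (quotient_topology X q) Y f"
      unfolding continuous_map_def
    proof (intro conjI allI impI)
      show "f \<in> topspace (quotient_topology X q) \<rightarrow> topspace Y" using * by (auto simp: continuous_map_def)
      fix U assume "openin Y U"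
      then have "openin X {x \<in> topspace X. f (q x) \<in> U}" using * by (simp add: continuous_map_def)
      moreover have "{x \<in> topspace X. q x \<in> {y \<in> q ` topspace X. f y \<in> U}} = {x \<in> topspace X. f (q x) \<in> U}" by auto
      ultimately show "openin (quotient_topology X q) {x \<in> topspace (quotient_topology X q). f x \<in> U}"
        by (auto simp: openin_quotient_topology)
    qed
  qed (use q in \<open>blast intro: continuous_map_compose\<close>)
qed

abbreviation act_tree_space :: "color list \<Rightarrow> color \<Rightarrow> (color, unit) tree topology" where
  "act_tree_space w x \<equiv> tree_topology {t \<in> mtrees act_labels. leaves t = w \<and> color_of t = x}"

abbreviation K_tree_space :: "nat \<Rightarrow> (unit, unit) tree topology" where
  "K_tree_space n \<equiv> tree_topology {t \<in> mtrees K_labels. length (leaves t) = n}"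

lemma K_eq_quotient: "n \<noteq> 0 \<Longrightarrow> K n = quotient_topology (K_tree_space n) K_class"
  by (simp add: K_def K_class_def[abs_def])

lemma ops_Act_inf_eq:
  "\<not> (w = [] \<and> x = Closed) \<Longrightarrow>
   ops Act_inf w x = quotient_topology (quotient_topology (act_tree_space w x) (\<lambda>t. W_eq `` {t})) Some"
  by (auto simp: Act_inf_def W_def)

lemma continuous_map_W_class:
  assumes "\<not> (w = [] \<and> x = Closed)"
  shows "continuous_map (act_tree_space w x) (ops Act_inf w x) W_class"
  unfolding ops_Act_inf_eq[OF assms] W_class_def[abs_def]
  using continuous_map_compose[OF continuous_map_quotient_topology(1) continuous_map_quotient_topology(1)]
  by (simp add: o_def)

text \<open>Treats \<open>closed_op\<close> and \<open>open_op\<close> alike, from a non-expansive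
  map \<open>G\<close> on representatives. The conditions on \<open>n\<close> and \<open>w\<close>
  ensure that both spaces are quotients of spaces of trees.\<close>

lemma continuous_map_op:
  assumes "n \<noteq> 0" "\<And>t. t \<in> mtrees K_labels \<Longrightarrow> length (leaves t) = n \<Longrightarrow>
      F (K_class t) = W_class (G t) \<and> G t \<in> mtrees act_labels \<and> leaves (G t) = w \<and> color_of (G t) = x"
    "\<And>e s t. e > 0 \<Longrightarrow> near e s t \<Longrightarrow> near e (G s) (G t)" "w \<noteq> []"
  shows "continuous_map (K n) (ops Act_inf w x) F"
  unfolding K_eq_quotient[OF assms(1)] continuous_map_quotient_topology(2)
proof (rule continuous_map_eq)
  have "continuous_map (K_tree_space n) (act_tree_space w x) G"
    by (rule continuous_map_trees) (use assms in auto)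
  then show "continuous_map (K_tree_space n) (ops Act_inf w x) (W_class \<circ> G)"
    using continuous_map_compose continuous_map_W_class assms(4) by blast
qed (use assms in auto)

lemma continuous_map_closed_op: "continuous_map (K n) (ops Act_inf (replicate n Closed) Closed) closed_op"
proof (cases "n = 0")
  case True
  then show ?thesis by (auto simp: K_def Act_inf_def)
next
  case False
  then show ?thesis
    by (intro continuous_map_op[of _ _ paint])
      (auto simp: closed_op_class paint_mtrees map_replicate_const near_paint)
qed

lemma continuous_map_open_op:
  "continuous_map (K (Suc n)) (ops Act_inf (replicate n Closed @ [Open]) Open) open_op"
  by (intro continuous_map_op[of _ _ reroot]) (auto simp: open_op_class reroot_typed near_reroot)

lemma continuous_map_to_kpoint: "continuous_map (ops Act_inf w x) (K (length w)) to_kpoint"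
proof (cases "w = []")
  case True
  show ?thesis
  proof (cases x)
    case Closed
    then show ?thesis using True by (auto simp: K_def Act_inf_def)
  next
    case Open
    then have "topspace (ops Act_inf w x) = {}" using True Act_inf_arity[of _ w x] by fastforce
    then show ?thesis by simp
  qed
next
  case False
  have "continuous_map (act_tree_space w x) (K (length w)) (K_class \<circ> to_K)"
  proof (rule continuous_map_compose)
    show "continuous_map (act_tree_space w x) (K_tree_space (length w)) to_K"
      by (rule continuous_map_trees) (auto simp: to_K_typed near_to_K)
    show "continuous_map (K_tree_space (length w)) (K (length w)) K_class"
      using False continuous_map_quotient_topology(1) by (simp add: K_eq_quotient)
  qed
  then have "continuous_map (act_tree_space w x) (K (length w)) (to_kpoint \<circ> Some \<circ> (\<lambda>t. W_eq `` {t}))"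
    by (rule continuous_map_eq) (auto simp: to_kpoint_class simp flip: W_class_def)
  then show ?thesis
    using False by (simp add: ops_Act_inf_eq continuous_map_quotient_topology(2))
qed

section \<open>Compactly generated spaces\<close>

lemma openin_kify_mono: "openin X U \<Longrightarrow> openin (kify X) U"
  by (auto simp: openin_kify openin_subset openin_subtopology_Int2)

lemma topspace_kify [simp]: "topspace (kify X) = topspace X"
proof
  show "topspace (kify X) \<subseteq> topspace X"
    using openin_topspace[of "kify X"] unfolding openin_kify by blast
  show "topspace X \<subseteq> topspace (kify X)"
    by (rule openin_subset) (simp add: openin_kify_mono)
qed

text \<open>On compact sets nothing changes; from this it follows that \<open>kify\<close> keeps the
  compact sets and is idempotent.\<close>

lemma subtopology_kify: "compactin X C \<Longrightarrow> subtopology (kify X) C = subtopology X C"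
  unfolding topology_eq
proof (intro allI iffI)
  fix S assume C: "compactin X C" and "openin (subtopology (kify X) C) S"
  then obtain U where "openin (kify X) U" "S = U \<inter> C" by (auto simp: openin_subtopology)
  then show "openin (subtopology X C) S" using C by (simp add: openin_kify Int_commute)
next
  fix S assume "openin (subtopology X C) S"
  then show "openin (subtopology (kify X) C) S"
    by (auto simp: openin_subtopology intro: openin_kify_mono)
qed

lemma compactin_kify [simp]: "compactin (kify X) C \<longleftrightarrow> compactin X C"
proof
  assume C: "compactin (kify X) C"
  have "continuous_map (kify X) X id"
    by (auto simp: continuous_map_def Int_absorb1 openin_subset Collect_conj_eq intro: openin_kify_mono)
  then show "compactin X C" using image_compactin[OF C, of X id] by simp
next
  assume C: "compactin X C"
  then have "compact_space (subtopology X C)" by (rule compact_space_subtopology)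
  then show "compactin (kify X) C"
    using C compactin_subset_topspace[OF C] by (simp add: compactin_subspace subtopology_kify)
qed

lemma kify_kify [simp]: "kify (kify X) = kify X"
  unfolding topology_eq openin_kify[of "kify X"] openin_kify[of X] by (simp add: subtopology_kify)

lemma kify_k_space: "k_space X \<Longrightarrow> kify X = X"
  unfolding topology_eq openin_kify
proof (intro allI)
  fix S assume "k_space X"
  then show "(S \<subseteq> topspace X \<and> (\<forall>C. compactin X C \<longrightarrow> openin (subtopology X C) (C \<inter> S))) = openin X S"
    unfolding k_space_open by (meson openin_subset openin_subtopology_Int2)
qed

lemma continuous_map_from_kify: "continuous_map X Y f \<Longrightarrow> continuous_map (kify X) Y f"
  by (auto simp: continuous_map_def intro: openin_kify_mono)

lemma continuous_map_into_kifyD: "continuous_map X (kify Y) f \<Longrightarrow> continuous_map X Y f"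
  by (auto simp: continuous_map_def openin_kify_mono)

lemma continuous_map_kify_iff:
  "continuous_map (kify X) Y f \<longleftrightarrow>
     f \<in> topspace X \<rightarrow> topspace Y \<and> (\<forall>C. compactin X C \<longrightarrow> continuous_map (subtopology X C) Y f)"
proof (intro iffI conjI allI impI)
  assume *: "continuous_map (kify X) Y f"
  then show "f \<in> topspace X \<rightarrow> topspace Y" by (simp add: continuous_map_def)
  fix C assume "compactin X C"
  then show "continuous_map (subtopology X C) Y f"
    using continuous_map_from_subtopology[OF *, of C] by (simp add: subtopology_kify)
next
  assume *: "f \<in> topspace X \<rightarrow> topspace Y \<and> (\<forall>C. compactin X C \<longrightarrow> continuous_map (subtopology X C) Y f)"
  show "continuous_map (kify X) Y f"
    unfolding continuous_map_def openin_kify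
  proof (intro conjI allI impI)
    fix U C assume U: "openin Y U" and C: "compactin X C"
    have "C \<inter> {x \<in> topspace (kify X). f x \<in> U} = {x \<in> topspace (subtopology X C). f x \<in> U}" by auto
    then show "openin (subtopology X C) (C \<inter> {x \<in> topspace (kify X). f x \<in> U})"
      using * U C by (simp add: continuous_map_def)
  qed (use * in auto)
qed

text \<open>The coreflection property: continuity is tested on compact sets, their images are
  compact, and on these \<open>kify\<close> changes nothing.\<close>

lemma continuous_map_into_kify:
  assumes "kify X = X"
  shows "continuous_map X (kify Y) f \<longleftrightarrow> continuous_map X Y f"
proof
  assume *: "continuous_map X Y f"
  have "continuous_map (kify X) (kify Y) f"
    unfolding continuous_map_kify_iff
  proof (intro conjI allI impI)
    fix C assume C: "compactin X C"
    then have fC: "compactin Y (f ` C)" using * by (rule image_compactin)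
    have "continuous_map (subtopology X C) (subtopology Y (f ` C)) f"
      using * by (auto simp: continuous_map_in_subtopology continuous_map_from_subtopology)
    then show "continuous_map (subtopology X C) (kify Y) f"
      unfolding subtopology_kify[OF fC, symmetric] by (simp add: continuous_map_in_subtopology)
  qed (use * in \<open>auto simp: continuous_map_def\<close>)
  then show "continuous_map X (kify Y) f" using assms by simp
qed (rule continuous_map_into_kifyD)

lemma kify_kprod [simp]: "kify (kprod X Y) = kprod X Y"
  by (simp add: kprod_def)

lemma topspace_kprod [simp]: "topspace (kprod X Y) = topspace X \<times> topspace Y"
  by (simp add: kprod_def)

lemma continuous_map_into_kprod:
  "kify Z = Z \<Longrightarrow> continuous_map Z (kprod X Y) f \<longleftrightarrow> continuous_map Z X (fst \<circ> f) \<and> continuous_map Z Y (snd \<circ> f)"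
  by (simp add: kprod_def continuous_map_into_kify continuous_map_pairwise)

lemma continuous_map_kprod_proj:
  "continuous_map (kprod X Y) X fst" "continuous_map (kprod X Y) Y snd"
  by (simp_all add: kprod_def continuous_map_from_kify continuous_map_fst continuous_map_snd)

lemma topspace_word_prod: "topspace (word_prod X w) = {xs. list_all2 (\<lambda>x c. x \<in> topspace (X c)) xs w}"
  unfolding word_prod_def topspace_kify topspace_pullback_topology topspace_product_topology
proof (rule set_eqI)
  fix xs :: "'a list"
  have "(\<lambda>i\<in>{..<length w}. xs ! i) \<in> (\<Pi>\<^sub>E i\<in>{..<length w}. topspace (X (w ! i))) \<longleftrightarrow>
      (\<forall>i<length w. xs ! i \<in> topspace (X (w ! i)))"
    by (auto simp: PiE_iff)
  then show "xs \<in> (\<lambda>xs. \<lambda>i\<in>{..<length w}. xs ! i) -` (\<Pi>\<^sub>E i\<in>{..<length w}. topspace (X (w ! i))) \<inter>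
        {xs. length xs = length w} \<longleftrightarrow> xs \<in> {xs. list_all2 (\<lambda>x c. x \<in> topspace (X c)) xs w}"
    by (auto simp: list_all2_conv_all_nth)
qed

lemma kify_word_prod [simp]: "kify (word_prod X w) = word_prod X w"
  by (simp add: word_prod_def)

lemma continuous_map_into_pullback:
  assumes "f ` topspace Z \<subseteq> A"
  shows "continuous_map Z (pullback_topology A g X) f \<longleftrightarrow> continuous_map Z X (g \<circ> f)"
proof
  assume "continuous_map Z (pullback_topology A g X) f"
  moreover have "continuous_map (pullback_topology A g X) X g"
    using continuous_map_pullback[of X X id A g] by simp
  ultimately show "continuous_map Z X (g \<circ> f)" by (rule continuous_map_compose)
next
  assume "continuous_map Z X (g \<circ> f)"
  then show "continuous_map Z (pullback_topology A g X) f"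
    by (rule continuous_map_pullback') (use assms in auto)
qed

lemma continuous_map_into_word_prod:
  assumes "kify Z = Z" "\<And>z. z \<in> topspace Z \<Longrightarrow> length (f z) = length w"
  shows "continuous_map Z (word_prod X w) f \<longleftrightarrow> (\<forall>i<length w. continuous_map Z (X (w ! i)) (\<lambda>z. f z ! i))"
  using assms(2)
  by (auto simp: word_prod_def continuous_map_into_kify[OF assms(1)] continuous_map_into_pullback image_subset_iff
      continuous_map_componentwise)

lemma continuous_map_word_prod_nth:
  "i < length w \<Longrightarrow> continuous_map (word_prod X w) (X (w ! i)) (\<lambda>xs. xs ! i)"
  using continuous_map_into_word_prod[of "word_prod X w" "\<lambda>xs. xs" w X]
  by (auto simp: topspace_word_prod list_all2_lengthD)

section \<open>The exponential law\<close>

lemma topspace_mapping_space: "topspace (mapping_space X Y) = cmaps X Y"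
  by (auto simp: mapping_space_def)

text \<open>Openness of the preimage of a subbasic set is tested on a compact \<open>C\<close> in
  \<open>A\<close>. There its complement is the projection of a closed subset of C x K, and
  projection along a compact factor is closed.\<close>

lemma curry_continuous:
  assumes A: "kify A = A" and B: "kify B = B" and g: "continuous_map (kprod A B) Y g"
  shows "continuous_map A (mapping_space B Y) (\<lambda>a. \<lambda>b\<in>topspace B. g (a, b))"
proof -
  define F where "F = (\<lambda>a. \<lambda>b\<in>topspace B. g (a, b))"
  have F: "F a \<in> cmaps B Y" if "a \<in> topspace A" for a
  proof -
    \<comment> \<open>Slices are continuous into the compactly generated product because
      \<open>B\<close> is itself compactly generated.\<close>
    have "continuous_map B (kprod A B) (\<lambda>b. (a, b))"
      using that by (simp add: continuous_map_into_kprod[OF B] o_def)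
    from continuous_map_compose[OF this g] have "continuous_map B Y (F a)"
      by (rule continuous_map_eq) (simp add: F_def)
    then show ?thesis by (simp add: cmaps_def F_def)
  qed
  have "continuous_map A (topology_generated_by {{g \<in> cmaps B Y. g ` K \<subseteq> U} |K U. compactin B K \<and> openin Y U}) F"
  proof (rule continuous_on_generated_topo)
    fix S assume "S \<in> {{g \<in> cmaps B Y. g ` K \<subseteq> U} |K U. compactin B K \<and> openin Y U}"
    then obtain K V where S: "S = {g \<in> cmaps B Y. g ` K \<subseteq> V}" and K: "compactin B K" and V: "openin Y V"
      by blast
    have "openin (kify A) (F -` S \<inter> topspace A)"
      unfolding openin_kify
    proof (intro conjI allI impI)
      fix C assume C: "compactin A C"
      let ?Q = "prod_topology (subtopology A C) (subtopology B K)"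
      have "continuous_map (subtopology (prod_topology A B) (C \<times> K)) Y g"
        using g K C unfolding kprod_def continuous_map_kify_iff by (simp add: compactin_Times)
      then have gQ: "continuous_map ?Q Y g" by (simp add: subtopology_Times)
      \<comment> \<open>The points at which the condition defining \<open>S\<close> fails.\<close>
      define Z where "Z = {z \<in> topspace ?Q. g z \<in> topspace Y - V}"
      have "closedin ?Q Z"
        unfolding Z_def using gQ V by (intro closedin_continuous_map_preimage) auto
      moreover have "compact_space (subtopology B K)" using K by (rule compact_space_subtopology)
      ultimately have "closedin (subtopology A C) (fst ` Z)"
        using Abstract_Topological_Spaces.closed_map_fst unfolding closed_map_def by blast
      then have "openin (subtopology A C) (topspace (subtopology A C) - fst ` Z)" by blast
      moreover have "C \<inter> (F -` S \<inter> topspace A) = topspace (subtopology A C) - fst ` Z"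
      proof -
        have KB: "K \<subseteq> topspace B" and CA: "C \<subseteq> topspace A" using K C compactin_subset_topspace by auto
        have g: "g (a, b) \<in> topspace Y" if "a \<in> C" "b \<in> K" for a b
          using gQ that KB CA by (auto simp: continuous_map_def)
        show ?thesis
        proof (intro equalityI subsetI)
          fix a assume "a \<in> C \<inter> (F -` S \<inter> topspace A)"
          then show "a \<in> topspace (subtopology A C) - fst ` Z" using KB by (auto simp: S Z_def F_def)
        next
          fix a assume a: "a \<in> topspace (subtopology A C) - fst ` Z"
          then have aC: "a \<in> C" "a \<in> topspace A" by auto
          have "g (a, b) \<in> V" if "b \<in> K" for b
          proof (rule ccontr)
            assume "g (a, b) \<notin> V"
            then have "(a, b) \<in> Z" using g[OF aC(1) that] aC that KB by (auto simp: Z_def)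
            then show False using a by force
          qed
          then have "F a ` K \<subseteq> V" using KB by (auto simp: F_def)
          then show "a \<in> C \<inter> (F -` S \<inter> topspace A)" using aC F by (auto simp: S)
        qed
      qed
      ultimately show "openin (subtopology A C) (C \<inter> (F -` S \<inter> topspace A))" by simp
    qed auto
    then show "openin A (F -` S \<inter> topspace A)" using A by simp
  next
    show "F ` topspace A \<subseteq> \<Union> {{g \<in> cmaps B Y. g ` K \<subseteq> U} |K U. compactin B K \<and> openin Y U}"
      using F topspace_mapping_space[of B Y] by (auto simp: mapping_space_def)
  qed
  then show ?thesis
    unfolding mapping_space_def F_def[symmetric] by (simp add: continuous_map_into_kify[OF A])
qed

lemma openin_mapping_space: "compactin X C \<Longrightarrow> openin Y U \<Longrightarrow> openin (mapping_space X Y) {g \<in> cmaps X Y. g ` C \<subseteq> U}"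
  unfolding mapping_space_def by (intro openin_kify_mono topology_generated_by_Basis) blast

text \<open>On compact sets evaluation is continuous: a compact Hausdorff space is regular, so
  \<open>b\<close> has a compact neighbourhood \<open>V\<close> which \<open>f a\<close> maps into
  \<open>W\<close>, and the maps sending \<open>V\<close> into \<open>W\<close> form an open
  set.\<close>

lemma uncurry_continuous:
  assumes B: "Hausdorff_space B" and f: "continuous_map A (mapping_space B Y) f"
  shows "continuous_map (kprod A B) Y (\<lambda>(a, b). f a b)"
proof -
  let ?h = "\<lambda>(a, b). f a b"
  have fa: "f a \<in> cmaps B Y" if "a \<in> topspace A" for a
    using f that by (auto simp: continuous_map_def topspace_mapping_space)
  then have h: "?h z \<in> topspace Y" if "z \<in> topspace (prod_topology A B)" for z
    using that by (fastforce simp: cmaps_def continuous_map_def)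
  show ?thesis
    unfolding kprod_def continuous_map_kify_iff
  proof (intro conjI allI impI)
    fix L assume L: "compactin (prod_topology A B) L"
    \<comment> \<open>The compact set is enlarged to the product of its projections, on which
      product neighbourhoods are available.\<close>
    define C D where "C = fst ` L" and "D = snd ` L"
    have C: "compactin A C" and D: "compactin B D"
      using image_compactin[OF L continuous_map_fst] image_compactin[OF L continuous_map_snd]
      by (simp_all add: C_def D_def)
    let ?Q = "prod_topology (subtopology A C) (subtopology B D)"
    have "regular_space (subtopology B D)"
      using D B by (intro compact_Hausdorff_imp_regular_space compact_space_subtopology Hausdorff_space_subtopology)
    then have reg: "neighbourhood_base_of (closedin (subtopology B D)) (subtopology B D)"
      by (simp add: neighbourhood_base_of_closedin)
    have "continuous_map ?Q Y ?h"
      unfolding continuous_map_def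
    proof (intro conjI allI impI)
      fix W assume W: "openin Y W"
      show "openin ?Q {z \<in> topspace ?Q. ?h z \<in> W}"
        unfolding openin_prod_topology_alt
      proof (intro allI impI)
        fix a b assume "(a, b) \<in> {z \<in> topspace ?Q. ?h z \<in> W}"
        then have ab: "a \<in> topspace A" "a \<in> C" "b \<in> topspace B" "b \<in> D" "f a b \<in> W" by auto
        define N where "N = {y \<in> topspace (subtopology B D). f a y \<in> W}"
        have "continuous_map (subtopology B D) Y (f a)"
          using fa[OF ab(1)] by (auto simp: cmaps_def continuous_map_from_subtopology)
        then have "openin (subtopology B D) N" unfolding N_def using W by (rule openin_continuous_map_preimage)
        moreover have "b \<in> N" using ab by (simp add: N_def)
        ultimately obtain U V where UV: "openin (subtopology B D) U" "closedin (subtopology B D) V" "b \<in> U" "U \<subseteq> V" "V \<subseteq> N"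
          using reg unfolding neighbourhood_base_of by meson
        have "compactin (subtopology B D) V"
          using UV(2) compact_space_subtopology[OF D] closedin_compact_space by blast
        then have V: "compactin B V" by (simp add: compactin_subtopology)
        define G where "G = {g \<in> cmaps B Y. g ` V \<subseteq> W}"
        have "openin A {x \<in> topspace A. f x \<in> G}"
          unfolding G_def using f openin_mapping_space[OF V W] by (rule openin_continuous_map_preimage)
        then have "openin (subtopology A C) (C \<inter> {x \<in> topspace A. f x \<in> G})"
          by (rule openin_subtopology_Int2)
        moreover have "a \<in> C \<inter> {x \<in> topspace A. f x \<in> G}"
          using ab fa UV(5) by (auto simp: G_def N_def)
        moreover have "(C \<inter> {x \<in> topspace A. f x \<in> G}) \<times> U \<subseteq> {z \<in> topspace ?Q. ?h z \<in> W}"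
          using UV(4) openin_subset[OF UV(1)] by (auto simp: G_def image_subset_iff)
        ultimately show "\<exists>U V. openin (subtopology A C) U \<and> openin (subtopology B D) V \<and> a \<in> U \<and> b \<in> V \<and>
            U \<times> V \<subseteq> {z \<in> topspace ?Q. ?h z \<in> W}"
          using UV(1,3) by blast
      qed
    qed (use h in auto)
    then have "continuous_map (subtopology (prod_topology A B) (C \<times> D)) Y ?h" by (simp add: subtopology_Times)
    moreover have "L \<subseteq> C \<times> D" by (force simp: C_def D_def)
    ultimately show "continuous_map (subtopology (prod_topology A B) L) Y ?h"
      by (rule continuous_map_from_subtopology_mono)
  qed (use h in auto)
qed

section \<open>Algebras over \<open>Act\<^sub>\<infinity>\<close> and \<open>A\<^sub>\<infinity>\<close>-actions\<close>

lemma pair_family_simps: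
  "pair_family X P Closed = quotient_topology X Inl" "pair_family X P Open = quotient_topology P Inr"
  by (simp_all add: pair_family_def)

lemma continuous_map_projl: "continuous_map (pair_family X P Closed) X projl"
  by (simp add: pair_family_simps continuous_map_quotient_topology(2) o_def)

lemma continuous_map_projr: "continuous_map (pair_family X P Open) P projr"
  by (simp add: pair_family_simps continuous_map_quotient_topology(2) o_def)

lemma continuous_map_Inl: "continuous_map X (pair_family X P Closed) Inl"
  by (simp add: pair_family_simps continuous_map_quotient_topology(1))

lemma continuous_map_Inr: "continuous_map P (pair_family X P Open) Inr"
  by (simp add: pair_family_simps continuous_map_quotient_topology(1))

lemma in_kpower: "xs \<in> topspace (kpower X n) \<longleftrightarrow> length xs = n \<and> set xs \<subseteq> topspace X"
proof -
  have "set xs \<subseteq> topspace X \<longleftrightarrow> (\<forall>i<length xs. xs ! i \<in> topspace X)"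
    by (auto simp: set_conv_nth)
  then show ?thesis by (auto simp: topspace_word_prod list_all2_conv_all_nth)
qed

lemma word_prod_Nil [simp]: "xs \<in> topspace (word_prod F []) \<longleftrightarrow> xs = []"
  by (auto simp: topspace_word_prod)

lemma in_closed_word:
  "zs \<in> topspace (word_prod (pair_family X P) (replicate n Closed)) \<longleftrightarrow>
     (\<exists>xs\<in>topspace (kpower X n). zs = map Inl xs)"
proof
  assume "zs \<in> topspace (word_prod (pair_family X P) (replicate n Closed))"
  then have "length zs = n" "\<forall>z\<in>set zs. z \<in> Inl ` topspace X"
    by (auto simp: topspace_word_prod list_all2_conv_all_nth in_set_conv_nth pair_family_simps)
  then have "map projl zs \<in> topspace (kpower X n)" "zs = map Inl (map projl zs)"
    by (auto simp: in_kpower o_def intro!: map_idI[symmetric])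
  then show "\<exists>xs\<in>topspace (kpower X n). zs = map Inl xs" by blast
qed (auto simp: topspace_word_prod list_all2_conv_all_nth pair_family_simps)

lemma in_open_word:
  "zs \<in> topspace (word_prod (pair_family X P) (replicate n Closed @ [Open])) \<longleftrightarrow>
     (\<exists>xs\<in>topspace (kpower X n). \<exists>p\<in>topspace P. zs = map Inl xs @ [Inr p])"
proof
  assume "zs \<in> topspace (word_prod (pair_family X P) (replicate n Closed @ [Open]))"
  then obtain ys z where "zs = ys @ [z]" "ys \<in> topspace (word_prod (pair_family X P) (replicate n Closed))"
    "z \<in> topspace (pair_family X P Open)"
    by (auto simp: topspace_word_prod list_all2_append2 list_all2_Cons2)
  then show "\<exists>xs\<in>topspace (kpower X n). \<exists>p\<in>topspace P. zs = map Inl xs @ [Inr p]"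
    unfolding in_closed_word by (auto simp: pair_family_simps)
next
  assume "\<exists>xs\<in>topspace (kpower X n). \<exists>p\<in>topspace P. zs = map Inl xs @ [Inr p]"
  then obtain xs p where *: "map Inl xs \<in> topspace (word_prod (pair_family X P) (replicate n Closed))"
    "p \<in> topspace P" "zs = map Inl xs @ [Inr p]"
    unfolding in_closed_word by blast
  then show "zs \<in> topspace (word_prod (pair_family X P) (replicate n Closed @ [Open]))"
    by (auto simp: topspace_word_prod pair_family_simps intro!: list_all2_appendI)
qed

section \<open>Uniform laws for spaces and maps\<close>

definition M_comp where
  "M_comp X M \<longleftrightarrow> (\<forall>i k m T S xs ys zs. T \<in> topspace (K (i + Suc k)) \<longrightarrow> S \<in> topspace (K m) \<longrightarrow>
     xs \<in> topspace (kpower X i) \<longrightarrow> ys \<in> topspace (kpower X m) \<longrightarrow> zs \<in> topspace (kpower X k) \<longrightarrow>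
     M (i + m + k) (K_comp T i S, xs @ ys @ zs) = M (i + Suc k) (T, xs @ [M m (S, ys)] @ zs))"

text \<open>Arities are sums, with \<open>i\<close> arguments before and \<open>k\<close> after the
  composed one, which avoids truncated subtraction. Allowing every \<open>m\<close> puts erasing
  (\<open>m = 0\<close>), the identity (\<open>m = 1\<close>) and proper compositions into one
  law.\<close>

definition f_comp where
  "f_comp X M f \<longleftrightarrow> (\<forall>i k m T S xs ys zs. T \<in> topspace (K (Suc (i + Suc k))) \<longrightarrow> S \<in> topspace (K m) \<longrightarrow>
     xs \<in> topspace (kpower X i) \<longrightarrow> ys \<in> topspace (kpower X m) \<longrightarrow> zs \<in> topspace (kpower X k) \<longrightarrow>
     f (i + m + k) (K_comp T (Suc i) S, xs @ ys @ zs) = f (i + Suc k) (T, xs @ [M m (S, ys)] @ zs))"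

definition f_mult where
  "f_mult X mul f \<longleftrightarrow> (\<forall>m n S T ys zs. T \<in> topspace (K (Suc n)) \<longrightarrow> S \<in> topspace (K (Suc m)) \<longrightarrow>
     ys \<in> topspace (kpower X m) \<longrightarrow> zs \<in> topspace (kpower X n) \<longrightarrow>
     f (m + n) (K_comp T 0 S, ys @ zs) = mul (f m (S, ys)) (f n (T, zs)))"

lemma M_compD:
  "M_comp X M \<Longrightarrow> T \<in> topspace (K (i + Suc k)) \<Longrightarrow> S \<in> topspace (K m) \<Longrightarrow>
   xs \<in> topspace (kpower X i) \<Longrightarrow> ys \<in> topspace (kpower X m) \<Longrightarrow> zs \<in> topspace (kpower X k) \<Longrightarrow>
   M (i + m + k) (K_comp T i S, xs @ ys @ zs) = M (i + Suc k) (T, xs @ [M m (S, ys)] @ zs)"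
  unfolding M_comp_def by blast

lemma f_compD:
  "f_comp X M f \<Longrightarrow> T \<in> topspace (K (Suc (i + Suc k))) \<Longrightarrow> S \<in> topspace (K m) \<Longrightarrow>
   xs \<in> topspace (kpower X i) \<Longrightarrow> ys \<in> topspace (kpower X m) \<Longrightarrow> zs \<in> topspace (kpower X k) \<Longrightarrow>
   f (i + m + k) (K_comp T (Suc i) S, xs @ ys @ zs) = f (i + Suc k) (T, xs @ [M m (S, ys)] @ zs)"
  unfolding f_comp_def by blast

lemma f_multD:
  "f_mult X mul f \<Longrightarrow> T \<in> topspace (K (Suc n)) \<Longrightarrow> S \<in> topspace (K (Suc m)) \<Longrightarrow>
   ys \<in> topspace (kpower X m) \<Longrightarrow> zs \<in> topspace (kpower X n) \<Longrightarrow>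
   f (m + n) (K_comp T 0 S, ys @ zs) = mul (f m (S, ys)) (f n (T, zs))"
  unfolding f_mult_def by blast

lemma unit_list_eq: "w = replicate (length w) ()"
  by (rule replicate_eqI) auto

lemma Ainf_space_iff:
  "Ainf_space X M \<longleftrightarrow>
     (\<forall>n. continuous_map (kprod (K n) (kpower X n)) X (M n) \<and>
          M n \<in> extensional (topspace (kprod (K n) (kpower X n)))) \<and>
     (\<forall>a\<in>topspace X. M 1 (delta1, [a]) = a) \<and> M_comp X M"
proof
  assume "Ainf_space X M"
  note A = this[unfolded Ainf_space_def operad_algebra_def K_operad_def operad.simps]
  have cont: "continuous_map (kprod (K (length w)) (word_prod (\<lambda>_. X) w)) X (M (length w)) \<and>
        M (length w) \<in> extensional (topspace (kprod (K (length w)) (word_prod (\<lambda>_. X) w)))" for w :: "unit list"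
    using A by blast
  have unit: "M (length [x]) (delta1, [a]) = a" if "a \<in> topspace X" for x :: unit and a
    using A that by blast
  have comp: "M (length (u @ v @ w)) (K_comp T (length u) S, xs @ ys @ zs) =
      M (length (u @ [y] @ w)) (T, xs @ [M (length v) (S, ys)] @ zs)"
    if "T \<in> topspace (K (length (u @ [y] @ w)))" "S \<in> topspace (K (length v))"
      "xs \<in> topspace (word_prod (\<lambda>_. X) u)" "ys \<in> topspace (word_prod (\<lambda>_. X) v)"
      "zs \<in> topspace (word_prod (\<lambda>_. X) w)" for w u v :: "unit list" and y :: unit and T S xs ys zs
    using A that by blast
  have "continuous_map (kprod (K n) (kpower X n)) X (M n) \<and>
        M n \<in> extensional (topspace (kprod (K n) (kpower X n)))" for n
    using cont[of "replicate n ()"] by simp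
  moreover have "M 1 (delta1, [a]) = a" if "a \<in> topspace X" for a
    using unit[OF that, of "()"] by simp
  moreover have "M_comp X M"
    unfolding M_comp_def
  proof (intro allI impI)
    fix i k m T S xs ys zs
    assume "T \<in> topspace (K (i + Suc k))" "S \<in> topspace (K m)" "xs \<in> topspace (kpower X i)"
      "ys \<in> topspace (kpower X m)" "zs \<in> topspace (kpower X k)"
    then show "M (i + m + k) (K_comp T i S, xs @ ys @ zs) = M (i + Suc k) (T, xs @ [M m (S, ys)] @ zs)"
      using comp[of T "replicate i ()" "()" "replicate k ()" S "replicate m ()" xs ys zs] by (simp add: add.assoc)
  qed
  ultimately show "(\<forall>n. continuous_map (kprod (K n) (kpower X n)) X (M n) \<and>
        M n \<in> extensional (topspace (kprod (K n) (kpower X n)))) \<and>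
      (\<forall>a\<in>topspace X. M 1 (delta1, [a]) = a) \<and> M_comp X M" by blast
next
  assume *: "(\<forall>n. continuous_map (kprod (K n) (kpower X n)) X (M n) \<and>
        M n \<in> extensional (topspace (kprod (K n) (kpower X n)))) \<and>
      (\<forall>a\<in>topspace X. M 1 (delta1, [a]) = a) \<and> M_comp X M"
  show "Ainf_space X M"
    unfolding Ainf_space_def operad_algebra_def K_operad_def operad.simps
  proof (intro conjI allI ballI impI)
    fix w :: "unit list" and x :: unit
    obtain n where w: "w = replicate n ()" using unit_list_eq by blast
    show "continuous_map (kprod (K (length w)) (word_prod (\<lambda>_. X) w)) X (M (length w))"
      "M (length w) \<in> extensional (topspace (kprod (K (length w)) (word_prod (\<lambda>_. X) w)))"
      using * unfolding w by simp_all
  next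
    fix u v w :: "unit list" and x y :: unit and T S xs ys zs
    assume T: "T \<in> topspace (K (length (u @ [y] @ w)))" "S \<in> topspace (K (length v))"
      and xs: "xs \<in> topspace (word_prod (\<lambda>_. X) u)" "ys \<in> topspace (word_prod (\<lambda>_. X) v)"
        "zs \<in> topspace (word_prod (\<lambda>_. X) w)"
    obtain i k m where "u = replicate i ()" "w = replicate k ()" "v = replicate m ()" using unit_list_eq by metis
    then show "M (length (u @ v @ w)) (K_comp T (length u) S, xs @ ys @ zs) =
        M (length (u @ [y] @ w)) (T, xs @ [M (length v) (S, ys)] @ zs)"
      using M_compD[of X M T i k S m xs ys zs] T xs * by (simp add: add.assoc)
  qed (use * in auto)
qed

text \<open>The restrictions to arities at least 2 can be lifted: \<open>K 1\<close> consists of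
  \<open>delta1\<close> alone, which acts trivially through \<open>M 1\<close> and as the unit
  \<open>e\<close> through \<open>f 0\<close>, while arity 0 is the erasing law.\<close>

lemma unital_Ainf_map_iff:
  assumes "Ainf_space X M" and unit: "\<And>y. y \<in> topspace Y \<Longrightarrow> mul e y = y \<and> mul y e = y"
  shows "unital_Ainf_map X M Y mul e f \<longleftrightarrow>
     (\<forall>i. continuous_map (kprod (K (Suc i)) (kpower X i)) Y (f i) \<and>
          f i \<in> extensional (topspace (kprod (K (Suc i)) (kpower X i)))) \<and>
     f 0 (delta1, []) = e \<and> f_comp X M f \<and> f_mult X mul f"
proof
  have M1: "M 1 (delta1, [a]) = a" if "a \<in> topspace X" for a
    using assms(1) that by (simp add: Ainf_space_iff)
  assume U: "unital_Ainf_map X M Y mul e f"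
  then have cont: "\<forall>i. continuous_map (kprod (K (Suc i)) (kpower X i)) Y (f i) \<and>
          f i \<in> extensional (topspace (kprod (K (Suc i)) (kpower X i)))"
    and f0: "f 0 (delta1, []) = e"
    and comp: "\<And>r t j \<rho> \<tau> xs ys zs. 2 \<le> r \<Longrightarrow> 2 \<le> t \<Longrightarrow> \<rho> \<in> topspace (K r) \<Longrightarrow> \<tau> \<in> topspace (K t) \<Longrightarrow>
        1 \<le> j \<Longrightarrow> j < r \<Longrightarrow> xs \<in> topspace (kpower X (j - 1)) \<Longrightarrow>
        ys \<in> topspace (kpower X t) \<Longrightarrow> zs \<in> topspace (kpower X (r - 1 - j)) \<Longrightarrow>
        f (r + t - 2) (K_comp \<rho> j \<tau>, xs @ ys @ zs) = f (r - 1) (\<rho>, xs @ [M t (\<tau>, ys)] @ zs)"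
    and mult: "\<And>r t \<rho> \<tau> ys zs. 2 \<le> r \<Longrightarrow> 2 \<le> t \<Longrightarrow> \<rho> \<in> topspace (K r) \<Longrightarrow> \<tau> \<in> topspace (K t) \<Longrightarrow>
        ys \<in> topspace (kpower X (t - 1)) \<Longrightarrow> zs \<in> topspace (kpower X (r - 1)) \<Longrightarrow>
        f (r + t - 2) (K_comp \<rho> 0 \<tau>, ys @ zs) = mul (f (t - 1) (\<tau>, ys)) (f (r - 1) (\<rho>, zs))"
    and delta0: "\<And>n j \<rho> xs zs. 1 \<le> j \<Longrightarrow> j \<le> n \<Longrightarrow> xs \<in> topspace (kpower X (j - 1)) \<Longrightarrow>
        zs \<in> topspace (kpower X (n - j)) \<Longrightarrow> \<rho> \<in> topspace (K (Suc n)) \<Longrightarrow>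
        f (n - 1) (K_comp \<rho> j delta0, xs @ zs) = f n (\<rho>, xs @ [M 0 (delta0, [])] @ zs)"
    unfolding unital_Ainf_map_def by blast+
  have fY: "f n (T, xs) \<in> topspace Y" if "T \<in> topspace (K (Suc n))" "xs \<in> topspace (kpower X n)" for n T xs
    using cont that by (auto simp: continuous_map_def)
  have K1: "T = delta1" if "T \<in> topspace (K (Suc 0))" for T
    using that topspace_K_1 by simp
  have "f_comp X M f"
    unfolding f_comp_def
  proof (intro allI impI)
    fix i k m T S xs ys zs
    assume *: "T \<in> topspace (K (Suc (i + Suc k)))" "S \<in> topspace (K m)" "xs \<in> topspace (kpower X i)"
      "ys \<in> topspace (kpower X m)" "zs \<in> topspace (kpower X k)"
    \<comment> \<open>Erasing law, identity of the operad, and proper composition,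
      respectively.\<close>
    consider "m = 0" | "m = 1" | "2 \<le> m" by linarith
    then show "f (i + m + k) (K_comp T (Suc i) S, xs @ ys @ zs) = f (i + Suc k) (T, xs @ [M m (S, ys)] @ zs)"
    proof cases
      case 1
      then have "S = delta0" "ys = []" using * by (simp_all add: topspace_K delta0_def in_kpower)
      then show ?thesis using delta0[of "Suc i" "i + Suc k" xs zs T] * 1 by simp
    next
      case 2
      then have "S = delta1" using * K1 by simp
      moreover obtain a where "ys = [a]" "a \<in> topspace X"
        using *(4) 2 by (cases ys) (auto simp: in_kpower simp del: replicate_Suc)
      ultimately show ?thesis using K_comp_delta1(2)[OF *(1), of "Suc i"] M1 2 by simp
    next
      case 3
      then show ?thesis using comp[of "Suc (i + Suc k)" m T S "Suc i" xs ys zs] * by (simp add: ac_simps)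
    qed
  qed
  moreover have "f_mult X mul f"
    unfolding f_mult_def
  proof (intro allI impI)
    fix m n S T ys zs
    assume *: "T \<in> topspace (K (Suc n))" "S \<in> topspace (K (Suc m))"
      "ys \<in> topspace (kpower X m)" "zs \<in> topspace (kpower X n)"
    \<comment> \<open>If one of the trees is \<open>delta1\<close>, the law is a unit law of
      \<open>mul\<close>.\<close>
    consider "m = 0" | "n = 0" | "2 \<le> Suc m" "2 \<le> Suc n" by linarith
    then show "f (m + n) (K_comp T 0 S, ys @ zs) = mul (f m (S, ys)) (f n (T, zs))"
    proof cases
      case 1
      then show ?thesis
        using * K1[of S] K_comp_delta1(2)[OF *(1), of 0] unit fY[OF *(1,4)] f0 by (simp add: in_kpower)
    next
      case 2
      then show ?thesis
        using * K1[of T] K_comp_delta1(1)[OF *(2)] unit fY[OF *(2,3)] f0 by (simp add: in_kpower)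
    next
      case 3
      then show ?thesis using mult[OF 3(2,1) *(1,2), of ys zs] * by (simp add: ac_simps)
    qed
  qed
  ultimately show "(\<forall>i. continuous_map (kprod (K (Suc i)) (kpower X i)) Y (f i) \<and>
          f i \<in> extensional (topspace (kprod (K (Suc i)) (kpower X i)))) \<and>
     f 0 (delta1, []) = e \<and> f_comp X M f \<and> f_mult X mul f"
    using cont f0 by blast
next
  assume *: "(\<forall>i. continuous_map (kprod (K (Suc i)) (kpower X i)) Y (f i) \<and>
          f i \<in> extensional (topspace (kprod (K (Suc i)) (kpower X i)))) \<and>
     f 0 (delta1, []) = e \<and> f_comp X M f \<and> f_mult X mul f"
  show "unital_Ainf_map X M Y mul e f"
    unfolding unital_Ainf_map_def
  proof (intro conjI allI impI ballI)
    fix r t j :: nat and \<rho> \<tau> xs ys zs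
    assume "2 \<le> r" "2 \<le> t" and \<rho>: "\<rho> \<in> topspace (K r)" and \<tau>: "\<tau> \<in> topspace (K t)"
    {
      assume j: "1 \<le> j" "j < r" and xs: "xs \<in> topspace (kpower X (j - 1))"
        "ys \<in> topspace (kpower X t)" "zs \<in> topspace (kpower X (r - 1 - j))"
      obtain i where i: "j = Suc i" using j(1) by (cases j) auto
      obtain k where "r = Suc (j + k)" using less_imp_Suc_add[OF j(2)] by blast
      then have k: "r = Suc (i + Suc k)" using i by simp
      show "f (r + t - 2) (K_comp \<rho> j \<tau>, xs @ ys @ zs) = f (r - 1) (\<rho>, xs @ [M t (\<tau>, ys)] @ zs)" (is ?goal)
      proof -
        have e: "r + t - 2 = i + t + k" "r - 1 = i + Suc k" using i k by simp_all
        have "xs \<in> topspace (kpower X i)" "zs \<in> topspace (kpower X k)" using xs i k by simp_all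
        then show ?goal
          using f_compD[of X M f \<rho> i k \<tau> t xs ys zs] * \<rho>[unfolded k] \<tau> xs(2) unfolding e unfolding i by blast
      qed
    }
    {
      assume xs: "ys \<in> topspace (kpower X (t - 1))" "zs \<in> topspace (kpower X (r - 1))"
      obtain m where m: "t = Suc m" using \<open>2 \<le> t\<close> by (cases t) auto
      obtain n where n: "r = Suc n" using \<open>2 \<le> r\<close> by (cases r) auto
      show "f (r + t - 2) (K_comp \<rho> 0 \<tau>, ys @ zs) = mul (f (t - 1) (\<tau>, ys)) (f (r - 1) (\<rho>, zs))" (is ?goal)
      proof -
        have e: "r + t - 2 = m + n" "t - 1 = m" "r - 1 = n" using m n by simp_all
        show ?goal
          using f_multD[of X mul f \<rho> n \<tau> m ys zs] * \<rho>[unfolded n] \<tau>[unfolded m] xs[unfolded e] unfolding e by blast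
      qed
    }
  next
    fix n j :: nat and xs zs \<rho>
    assume j: "1 \<le> j" "j \<le> n" and xs: "xs \<in> topspace (kpower X (j - 1))" "zs \<in> topspace (kpower X (n - j))"
      "\<rho> \<in> topspace (K (Suc n))"
    obtain i where i: "j = Suc i" using j(1) by (cases j) auto
    obtain k where k: "n = i + Suc k" using j(2) i less_imp_Suc_add by fastforce
    have "delta0 \<in> topspace (K 0)" by (simp add: delta0_def topspace_K)
    then have "f (i + 0 + k) (K_comp \<rho> (Suc i) delta0, xs @ [] @ zs) = f (i + Suc k) (\<rho>, xs @ [M 0 (delta0, [])] @ zs)"
      using f_compD[of X M f \<rho> i k delta0 0 xs "[]" zs] * xs unfolding i k by simp
    then show "f (n - 1) (K_comp \<rho> j delta0, xs @ zs) = f n (\<rho>, xs @ [M 0 (delta0, [])] @ zs)"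
      unfolding i k by simp
  qed (use * in auto)
qed

section \<open>Composition laws of algebras and of actions\<close>

definition act_comp where
  "act_comp X P act \<longleftrightarrow> (\<forall>u v w x y T S.
     T \<in> topspace (ops Act_inf (u @ [y] @ w) x) \<longrightarrow> S \<in> topspace (ops Act_inf v y) \<longrightarrow>
     (\<forall>xs\<in>topspace (word_prod (pair_family X P) u). \<forall>ys\<in>topspace (word_prod (pair_family X P) v).
      \<forall>zs\<in>topspace (word_prod (pair_family X P) w).
        act (u @ v @ w) x (pcomp Act_inf T (length u) S, xs @ ys @ zs) =
        act (u @ [y] @ w) x (T, xs @ [act v y (S, ys)] @ zs)))"

text \<open>The structure maps of an algebra over \<open>Act\<^sub>\<infinity>\<close> and the maps of an action determine
  each other by the first two assumptions.\<close>

locale action_data =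
  fixes X :: "'x topology" and P :: "'p topology"
    and act :: "color list \<Rightarrow> color \<Rightarrow> (color, unit) tree set option \<times> ('x + 'p) list \<Rightarrow> 'x + 'p"
    and M :: "nat \<Rightarrow> kpoint \<times> 'x list \<Rightarrow> 'x" and f :: "nat \<Rightarrow> kpoint \<times> 'x list \<Rightarrow> 'p \<Rightarrow> 'p"
  assumes act_closed: "\<And>n T xs. T \<in> topspace (K n) \<Longrightarrow> xs \<in> topspace (kpower X n) \<Longrightarrow>
      act (replicate n Closed) Closed (closed_op T, map Inl xs) = Inl (M n (T, xs))"
    and act_open: "\<And>n T xs p. T \<in> topspace (K (Suc n)) \<Longrightarrow> xs \<in> topspace (kpower X n) \<Longrightarrow> p \<in> topspace P \<Longrightarrow>
      act (replicate n Closed @ [Open]) Open (open_op T, map Inl xs @ [Inr p]) = Inr (f n (T, xs) p)"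
    and M_in: "\<And>n T xs. T \<in> topspace (K n) \<Longrightarrow> xs \<in> topspace (kpower X n) \<Longrightarrow> M n (T, xs) \<in> topspace X"
    and f_in: "\<And>n T xs. T \<in> topspace (K (Suc n)) \<Longrightarrow> xs \<in> topspace (kpower X n) \<Longrightarrow>
      f n (T, xs) \<in> topspace P \<rightarrow>\<^sub>E topspace P"
begin

text \<open>Stated as an equivalence, like the two lemmas that follow, so that one computation
  serves both directions of the comparison. It rests on the compatibility of
  \<open>closed_op\<close> with composition and on injectivity of \<open>Inl\<close>.\<close>

lemma act_comp_closed_iff:
  assumes "T \<in> topspace (K (i + Suc k))" "S \<in> topspace (K m)"
    "xs \<in> topspace (kpower X i)" "ys \<in> topspace (kpower X m)" "zs \<in> topspace (kpower X k)"
  shows "act (replicate i Closed @ replicate m Closed @ replicate k Closed) Closed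
        (pcomp Act_inf (closed_op T) i (closed_op S), map Inl xs @ map Inl ys @ map Inl zs) =
      act (replicate i Closed @ [Closed] @ replicate k Closed) Closed
        (closed_op T, map Inl xs @ [act (replicate m Closed) Closed (closed_op S, map Inl ys)] @ map Inl zs) \<longleftrightarrow>
    M (i + m + k) (K_comp T i S, xs @ ys @ zs) = M (i + Suc k) (T, xs @ [M m (S, ys)] @ zs)"
proof -
  have w: "replicate i Closed @ replicate m Closed @ replicate k Closed = replicate (i + m + k) Closed"
    "replicate i Closed @ [Closed] @ replicate k Closed = replicate (i + Suc k) Closed"
    by (simp_all add: replicate_add replicate_append_same)
  have "K_comp T i S \<in> topspace (K (i + m + k))"
    using K_comp_in_K[OF assms(1,2), of i] by (simp add: ac_simps)
  moreover have "xs @ ys @ zs \<in> topspace (kpower X (i + m + k))" "xs @ [M m (S, ys)] @ zs \<in> topspace (kpower X (i + Suc k))"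
    using assms(3-5) M_in[OF assms(2,4)] unfolding in_kpower by auto
  ultimately show ?thesis
    using act_closed[of "K_comp T i S" "i + m + k" "xs @ ys @ zs"] act_closed[OF assms(1), of "xs @ [M m (S, ys)] @ zs"]
      act_closed[OF assms(2,4)] closed_op_comp[OF assms(1,2), of i] assms(1)
    unfolding w by simp
qed

lemma act_comp_open_closed_iff:
  assumes "T \<in> topspace (K (Suc (i + Suc k)))" "S \<in> topspace (K m)"
    "xs \<in> topspace (kpower X i)" "ys \<in> topspace (kpower X m)" "zs \<in> topspace (kpower X k)" "p \<in> topspace P"
  shows "act (replicate i Closed @ replicate m Closed @ replicate k Closed @ [Open]) Open
        (pcomp Act_inf (open_op T) i (closed_op S), map Inl xs @ map Inl ys @ map Inl zs @ [Inr p]) =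
      act (replicate i Closed @ [Closed] @ replicate k Closed @ [Open]) Open
        (open_op T, map Inl xs @ [act (replicate m Closed) Closed (closed_op S, map Inl ys)] @ map Inl zs @ [Inr p]) \<longleftrightarrow>
    f (i + m + k) (K_comp T (Suc i) S, xs @ ys @ zs) p = f (i + Suc k) (T, xs @ [M m (S, ys)] @ zs) p"
proof -
  have w: "replicate i Closed @ replicate m Closed @ replicate k Closed @ [Open] = replicate (i + m + k) Closed @ [Open]"
    "replicate i Closed @ [Closed] @ replicate k Closed @ [Open] = replicate (i + Suc k) Closed @ [Open]"
    by (simp_all add: replicate_add replicate_append_same)
  have "K_comp T (Suc i) S \<in> topspace (K (Suc (i + m + k)))"
    using K_comp_in_K[OF assms(1,2), of "Suc i"] by (simp add: ac_simps)
  moreover have "xs @ ys @ zs \<in> topspace (kpower X (i + m + k))" "xs @ [M m (S, ys)] @ zs \<in> topspace (kpower X (i + Suc k))"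
    using assms(3-5) M_in[OF assms(2,4)] unfolding in_kpower by auto
  ultimately show ?thesis
    using act_open[of "K_comp T (Suc i) S" "i + m + k" "xs @ ys @ zs" p]
      act_open[OF assms(1), of "xs @ [M m (S, ys)] @ zs" p]
      act_closed[OF assms(2,4)] open_op_comp_closed[OF assms(1,2), of i] assms(1,6)
    unfolding w by simp
qed

lemma act_comp_open_open_iff:
  assumes "T \<in> topspace (K (Suc n))" "S \<in> topspace (K (Suc m))"
    "ys \<in> topspace (kpower X m)" "zs \<in> topspace (kpower X n)" "p \<in> topspace P"
  shows "act (replicate m Closed @ (replicate n Closed @ [Open]) @ []) Open
        (pcomp Act_inf (open_op S) m (open_op T), map Inl ys @ (map Inl zs @ [Inr p]) @ []) =
      act (replicate m Closed @ [Open] @ []) Open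
        (open_op S, map Inl ys @ [act (replicate n Closed @ [Open]) Open (open_op T, map Inl zs @ [Inr p])] @ []) \<longleftrightarrow>
    f (m + n) (K_comp T 0 S, ys @ zs) p = f m (S, ys) (f n (T, zs) p)"
proof -
  have w: "replicate m Closed @ (replicate n Closed @ [Open]) @ [] = replicate (m + n) Closed @ [Open]"
    by (simp add: replicate_add)
  have "K_comp T 0 S \<in> topspace (K (Suc (m + n)))"
    using K_comp_in_K[OF assms(1,2), of 0] by (simp add: ac_simps)
  moreover have "ys @ zs \<in> topspace (kpower X (m + n))" using assms by (auto simp: in_kpower)
  moreover have "f n (T, zs) p \<in> topspace P" using f_in[OF assms(1,4)] assms(5) by auto
  ultimately show ?thesis
    using act_open[of "K_comp T 0 S" "m + n" "ys @ zs" p] act_open[OF assms(2,3), of "f n (T, zs) p"]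
      act_open[OF assms(1,4,5)] open_op_comp_open[OF assms(1,2)] assms(5)
    unfolding w by simp
qed

lemma act_compD:
  assumes "act_comp X P act" "T \<in> topspace (ops Act_inf (u @ [y] @ w) x)" "S \<in> topspace (ops Act_inf v y)"
    "xs \<in> topspace (word_prod (pair_family X P) u)" "ys \<in> topspace (word_prod (pair_family X P) v)"
    "zs \<in> topspace (word_prod (pair_family X P) w)"
  shows "act (u @ v @ w) x (pcomp Act_inf T (length u) S, xs @ ys @ zs) =
        act (u @ [y] @ w) x (T, xs @ [act v y (S, ys)] @ zs)"
  using assms unfolding act_comp_def by blast

text \<open>There are three kinds of composition: closed into closed, closed into open, and open
  into open. They correspond in this order to the three laws on the right.\<close>

lemma act_comp_iff: "act_comp X P act \<longleftrightarrow> M_comp X M \<and> f_comp X M f \<and> f_mult X (compose (topspace P)) f"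
proof (intro iffI conjI)
  assume A: "act_comp X P act"
  have w: "replicate i Closed @ [Closed] @ replicate k Closed = replicate (i + Suc k) Closed"
    "replicate i Closed @ [Closed] @ replicate k Closed @ [Open] = replicate (i + Suc k) Closed @ [Open]" for i k
    by (simp_all add: replicate_add replicate_append_same)
  show "M_comp X M"
    unfolding M_comp_def
  proof (intro allI impI)
    fix i k m T S xs ys zs
    assume *: "T \<in> topspace (K (i + Suc k))" "S \<in> topspace (K m)" "xs \<in> topspace (kpower X i)"
      "ys \<in> topspace (kpower X m)" "zs \<in> topspace (kpower X k)"
    show "M (i + m + k) (K_comp T i S, xs @ ys @ zs) = M (i + Suc k) (T, xs @ [M m (S, ys)] @ zs)"
      unfolding act_comp_closed_iff[OF *, symmetric]
      using act_compD[OF A, of "closed_op T" "replicate i Closed" Closed "replicate k Closed" Closed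
          "closed_op S" "replicate m Closed" "map Inl xs" "map Inl ys" "map Inl zs"]
        closed_op_in[OF *(1)] closed_op_in[OF *(2)] *(3-5)
      by (simp only: w length_replicate) (auto simp: in_closed_word)
  qed
  show "f_comp X M f"
    unfolding f_comp_def
  proof (intro allI impI)
    fix i k m T S xs ys zs
    assume *: "T \<in> topspace (K (Suc (i + Suc k)))" "S \<in> topspace (K m)" "xs \<in> topspace (kpower X i)"
      "ys \<in> topspace (kpower X m)" "zs \<in> topspace (kpower X k)"
    have "K_comp T (Suc i) S \<in> topspace (K (Suc (i + m + k)))"
      using K_comp_in_K[OF *(1,2), of "Suc i"] by (simp add: ac_simps)
    moreover have "xs @ ys @ zs \<in> topspace (kpower X (i + m + k))" "xs @ [M m (S, ys)] @ zs \<in> topspace (kpower X (i + Suc k))"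
      using *(3-5) M_in[OF *(2,4)] unfolding in_kpower by auto
    ultimately have "f (i + m + k) (K_comp T (Suc i) S, xs @ ys @ zs) \<in> topspace P \<rightarrow>\<^sub>E topspace P"
      "f (i + Suc k) (T, xs @ [M m (S, ys)] @ zs) \<in> topspace P \<rightarrow>\<^sub>E topspace P"
      using f_in *(1) by blast+
    \<comment> \<open>The algebra determines the two self-maps only at points of \<open>P\<close>;
      both are extensional, so they are equal.\<close>
    then show "f (i + m + k) (K_comp T (Suc i) S, xs @ ys @ zs) = f (i + Suc k) (T, xs @ [M m (S, ys)] @ zs)"
    proof (rule PiE_ext)
      fix p assume p: "p \<in> topspace P"
      show "f (i + m + k) (K_comp T (Suc i) S, xs @ ys @ zs) p = f (i + Suc k) (T, xs @ [M m (S, ys)] @ zs) p"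
        unfolding act_comp_open_closed_iff[OF * p, symmetric]
        using act_compD[OF A, of "open_op T" "replicate i Closed" Closed "replicate k Closed @ [Open]" Open
            "closed_op S" "replicate m Closed" "map Inl xs" "map Inl ys" "map Inl zs @ [Inr p]"]
          open_op_in[OF *(1)] closed_op_in[OF *(2)] *(3-5) p
        by (simp only: w length_replicate) (auto simp: in_closed_word in_open_word)
    qed
  qed
  show "f_mult X (compose (topspace P)) f"
    unfolding f_mult_def
  proof (intro allI impI)
    fix m n S T ys zs
    assume *: "T \<in> topspace (K (Suc n))" "S \<in> topspace (K (Suc m))"
      "ys \<in> topspace (kpower X m)" "zs \<in> topspace (kpower X n)"
    have "K_comp T 0 S \<in> topspace (K (Suc (m + n)))"
      using K_comp_in_K[OF *(1,2), of 0] by (simp add: ac_simps)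
    moreover have "ys @ zs \<in> topspace (kpower X (m + n))" using *(3,4) unfolding in_kpower by auto
    ultimately have "f (m + n) (K_comp T 0 S, ys @ zs) \<in> topspace P \<rightarrow>\<^sub>E topspace P" by (rule f_in)
    moreover have "compose (topspace P) (f m (S, ys)) (f n (T, zs)) \<in> topspace P \<rightarrow>\<^sub>E topspace P"
      using f_in[OF *(1,4)] f_in[OF *(2,3)] by (auto simp: compose_def)
    ultimately show "f (m + n) (K_comp T 0 S, ys @ zs) = compose (topspace P) (f m (S, ys)) (f n (T, zs))"
    proof (rule PiE_ext)
      fix p assume p: "p \<in> topspace P"
      have "[] \<in> topspace (word_prod (pair_family X P) [])" by (simp add: topspace_word_prod)
      then have "f (m + n) (K_comp T 0 S, ys @ zs) p = f m (S, ys) (f n (T, zs) p)"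
        unfolding act_comp_open_open_iff[OF * p, symmetric]
        using act_compD[OF A, of "open_op S" "replicate m Closed" Open "[]" Open
            "open_op T" "replicate n Closed @ [Open]" "map Inl ys" "map Inl zs @ [Inr p]" "[]"]
          open_op_in[OF *(1)] open_op_in[OF *(2)] *(3,4) p
        by (simp only: length_replicate append_Nil2) (auto simp: in_closed_word in_open_word)
      then show "f (m + n) (K_comp T 0 S, ys @ zs) p = compose (topspace P) (f m (S, ys)) (f n (T, zs)) p"
        using p by (simp add: compose_def)
    qed
  qed
next
  assume *: "M_comp X M \<and> f_comp X M f \<and> f_mult X (compose (topspace P)) f"
  show "act_comp X P act"
    unfolding act_comp_def
  proof (intro allI impI ballI)
    fix u v w x y T S xs ys zs
    assume T: "T \<in> topspace (ops Act_inf (u @ [y] @ w) x)" and S: "S \<in> topspace (ops Act_inf v y)"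
      and xs: "xs \<in> topspace (word_prod (pair_family X P) u)" and ys: "ys \<in> topspace (word_prod (pair_family X P) v)"
      and zs: "zs \<in> topspace (word_prod (pair_family X P) w)"
    define T' S' where "T' = to_kpoint T" and "S' = to_kpoint S"
    have T': "T' \<in> topspace (K (length (u @ [y] @ w)))" and S': "S' \<in> topspace (K (length v))"
      using to_kpoint_in(1)[OF T] to_kpoint_in(1)[OF S] by (simp_all add: T'_def S'_def)
    have closedS: "v = replicate (length v) Closed \<and> S = closed_op S'" if "y = Closed"
      using Act_inf_arity[OF S] to_kpoint_in(2)[OF S] that by (simp add: S'_def)
    have replicate: "q = replicate (length q) Closed" if "set q \<subseteq> {Closed}" for q
      using that by (intro replicate_eqI) auto
    show "act (u @ v @ w) x (pcomp Act_inf T (length u) S, xs @ ys @ zs) =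
        act (u @ [y] @ w) x (T, xs @ [act v y (S, ys)] @ zs)"
    proof (cases x)
      case Closed
      then have eq: "u @ [y] @ w = replicate (length (u @ [y] @ w)) Closed" and T_eq: "T = closed_op T'"
        using Act_inf_arity[OF T] to_kpoint_in(2)[OF T] by (simp_all add: T'_def)
      have "set (u @ [y] @ w) \<subseteq> {Closed}" using eq set_replicate_conv_if by (metis empty_subsetI subset_refl)
      then have y: "y = Closed" and u: "u = replicate (length u) Closed" and w: "w = replicate (length w) Closed"
        by (auto intro: replicate)
      obtain i k m where uwv: "u = replicate i Closed" "w = replicate k Closed" "v = replicate m Closed"
        using u w closedS[OF y] by blast
      obtain xs' ys' zs' where xyz: "xs = map Inl xs'" "ys = map Inl ys'" "zs = map Inl zs'" 
        and k: "xs' \<in> topspace (kpower X i)" "ys' \<in> topspace (kpower X m)" "zs' \<in> topspace (kpower X k)"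
        using xs ys zs unfolding uwv in_closed_word by blast
      have K: "T' \<in> topspace (K (i + Suc k))" "S' \<in> topspace (K m)"
        using T' S' by (simp_all add: uwv)
      have "M (i + m + k) (K_comp T' i S', xs' @ ys' @ zs') = M (i + Suc k) (T', xs' @ [M m (S', ys')] @ zs')"
        using * K k unfolding M_comp_def by blast
      then show ?thesis
        unfolding act_comp_closed_iff[OF K k, symmetric] Closed y T_eq closedS[OF y, THEN conjunct2] xyz
        unfolding uwv by simp
    next
      case Open
      then obtain n where eq: "u @ [y] @ w = replicate n Closed @ [Open]" and T_eq: "T = open_op T'"
        using Act_inf_arity[OF T] to_kpoint_in(3)[OF T] by (auto simp: T'_def)
      show ?thesis
      \<comment> \<open>If \<open>w\<close> is empty, the composition uses the open last input;
        otherwise it uses a closed input of an open operation.\<close>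
      proof (cases w rule: rev_cases)
        case Nil
        then have y: "y = Open" and u: "u = replicate n Closed" using eq by auto
        obtain m where v: "v = replicate m Closed @ [Open]" and S_eq: "S = open_op S'"
          using Act_inf_arity[OF S] to_kpoint_in(3)[OF S] y by (auto simp: S'_def)
        obtain xs' ys' p where xyz: "xs = map Inl xs'" "ys = map Inl ys' @ [Inr p]" "zs = []"
          and k: "xs' \<in> topspace (kpower X n)" "ys' \<in> topspace (kpower X m)" "p \<in> topspace P"
          using xs ys zs unfolding u v Nil in_closed_word in_open_word by (auto simp: topspace_word_prod)
        have K: "T' \<in> topspace (K (Suc n))" "S' \<in> topspace (K (Suc m))"
          using T' S' by (simp_all add: u v Nil)
        have "f (n + m) (K_comp S' 0 T', xs' @ ys') p = f n (T', xs') (f m (S', ys') p)"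
          using * K k unfolding f_mult_def by (simp add: compose_def)
        then show ?thesis
          unfolding act_comp_open_open_iff[OF K(2,1) k(1,2,3), symmetric] Open y T_eq S_eq xyz
          unfolding u v Nil by simp
      next
        case (snoc w' z)
        then have z: "z = Open" and eq': "u @ [y] @ w' = replicate n Closed" using eq by auto
        have "set (u @ [y] @ w') \<subseteq> {Closed}" unfolding eq' by auto
        then have y: "y = Closed" and u: "u = replicate (length u) Closed" and w: "w' = replicate (length w') Closed"
          by (auto intro: replicate)
        obtain i k m where uwv: "u = replicate i Closed" "w = replicate k Closed @ [Open]" "v = replicate m Closed"
          using u w closedS[OF y] snoc z by blast
        obtain xs' ys' zs' p where xyz: "xs = map Inl xs'" "ys = map Inl ys'" "zs = map Inl zs' @ [Inr p]"
          and k: "xs' \<in> topspace (kpower X i)" "ys' \<in> topspace (kpower X m)" "zs' \<in> topspace (kpower X k)" "p \<in> topspace P"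
          using xs ys zs unfolding uwv in_closed_word in_open_word by blast
        have K: "T' \<in> topspace (K (Suc (i + Suc k)))" "S' \<in> topspace (K m)"
          using T' S' by (simp_all add: uwv)
        have "f (i + m + k) (K_comp T' (Suc i) S', xs' @ ys' @ zs') p = f (i + Suc k) (T', xs' @ [M m (S', ys')] @ zs') p"
          using * K k unfolding f_comp_def by metis
        then show ?thesis
          unfolding act_comp_open_closed_iff[OF K k, symmetric] Open y T_eq closedS[OF y, THEN conjunct2] xyz
          unfolding uwv by simp
      qed
    qed
  qed
qed

end

section \<open>Continuity of the passage between the two kinds of arguments\<close>

lemma continuous_map_closed_point:
  "continuous_map (kprod (K n) (kpower X n))
     (kprod (ops Act_inf (replicate n Closed) Closed) (word_prod (pair_family X P) (replicate n Closed)))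
     (\<lambda>(T, xs). (closed_op T, map Inl xs))"
proof -
  let ?Z = "kprod (K n) (kpower X n)"
  have "continuous_map ?Z (ops Act_inf (replicate n Closed) Closed) (closed_op \<circ> fst)"
    by (rule continuous_map_compose[OF continuous_map_kprod_proj(1) continuous_map_closed_op])
  moreover have "continuous_map ?Z (pair_family X P Closed) (\<lambda>z. map Inl (snd z) ! i)" if "i < n" for i
  proof -
    have "continuous_map ?Z X ((\<lambda>xs. xs ! i) \<circ> snd)"
      using continuous_map_word_prod_nth[of i "replicate n ()" "\<lambda>_. X"] that
      by (intro continuous_map_compose[OF continuous_map_kprod_proj(2)]) simp
    from continuous_map_compose[OF this continuous_map_Inl[of X P]] show ?thesis
      by (rule continuous_map_eq) (use that in \<open>auto simp: in_kpower\<close>)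
  qed
  then have "continuous_map ?Z (word_prod (pair_family X P) (replicate n Closed)) (map Inl \<circ> snd)"
    by (subst continuous_map_into_word_prod) (auto simp: in_kpower)
  ultimately show ?thesis
    by (simp add: continuous_map_into_kprod o_def case_prod_beta)
qed

lemma continuous_map_open_point:
  "continuous_map (kprod (kprod (K (Suc n)) (kpower X n)) P)
     (kprod (ops Act_inf (replicate n Closed @ [Open]) Open) (word_prod (pair_family X P) (replicate n Closed @ [Open])))
     (\<lambda>((T, xs), p). (open_op T, map Inl xs @ [Inr p]))"
proof -
  let ?Z = "kprod (kprod (K (Suc n)) (kpower X n)) P"
  have "continuous_map ?Z (ops Act_inf (replicate n Closed @ [Open]) Open) (open_op \<circ> (fst \<circ> fst))"
    by (intro continuous_map_compose[OF continuous_map_compose[OF continuous_map_kprod_proj(1) continuous_map_kprod_proj(1)]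
          continuous_map_open_op])
  moreover have "continuous_map ?Z (pair_family X P ((replicate n Closed @ [Open]) ! i))
      (\<lambda>z. (map Inl (snd (fst z)) @ [Inr (snd z)]) ! i)" if "i < Suc n" for i
  proof (cases "i < n")
    case True
    have "continuous_map ?Z X ((\<lambda>xs. xs ! i) \<circ> (snd \<circ> fst))"
      using continuous_map_word_prod_nth[of i "replicate n ()" "\<lambda>_. X"] True
      by (intro continuous_map_compose[OF continuous_map_compose[OF continuous_map_kprod_proj(1) continuous_map_kprod_proj(2)]])
        simp
    from continuous_map_compose[OF this continuous_map_Inl[of X P]] show ?thesis
      using True by (simp add: nth_append) (erule continuous_map_eq, auto simp: in_kpower nth_append)
  next
    case False
    then have i: "i = n" using that by simp
    have "continuous_map ?Z (pair_family X P Open) (Inr \<circ> snd)"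
      by (rule continuous_map_compose[OF continuous_map_kprod_proj(2) continuous_map_Inr])
    then show ?thesis
      using i by (simp add: nth_append) (erule continuous_map_eq, auto simp: in_kpower nth_append)
  qed
  then have "continuous_map ?Z (word_prod (pair_family X P) (replicate n Closed @ [Open])) (\<lambda>z. map Inl (snd (fst z)) @ [Inr (snd z)])"
    by (subst continuous_map_into_word_prod) (auto simp: in_kpower)
  ultimately show ?thesis
    by (simp add: continuous_map_into_kprod o_def case_prod_beta)
qed

lemma continuous_map_closed_point_inv:
  "continuous_map (kprod (ops Act_inf (replicate n Closed) Closed) (word_prod (pair_family X P) (replicate n Closed)))
     (kprod (K n) (kpower X n)) (\<lambda>(A, xs). (to_kpoint A, map projl xs))"
proof -
  let ?Z = "kprod (ops Act_inf (replicate n Closed) Closed) (word_prod (pair_family X P) (replicate n Closed))"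
  have "continuous_map ?Z (K n) (to_kpoint \<circ> fst)"
    using continuous_map_compose[OF continuous_map_kprod_proj(1) continuous_map_to_kpoint[of "replicate n Closed" Closed]]
    by simp
  moreover have "continuous_map ?Z X (\<lambda>z. map projl (snd z) ! i)" if "i < n" for i
  proof -
    have "continuous_map ?Z (pair_family X P Closed) ((\<lambda>xs. xs ! i) \<circ> snd)"
      using continuous_map_word_prod_nth[of i "replicate n Closed" "pair_family X P"] that
      by (intro continuous_map_compose[OF continuous_map_kprod_proj(2)]) simp
    from continuous_map_compose[OF this continuous_map_projl] show ?thesis
      by (rule continuous_map_eq) (use that in \<open>auto simp: in_closed_word in_kpower\<close>)
  qed
  then have "continuous_map ?Z (kpower X n) (map projl \<circ> snd)"
    by (subst continuous_map_into_word_prod) (auto simp: in_closed_word in_kpower)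
  ultimately show ?thesis
    by (simp add: continuous_map_into_kprod o_def case_prod_beta)
qed

lemma continuous_map_open_point_inv:
  "continuous_map
     (kprod (ops Act_inf (replicate n Closed @ [Open]) Open) (word_prod (pair_family X P) (replicate n Closed @ [Open])))
     (kprod (kprod (K (Suc n)) (kpower X n)) P)
     (\<lambda>(A, xs). ((to_kpoint A, map projl (butlast xs)), projr (last xs)))"
proof -
  let ?Z = "kprod (ops Act_inf (replicate n Closed @ [Open]) Open) (word_prod (pair_family X P) (replicate n Closed @ [Open]))"
  have nth: "continuous_map ?Z (pair_family X P ((replicate n Closed @ [Open]) ! i)) ((\<lambda>xs. xs ! i) \<circ> snd)" if "i < Suc n" for i
    using continuous_map_word_prod_nth[of i "replicate n Closed @ [Open]" "pair_family X P"] that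
    by (intro continuous_map_compose[OF continuous_map_kprod_proj(2)]) simp
  have "continuous_map ?Z (K (Suc n)) (to_kpoint \<circ> fst)"
    using continuous_map_compose[OF continuous_map_kprod_proj(1) continuous_map_to_kpoint[of "replicate n Closed @ [Open]" Open]]
    by simp
  moreover have "continuous_map ?Z X (\<lambda>z. map projl (butlast (snd z)) ! i)" if "i < n" for i
  proof -
    have "continuous_map ?Z (pair_family X P Closed) ((\<lambda>xs. xs ! i) \<circ> snd)"
      using nth[of i] that by (simp add: nth_append)
    from continuous_map_compose[OF this continuous_map_projl] show ?thesis
      by (rule continuous_map_eq) (use that in \<open>auto simp: in_open_word in_kpower nth_append\<close>)
  qed
  then have "continuous_map ?Z (kpower X n) (\<lambda>z. map projl (butlast (snd z)))"
    by (subst continuous_map_into_word_prod) (auto simp: in_open_word in_kpower)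
  moreover have "continuous_map ?Z P (\<lambda>z. projr (last (snd z)))"
  proof -
    have "continuous_map ?Z (pair_family X P Open) ((\<lambda>xs. xs ! n) \<circ> snd)"
      using nth[of n] by (simp add: nth_append)
    from continuous_map_compose[OF this continuous_map_projr] show ?thesis
      by (rule continuous_map_eq) (auto simp: in_open_word in_kpower nth_append)
  qed
  ultimately show ?thesis
    by (simp add: continuous_map_into_kprod o_def case_prod_beta)
qed

section \<open>Algebras and actions determine each other\<close>

lemma algebra_iff:
  "operad_algebra Act_inf (pair_family X P) act \<longleftrightarrow>
     (\<forall>w x. continuous_map (kprod (ops Act_inf w x) (word_prod (pair_family X P) w)) (pair_family X P x) (act w x) \<and>
            act w x \<in> extensional (topspace (kprod (ops Act_inf w x) (word_prod (pair_family X P) w)))) \<and>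
     (\<forall>x. \<forall>a\<in>topspace (pair_family X P x). act [x] x (idop Act_inf x, [a]) = a) \<and>
     act_comp X P act"
  unfolding operad_algebra_def act_comp_def ..

lemma left_Ainf_action_iff:
  assumes "Ainf_space X M"
  shows "left_Ainf_action X M P f \<longleftrightarrow>
     (\<forall>i. continuous_map (kprod (K (Suc i)) (kpower X i)) (mapping_space P P) (f i) \<and>
          f i \<in> extensional (topspace (kprod (K (Suc i)) (kpower X i)))) \<and>
     f 0 (delta1, []) = (\<lambda>p\<in>topspace P. p) \<and> f_comp X M f \<and> f_mult X (compose (topspace P)) f"
  unfolding left_Ainf_action_def
proof (rule unital_Ainf_map_iff[OF assms])
  \<comment> \<open>Points of the mapping space are extensional, which makes the restricted identity
    a two-sided unit for the restricted composition.\<close>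
  fix g assume "g \<in> topspace (mapping_space P P)"
  then have "g \<in> topspace P \<rightarrow> topspace P" "g \<in> extensional (topspace P)"
    by (auto simp: topspace_mapping_space cmaps_def continuous_map_def)
  then show "compose (topspace P) (\<lambda>p\<in>topspace P. p) g = g \<and> compose (topspace P) g (\<lambda>p\<in>topspace P. p) = g"
    by (simp add: Id_compose compose_Id)
qed

lemma delta1_in_K: "delta1 \<in> topspace (K (Suc 0))"
  using topspace_K_1 by simp

lemma (in action_data) units_iff:
  "(\<forall>x. \<forall>a\<in>topspace (pair_family X P x). act [x] x (idop Act_inf x, [a]) = a) \<longleftrightarrow>
     (\<forall>a\<in>topspace X. M 1 (delta1, [a]) = a) \<and> f 0 (delta1, []) = (\<lambda>p\<in>topspace P. p)"
proof -
  have "act [Closed] Closed (closed_op delta1, [Inl a]) = Inl (M 1 (delta1, [a]))" if "a \<in> topspace X" for a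
    using act_closed[OF delta1_in_K, of "[a]"] that by (simp add: in_kpower del: replicate_Suc) simp
  then have "(\<forall>a\<in>topspace (pair_family X P Closed). act [Closed] Closed (idop Act_inf Closed, [a]) = a) \<longleftrightarrow>
      (\<forall>a\<in>topspace X. M 1 (delta1, [a]) = a)"
    by (simp add: pair_family_simps flip: op_delta1)
  moreover have "(\<forall>a\<in>topspace (pair_family X P Open). act [Open] Open (idop Act_inf Open, [a]) = a) \<longleftrightarrow>
      (\<forall>p\<in>topspace P. f 0 (delta1, []) p = p)"
    using act_open[OF delta1_in_K, of "[]"] by (simp add: pair_family_simps in_kpower flip: op_delta1)
  moreover have "(\<forall>p\<in>topspace P. f 0 (delta1, []) p = p) \<longleftrightarrow> f 0 (delta1, []) = (\<lambda>p\<in>topspace P. p)"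
  proof
    assume "\<forall>p\<in>topspace P. f 0 (delta1, []) p = p"
    moreover have "f 0 (delta1, []) \<in> topspace P \<rightarrow>\<^sub>E topspace P"
      using f_in[OF delta1_in_K, of "[]"] by simp
    ultimately show "f 0 (delta1, []) = (\<lambda>p\<in>topspace P. p)"
      by (intro extensionalityI[of _ "topspace P"]) (auto simp: PiE_iff)
  qed simp
  moreover have "(\<forall>x. Q x) \<longleftrightarrow> Q Closed \<and> Q Open" for Q by (metis color.exhaust)
  ultimately show ?thesis by simp
qed

text \<open>The hypothesis on \<open>P\<close> enters through currying, which gives continuity of
  the maps into the mapping space.\<close>

lemma action_data_action_of_algebra:
  assumes alg: "operad_algebra Act_inf (pair_family X P) act" and P: "kify P = P"
  defines "M \<equiv> fst (action_of_algebra X P act)" and "f \<equiv> snd (action_of_algebra X P act)"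
  shows "action_data X P act M f" "Ainf_space X M" "left_Ainf_action X M P f"
proof -
  have act: "continuous_map (kprod (ops Act_inf w x) (word_prod (pair_family X P) w)) (pair_family X P x) (act w x)" for w x
    using alg by (simp add: algebra_iff)
  have M_def': "M n = (\<lambda>(T, xs)\<in>topspace (kprod (K n) (kpower X n)).
        projl (act (replicate n Closed) Closed (closed_op T, map Inl xs)))" for n
    by (simp add: M_def action_of_algebra_def)
  have f_def': "f n = (\<lambda>(T, xs)\<in>topspace (kprod (K (Suc n)) (kpower X n)). \<lambda>p\<in>topspace P.
        projr (act (replicate n Closed @ [Open]) Open (open_op T, map Inl xs @ [Inr p])))" for n
    by (simp add: f_def action_of_algebra_def)
  have act_closed: "continuous_map (kprod (K n) (kpower X n)) (pair_family X P Closed)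
      (\<lambda>(T, xs). act (replicate n Closed) Closed (closed_op T, map Inl xs))" for n
    using continuous_map_compose[OF continuous_map_closed_point act] by (simp add: o_def split_def)
  have act_open: "continuous_map (kprod (kprod (K (Suc n)) (kpower X n)) P) (pair_family X P Open)
      (\<lambda>((T, xs), p). act (replicate n Closed @ [Open]) Open (open_op T, map Inl xs @ [Inr p]))" for n
    using continuous_map_compose[OF continuous_map_open_point act] by (simp add: o_def split_def)
  have M_cont: "continuous_map (kprod (K n) (kpower X n)) X (M n)" for n
    using continuous_map_compose[OF act_closed continuous_map_projl]
    by (rule continuous_map_eq) (auto simp: M_def')
  have f_cont: "continuous_map (kprod (K (Suc n)) (kpower X n)) (mapping_space P P) (f n)" for n
  proof -
    have "continuous_map (kprod (kprod (K (Suc n)) (kpower X n)) P) P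
        (projr \<circ> (\<lambda>((T, xs), p). act (replicate n Closed @ [Open]) Open (open_op T, map Inl xs @ [Inr p])))"
      by (rule continuous_map_compose[OF act_open continuous_map_projr])
    from curry_continuous[OF kify_kprod P this] show ?thesis
      by (rule continuous_map_eq) (auto simp: f_def')
  qed
  show data: "action_data X P act M f"
  proof
    fix n T xs assume *: "T \<in> topspace (K n)" "xs \<in> topspace (kpower X n)"
    then have "act (replicate n Closed) Closed (closed_op T, map Inl xs) \<in> topspace (pair_family X P Closed)"
      using funcset_mem[OF continuous_map_funspace[OF act_closed[of n]], of "(T, xs)"] by simp
    then show "act (replicate n Closed) Closed (closed_op T, map Inl xs) = Inl (M n (T, xs))"
      using * by (auto simp: M_def' pair_family_simps)
    show "M n (T, xs) \<in> topspace X" using M_cont[of n] * by (auto simp: continuous_map_def)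
  next
    fix n T xs assume *: "T \<in> topspace (K (Suc n))" "xs \<in> topspace (kpower X n)"
    then have "f n (T, xs) \<in> cmaps P P"
      using f_cont[of n] by (auto simp: continuous_map_def topspace_mapping_space)
    then show "f n (T, xs) \<in> topspace P \<rightarrow>\<^sub>E topspace P"
      by (auto simp: cmaps_def continuous_map_def PiE_iff)
    fix p assume p: "p \<in> topspace P"
    then have "act (replicate n Closed @ [Open]) Open (open_op T, map Inl xs @ [Inr p]) \<in> topspace (pair_family X P Open)"
      using funcset_mem[OF continuous_map_funspace[OF act_open[of n]], of "((T, xs), p)"] * by simp
    then show "act (replicate n Closed @ [Open]) Open (open_op T, map Inl xs @ [Inr p]) = Inr (f n (T, xs) p)"
      using * p by (auto simp: f_def' pair_family_simps)
  qed
  have comp: "M_comp X M \<and> f_comp X M f \<and> f_mult X (compose (topspace P)) f"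
    and units: "(\<forall>a\<in>topspace X. M 1 (delta1, [a]) = a) \<and> f 0 (delta1, []) = (\<lambda>p\<in>topspace P. p)"
    using alg action_data.act_comp_iff[OF data] action_data.units_iff[OF data] unfolding algebra_iff by blast+
  have "M n \<in> extensional (topspace (kprod (K n) (kpower X n)))"
    "f n \<in> extensional (topspace (kprod (K (Suc n)) (kpower X n)))" for n
    unfolding M_def' f_def' by simp_all
  then show "Ainf_space X M" "left_Ainf_action X M P f"
    using M_cont f_cont comp units left_Ainf_action_iff[of X M P f] unfolding Ainf_space_iff[of X M] by blast+
qed

text \<open>For \<open>Open\<close> the last letter of the word is the open one, hence
  \<open>length w - 1\<close> arguments from \<open>X\<close>. On words of any other shape there are
  no operations, and the map is restricted to the empty set.\<close>

definition algebra_of_action :: "'x topology \<Rightarrow> 'p topology \<Rightarrow> (nat \<Rightarrow> kpoint \<times> 'x list \<Rightarrow> 'x) \<Rightarrow>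
    (nat \<Rightarrow> kpoint \<times> 'x list \<Rightarrow> 'p \<Rightarrow> 'p) \<Rightarrow>
    color list \<Rightarrow> color \<Rightarrow> (color, unit) tree set option \<times> ('x + 'p) list \<Rightarrow> 'x + 'p" where
  "algebra_of_action X P M f w x =
     (\<lambda>(A, xs)\<in>topspace (kprod (ops Act_inf w x) (word_prod (pair_family X P) w)).
        case x of
          Closed \<Rightarrow> Inl (M (length w) (to_kpoint A, map projl xs))
        | Open \<Rightarrow> Inr (f (length w - 1) (to_kpoint A, map projl (butlast xs)) (projr (last xs))))"

text \<open>Here the Hausdorff property of \<open>P\<close> enters, through uncurrying.\<close>

lemma algebra_of_action:
  assumes M: "Ainf_space X M" and f: "left_Ainf_action X M P f" and P: "Hausdorff_space P"
  defines "act \<equiv> algebra_of_action X P M f"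
  shows "operad_algebra Act_inf (pair_family X P) act" "action_of_algebra X P act = (M, f)"
proof -
  have M_cont: "continuous_map (kprod (K n) (kpower X n)) X (M n)"
    and M_ext: "M n \<in> extensional (topspace (kprod (K n) (kpower X n)))" for n
    using M unfolding Ainf_space_iff by blast+
  have f_cont: "continuous_map (kprod (K (Suc n)) (kpower X n)) (mapping_space P P) (f n)"
    and f_ext: "f n \<in> extensional (topspace (kprod (K (Suc n)) (kpower X n)))" for n
    using f unfolding left_Ainf_action_iff[OF M] by blast+
  have f_cmaps: "f n (T, xs) \<in> cmaps P P" if "T \<in> topspace (K (Suc n))" "xs \<in> topspace (kpower X n)" for n T xs
    using f_cont[of n] that by (auto simp: continuous_map_def topspace_mapping_space)
  have act_cont: "continuous_map (kprod (ops Act_inf w x) (word_prod (pair_family X P) w)) (pair_family X P x) (act w x)" for w x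
  proof (cases "topspace (ops Act_inf w x) = {}")
    \<comment> \<open>All words outside the two families fall under this case.\<close>
    case True
    then show ?thesis by (simp add: continuous_map_def)
  next
    case False
    then have "x = Closed \<and> w = replicate (length w) Closed \<or> x = Open \<and> w = replicate (length w - 1) Closed @ [Open]"
      using Act_inf_arity by blast
    then consider n where "x = Closed" "w = replicate n Closed" | n where "x = Open" "w = replicate n Closed @ [Open]"
      by blast
    then show ?thesis
    proof cases
      case (1 n)
      have "continuous_map (kprod (ops Act_inf w x) (word_prod (pair_family X P) w)) (pair_family X P x)
          (Inl \<circ> (M n \<circ> (\<lambda>(A, xs). (to_kpoint A, map projl xs))))"
        unfolding 1 using continuous_map_compose[OF continuous_map_compose[OF continuous_map_closed_point_inv M_cont] continuous_map_Inl] .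
      then show ?thesis
        by (rule continuous_map_eq) (auto simp: act_def algebra_of_action_def 1)
    next
      case (2 n)
      have "continuous_map (kprod (ops Act_inf w x) (word_prod (pair_family X P) w)) (pair_family X P x)
          (Inr \<circ> ((\<lambda>(a, b). f n a b) \<circ> (\<lambda>(A, xs). ((to_kpoint A, map projl (butlast xs)), projr (last xs)))))"
        unfolding 2
        using continuous_map_compose[OF continuous_map_compose[OF continuous_map_open_point_inv uncurry_continuous[OF P f_cont]] continuous_map_Inr] .
      then show ?thesis
        by (rule continuous_map_eq) (auto simp: act_def algebra_of_action_def 2)
    qed
  qed
  have data: "action_data X P act M f"
  proof
    fix n T xs assume *: "T \<in> topspace (K n)" "xs \<in> topspace (kpower X n)"
    then show "act (replicate n Closed) Closed (closed_op T, map Inl xs) = Inl (M n (T, xs))"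
      using closed_op_in[OF *(1)] to_kpoint_op(1)[OF *(1)]
      by (auto simp: act_def algebra_of_action_def in_closed_word o_def)
    show "M n (T, xs) \<in> topspace X" using M_cont[of n] * by (auto simp: continuous_map_def)
  next
    fix n T xs assume *: "T \<in> topspace (K (Suc n))" "xs \<in> topspace (kpower X n)"
    then show "f n (T, xs) \<in> topspace P \<rightarrow>\<^sub>E topspace P"
      using f_cmaps[OF *] by (auto simp: cmaps_def continuous_map_def PiE_iff)
    fix p assume p: "p \<in> topspace P"
    then show "act (replicate n Closed @ [Open]) Open (open_op T, map Inl xs @ [Inr p]) = Inr (f n (T, xs) p)"
      using open_op_in[OF *(1)] to_kpoint_op(2)[OF *(1)] *
      by (auto simp: act_def algebra_of_action_def in_open_word o_def)
  qed
  have act_ext: "act w x \<in> extensional (topspace (kprod (ops Act_inf w x) (word_prod (pair_family X P) w)))" for w x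
    by (simp add: act_def algebra_of_action_def)
  show "operad_algebra Act_inf (pair_family X P) act"
    unfolding algebra_iff action_data.act_comp_iff[OF data] action_data.units_iff[OF data]
    using M f act_cont act_ext unfolding left_Ainf_action_iff[OF M] Ainf_space_iff by blast
  have "fst (action_of_algebra X P act) = M"
  proof
    fix n
    show "fst (action_of_algebra X P act) n = M n"
    proof (rule extensionalityI)
      fix z assume "z \<in> topspace (kprod (K n) (kpower X n))"
      then show "fst (action_of_algebra X P act) n z = M n z"
        using action_data.act_closed[OF data] by (auto simp: action_of_algebra_def)
    qed (use M_ext in \<open>auto simp: action_of_algebra_def\<close>)
  qed
  moreover have "snd (action_of_algebra X P act) = f"
  proof
    fix n
    show "snd (action_of_algebra X P act) n = f n"
    proof (rule extensionalityI)
      fix z assume "z \<in> topspace (kprod (K (Suc n)) (kpower X n))"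
      then obtain T xs where z: "z = (T, xs)" "T \<in> topspace (K (Suc n))" "xs \<in> topspace (kpower X n)" by auto
      \<comment> \<open>The round trip returns the restriction of \<open>f n z\<close> to
        \<open>P\<close>, which is \<open>f n z\<close> itself because points of the mapping space
        are extensional.\<close>
      then have "f n z \<in> extensional (topspace P)" using f_cmaps by (auto simp: cmaps_def)
      moreover have "snd (action_of_algebra X P act) n z = restrict (f n z) (topspace P)"
        using z action_data.act_open[OF data] by (auto simp: action_of_algebra_def)
      ultimately show "snd (action_of_algebra X P act) n z = f n z" by (simp add: extensional_restrict)
    qed (use f_ext in \<open>auto simp: action_of_algebra_def\<close>)
  qed
  ultimately show "action_of_algebra X P act = (M, f)" by (simp add: prod_eq_iff)
qed

text \<open>Every operation comes from a point of some \<open>K n\<close> by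
  \<open>to_kpoint_in\<close>, so \<open>M\<close> and \<open>f\<close> fix all values on the
  domains; outside them extensionality does.\<close>

lemma algebra_eqI:
  assumes "operad_algebra Act_inf (pair_family X P) act" "operad_algebra Act_inf (pair_family X P) act'"
    and data: "action_data X P act M f" "action_data X P act' M f"
  shows "act = act'"
proof (rule ext, rule ext)
  fix w x
  let ?A = "topspace (kprod (ops Act_inf w x) (word_prod (pair_family X P) w))"
  show "act w x = act' w x"
  proof (rule extensionalityI)
    show "act w x \<in> extensional ?A" "act' w x \<in> extensional ?A" using assms(1,2) unfolding algebra_iff by blast+
    fix z assume "z \<in> ?A"
    then obtain A zs where z: "z = (A, zs)" and A: "A \<in> topspace (ops Act_inf w x)"
      and zs: "zs \<in> topspace (word_prod (pair_family X P) w)" by auto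
    note T = to_kpoint_in[OF A]
    from Act_inf_arity[OF A] consider n where "x = Closed" "w = replicate n Closed" | n where "x = Open" "w = replicate n Closed @ [Open]"
      by blast
    then show "act w x z = act' w x z"
    proof cases
      case (1 n)
      then obtain xs where "zs = map Inl xs" "xs \<in> topspace (kpower X n)" using zs by (auto simp: in_closed_word)
      then show ?thesis
        using action_data.act_closed[OF data(1), of "to_kpoint A" n xs] action_data.act_closed[OF data(2), of "to_kpoint A" n xs]
          T 1 z by simp
    next
      case (2 n)
      then obtain xs p where "zs = map Inl xs @ [Inr p]" "xs \<in> topspace (kpower X n)" "p \<in> topspace P"
        using zs by (auto simp: in_open_word)
      then show ?thesis
        using action_data.act_open[OF data(1), of "to_kpoint A" n xs p] action_data.act_open[OF data(2), of "to_kpoint A" n xs p]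
          T 2 z by simp
    qed
  qed
qed

theorem mainTheorem3:
  fixes X :: "'x topology" and P :: "'p topology" and x0 :: 'x and p0 :: 'p
  assumes "cg_space X x0" and "cg_space P p0"
  shows "bij_betw (action_of_algebra X P)
           {act. operad_algebra Act_inf (pair_family X P) act}
           {(M, f). Ainf_space X M \<and> left_Ainf_action X M P f}"
proof (rule bij_betw_imageI)
  \<comment> \<open>The first property is for currying, the second for uncurrying.\<close>
  have P: "kify P = P" "Hausdorff_space P"
    using assms(2) by (auto simp: cg_space_def kify_k_space)
  note fwd = action_data_action_of_algebra[OF _ P(1), of X]
  show "inj_on (action_of_algebra X P) {act. operad_algebra Act_inf (pair_family X P) act}"
  proof (rule inj_onI)
    fix act act'
    assume *: "act \<in> {act. operad_algebra Act_inf (pair_family X P) act}"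
      "act' \<in> {act. operad_algebra Act_inf (pair_family X P) act}"
      "action_of_algebra X P act = action_of_algebra X P act'"
    then show "act = act'" using fwd(1)[of act] fwd(1)[of act'] by (intro algebra_eqI) auto
  qed
  show "action_of_algebra X P ` {act. operad_algebra Act_inf (pair_family X P) act} =
      {(M, f). Ainf_space X M \<and> left_Ainf_action X M P f}"
  proof (intro equalityI subsetI)
    fix z assume "z \<in> action_of_algebra X P ` {act. operad_algebra Act_inf (pair_family X P) act}"
    then show "z \<in> {(M, f). Ainf_space X M \<and> left_Ainf_action X M P f}"
      using fwd(2,3) by (auto simp: case_prod_beta)
  next
    fix z assume "z \<in> {(M, f). Ainf_space X M \<and> left_Ainf_action X M P f}"
    then obtain M f where "z = (M, f)" "Ainf_space X M" "left_Ainf_action X M P f" by auto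
    then show "z \<in> action_of_algebra X P ` {act. operad_algebra Act_inf (pair_family X P) act}"
      using algebra_of_action[OF _ _ P(2), of X M f] by (metis (mono_tags, lifting) image_eqI mem_Collect_eq)
  qed
qed

end
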